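(* Let $K$ be a finite field of characteristic $2$ and let $G$ be a finite $2$-group which has an abelian subgroup $A$ of index $2$ and an element $b\in G\setminus A$ which inverts every element of $A$, i.e. $b^{-1}ab=a^{-1}$ for all $a\in A$. (i) If $b$ has order $2$, then $$|V_*(KG)|=|K|^{\frac{3|A|+|A[2]|-2}{2}}.$$ (ii) If $b$ has order $4$, then $$|V_*(KG)|=2\cdot|A^2[2]|\cdot |K|^{|A|+\frac{1}{2}|A[2]|-1}.$$
   Context: For a group $G$ and a commutative ring $K$ with $1$, $KG$ is the group algebra, and $V(KG)$ is the group of normalized units of $KG$, i.e. units $\sum_{g}\alpha_g g$ with augmentation $\sum_g\alpha_g=1$. The map $*$ is the $K$-linear extension of $g\mapsto g^{-1}$ to an anti-automorphism of $KG$: $(\sum_g\alpha_g g)^*=\sum_g\alpha_g g^{-1}$. The unitary subgroup is $V_*(KG)=\{v\in V(KG)\mid v^*=v^{-1}\}$. For an abelian group $A$, $A[2]=\{a\in A\mid a^2=1\}$, $A^2=\{a^2\mid a\in A\}$, and $A^2[2]=\{x\in A^2\mid x^2=1\}$. *)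

theory Defs
  imports "HOL-Algebra.Algebra"
begin

text \<open>
  Elements of the group algebra \<open>KG\<close> are coefficient functions of finite support on \<open>carrier G\<close>,
  with value \<open>undefined\<close> outside \<open>carrier G\<close>, so that equality of elements is equality of
  functions. Sums range over supports because \<open>finsum\<close> over an infinite set is \<open>\<zero>\<close>; for finite \<open>G\<close>
  this makes no difference.
\<close>

definition gr_support ::
    "('k, 'm) ring_scheme \<Rightarrow> ('g, 'n) monoid_scheme \<Rightarrow> ('g \<Rightarrow> 'k) \<Rightarrow> 'g set"
  where "gr_support K G v = {g \<in> carrier G. v g \<noteq> \<zero>\<^bsub>K\<^esub>}"

text \<open>
  The product is convolution: the coefficient of \<open>u v\<close> at \<open>g\<close> is the sum of \<open>u\<^sub>x v\<^sub>y\<close> over all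
  \<open>x y = g\<close>, i.e. over \<open>x\<close> with \<open>y = x\<^sup>-\<^sup>1 g\<close>.
\<close>

definition group_algebra ::
    "('k, 'm) ring_scheme \<Rightarrow> ('g, 'n) monoid_scheme \<Rightarrow> ('g \<Rightarrow> 'k) ring"
  where "group_algebra K G =
    \<lparr>carrier = {v \<in> carrier G \<rightarrow>\<^sub>E carrier K. finite (gr_support K G v)},
     monoid.mult = (\<lambda>u v. \<lambda>g\<in>carrier G.
       \<Oplus>\<^bsub>K\<^esub>x\<in>gr_support K G u. u x \<otimes>\<^bsub>K\<^esub> v (inv\<^bsub>G\<^esub> x \<otimes>\<^bsub>G\<^esub> g)),
     monoid.one = (\<lambda>g\<in>carrier G. if g = \<one>\<^bsub>G\<^esub> then \<one>\<^bsub>K\<^esub> else \<zero>\<^bsub>K\<^esub>),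
     ring.zero = (\<lambda>g\<in>carrier G. \<zero>\<^bsub>K\<^esub>),
     ring.add = (\<lambda>u v. \<lambda>g\<in>carrier G. u g \<oplus>\<^bsub>K\<^esub> v g)\<rparr>"

definition augmentation ::
    "('k, 'm) ring_scheme \<Rightarrow> ('g, 'n) monoid_scheme \<Rightarrow> ('g \<Rightarrow> 'k) \<Rightarrow> 'k"
  where "augmentation K G v = (\<Oplus>\<^bsub>K\<^esub>g\<in>gr_support K G v. v g)"

text \<open>The coefficient of \<open>(\<Sum>\<alpha>\<^sub>g g)\<^sup>* = \<Sum>\<alpha>\<^sub>g g\<^sup>-\<^sup>1\<close> at \<open>g\<close> is the coefficient of \<open>\<Sum>\<alpha>\<^sub>g g\<close> at \<open>g\<^sup>-\<^sup>1\<close>.\<close>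

definition gr_star :: "('g, 'n) monoid_scheme \<Rightarrow> ('g \<Rightarrow> 'k) \<Rightarrow> 'g \<Rightarrow> 'k"
  where "gr_star G v = (\<lambda>g\<in>carrier G. v (inv\<^bsub>G\<^esub> g))"

definition normalized_units ::
    "('k, 'm) ring_scheme \<Rightarrow> ('g, 'n) monoid_scheme \<Rightarrow> ('g \<Rightarrow> 'k) set"
  where "normalized_units K G =
    {v \<in> Units (group_algebra K G). augmentation K G v = \<one>\<^bsub>K\<^esub>}"

definition unitary_subgroup ::
    "('k, 'm) ring_scheme \<Rightarrow> ('g, 'n) monoid_scheme \<Rightarrow> ('g \<Rightarrow> 'k) set"
  where "unitary_subgroup K G =
    {v \<in> normalized_units K G. gr_star G v = inv\<^bsub>group_algebra K G\<^esub> v}"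

definition two_torsion :: "('g, 'n) monoid_scheme \<Rightarrow> 'g set \<Rightarrow> 'g set"
  where "two_torsion G A = {a \<in> A. a [^]\<^bsub>G\<^esub> (2::nat) = \<one>\<^bsub>G\<^esub>}"

definition squares :: "('g, 'n) monoid_scheme \<Rightarrow> 'g set \<Rightarrow> 'g set"
  where "squares G A = (\<lambda>a. a [^]\<^bsub>G\<^esub> (2::nat)) ` A"

text \<open>\<open>group.ord\<close> is \<open>0\<close> on elements of infinite order, which is the convention for characteristic \<open>0\<close>.\<close>

definition ring_characteristic :: "('k, 'm) ring_scheme \<Rightarrow> nat"
  where "ring_characteristic K = group.ord (add_monoid K) \<one>\<^bsub>K\<^esub>"

end

theory Submission
  imports Defs
begin

text \<open>
  Write an element of \<open>KG\<close> as \<open>x = u + v b\<close> with \<open>u\<close>, \<open>v\<close> in \<open>KA\<close> and put \<open>c = b\<^sup>2\<close>, an element of \<open>A\<close>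
  with \<open>c\<^sup>2 = 1\<close>. As \<open>b u = u\<^sup>* b\<close> and the inverse of \<open>b\<close> is \<open>c b\<close>, one finds
  \<open>x x\<^sup>* = (u u\<^sup>* + v v\<^sup>*) + (1 + c) u v b\<close>. Hence \<open>x\<close> is unitary iff the norms \<open>u u\<^sup>*\<close> and \<open>v v\<^sup>*\<close>
  add up to \<open>1\<close> and \<open>u v\<close> is invariant under translation by \<open>c\<close> (\<open>unitary_iff\<close>). From here on the
  work takes place in \<open>KA\<close>, a commutative ring in which every element of nonzero augmentation is a
  unit.

  If \<open>b\<close> has order \<open>2\<close>, then \<open>c = 1\<close> and only the equation \<open>u u\<^sup>* + v v\<^sup>* = 1\<close> is left. It forces
  \<open>w = u + v\<close> to have augmentation \<open>1\<close>, and the substitution \<open>v = w y\<close> turns it into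
  \<open>y + y\<^sup>* = 1 + w\<^sup>-\<^sup>1 (w\<^sup>-\<^sup>1)\<^sup>*\<close>. The right-hand side is symmetric and vanishes on \<open>A[2]\<close>, so a solution
  exists, and the solutions form a coset of the space of symmetric elements. This gives
  \<open>|K|\<close> to the power \<open>(|A| + |A[2]|)/2\<close> solutions for each of the \<open>|K|\<^sup>|\<^sup>A\<^sup>|\<^sup>-\<^sup>1\<close> choices of \<open>w\<close>
  (\<open>card_norm_pairs\<close>).

  If \<open>b\<close> has order \<open>4\<close>, then \<open>c \<noteq> 1\<close>. Exactly one of \<open>u\<close>, \<open>v\<close> is a unit; the other one is then itself
  invariant under \<open>c\<close>, has norm \<open>0\<close>, and the unit is unitary. So the order sought is
  \<open>2 |V\<^sub>*(KA)|\<close> times the number of invariant elements (\<open>card_norm_pairs_invariant\<close>).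

  It remains to know that \<open>|V\<^sub>*(KA)|\<close> is \<open>|A\<^sup>2[2]|\<close> times \<open>|K|\<close> to the power \<open>(|A| + |A[2]|)/2 - 1\<close>
  (\<open>card_unitary_abelian\<close>). For \<open>A\<close> of exponent \<open>2\<close> all elements are symmetric and the claim is
  clear. Otherwise some \<open>c = g\<^sup>2\<close> has order \<open>2\<close>, and the induction goes from \<open>B = A/\<langle>c\<rangle>\<close> to \<open>A\<close>. An
  element \<open>u\<close> of \<open>KA\<close> becomes unitary in \<open>KB\<close> iff \<open>u u\<^sup>* = 1 + t\<close> with \<open>t\<close> invariant under \<open>c\<close>.
  Products of invariant elements vanish, so multiplying such \<open>u\<close> adds the \<open>t\<close>, and the set of all
  \<open>t\<close> that occur is an additive group \<open>attained\<close>. Its order decides how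
  \<open>V\<^sub>*(KA)\<close> compares with \<open>V\<^sub>*(KB)\<close>. Each \<open>t\<close> is symmetric, invariant, and zero on \<open>A[2]\<close>; the
  elements with these properties form a group \<open>norm_targets\<close> of known order. Explicit elements
  such as \<open>1 + l k (1 + h)\<close> with \<open>h\<^sup>2 = c\<close> show that modulo \<open>attained\<close> every target is congruent to some
  \<open>l (1 + c) g\<close>, and that this is attained whenever \<open>l = x + x\<^sup>2\<close>. If \<open>c\<close> is a fourth power, all
  targets are attained (\<open>attained_eq_norm_targets\<close>). Otherwise \<open>l (1 + c) g\<close> is attained only if
  \<open>l = x + x\<^sup>2\<close>, and half of the targets are attained (\<open>card_norm_targets_eq_double\<close>). The same
  dichotomy governs the change of \<open>|A\<^sup>2[2]|\<close> from \<open>A\<close> to \<open>B\<close>, and the two factors agree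
  (\<open>card_norm_targets_square_torsion\<close>).
\<close>

section \<open>Sums over sets with an involution\<close>

lemma (in abelian_monoid) finsum_swap:
  assumes "finite A" "finite B" "\<And>a b. a \<in> A \<Longrightarrow> b \<in> B \<Longrightarrow> f a b \<in> carrier G"
  shows "(\<Oplus>a\<in>A. \<Oplus>b\<in>B. f a b) = (\<Oplus>b\<in>B. \<Oplus>a\<in>A. f a b)"
  using assms(1,3)
proof (induction A rule: finite_induct)
  case empty
  then show ?case by (simp add: finsum_zero)
next
  case (insert x F)
  have "(\<Oplus>a\<in>insert x F. \<Oplus>b\<in>B. f a b) = (\<Oplus>b\<in>B. f x b) \<oplus> (\<Oplus>b\<in>B. \<Oplus>a\<in>F. f a b)"
    using insert by (subst finsum_insert) (auto intro!: finsum_closed)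
  also have "\<dots> = (\<Oplus>b\<in>B. f x b \<oplus> (\<Oplus>a\<in>F. f a b))"
    using insert by (subst finsum_addf) (auto intro!: finsum_closed)
  also have "\<dots> = (\<Oplus>b\<in>B. \<Oplus>a\<in>insert x F. f a b)"
    using insert by (intro finsum_cong') (auto intro!: finsum_closed add.finprod_insert[symmetric])
  finally show ?case .
qed

lemma (in abelian_monoid) finsum_fibres:
  assumes "finite A" "finite B" "h \<in> A \<rightarrow> B" "f \<in> A \<rightarrow> carrier G"
  shows "(\<Oplus>a\<in>A. f a) = (\<Oplus>b\<in>B. \<Oplus>a\<in>{a \<in> A. h a = b}. f a)"
proof -
  have "(\<Union>b\<in>B. {a \<in> A. h a = b}) = A" using assms(3) by auto
  then show ?thesis
    using add.finprod_UN_disjoint[of B "\<lambda>b. {a \<in> A. h a = b}" f] assms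
    by (fastforce simp: pairwise_def disjnt_def finsum_def)
qed

lemma (in abelian_monoid) finsum_bij_betw:
  assumes "bij_betw h A B" "f \<in> B \<rightarrow> carrier G"
  shows "(\<Oplus>b\<in>B. f b) = (\<Oplus>a\<in>A. f (h a))"
  using assms finsum_reindex[of f h A] by (auto simp: bij_betw_def)

text \<open>
  In characteristic two the two terms of each orbit of length two cancel. Every evaluation of
  a coefficient below rests on this.
\<close>

lemma (in abelian_monoid) finsum_involution:
  assumes two: "\<And>x. x \<in> carrier G \<Longrightarrow> x \<oplus> x = \<zero>"
    and "finite S" "\<And>x. x \<in> S \<Longrightarrow> \<sigma> x \<in> S" "\<And>x. x \<in> S \<Longrightarrow> \<sigma> (\<sigma> x) = x"
    and "f \<in> S \<rightarrow> carrier G" "\<And>x. x \<in> S \<Longrightarrow> f (\<sigma> x) = f x"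
  shows "(\<Oplus>x\<in>S. f x) = (\<Oplus>x\<in>{x \<in> S. \<sigma> x = x}. f x)"
  using assms(2-)
proof (induction "card S" arbitrary: S rule: less_induct)
  case less
  note [simp] = finsum_insert
  show ?case
  proof (cases "\<exists>x\<in>S. \<sigma> x \<noteq> x")
    case False
    then have "{x \<in> S. \<sigma> x = x} = S" by auto
    then show ?thesis by simp
  next
    case True
    then obtain x where x: "x \<in> S" "\<sigma> x \<noteq> x" by auto
    define Y where "Y = S - {x, \<sigma> x}"
    have S: "S = insert x (insert (\<sigma> x) Y)" using x less.prems by (auto simp: Y_def)
    have "finite Y" "x \<notin> Y" "\<sigma> x \<notin> Y" using less.prems by (auto simp: Y_def)
    have "(\<Oplus>x\<in>S. f x) = f x \<oplus> (f (\<sigma> x) \<oplus> (\<Oplus>x\<in>Y. f x))"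
      using S x less.prems(4) \<open>finite Y\<close> \<open>x \<notin> Y\<close> \<open>\<sigma> x \<notin> Y\<close> by simp
    also have "\<dots> = (\<Oplus>x\<in>Y. f x)"
      using x less.prems S by (simp add: a_assoc[symmetric] two Pi_iff finsum_closed)
    also have "\<dots> = (\<Oplus>x\<in>{x \<in> Y. \<sigma> x = x}. f x)"
    proof (rule less.hyps)
      show "card Y < card S" using x less.prems(1) unfolding Y_def
        by (intro psubset_card_mono) auto
      show "\<sigma> y \<in> Y" if "y \<in> Y" for y using that less.prems x unfolding Y_def
        by (metis Diff_iff empty_iff insert_iff)
    qed (use less.prems \<open>finite Y\<close> in \<open>auto simp: Y_def\<close>)
    also have "{x \<in> Y. \<sigma> x = x} = {x \<in> S. \<sigma> x = x}"
      using x less.prems by (auto simp: Y_def)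
    finally show ?thesis .
  qed
qed

text \<open>
  The orbits \<open>{x, \<sigma> x}\<close> of \<open>x\<close> and \<open>\<sigma> x\<close> are the same set, so a choice function on sets picks the
  same representative for both.
\<close>

lemma involution_representatives:
  assumes "\<And>x. x \<in> S \<Longrightarrow> \<sigma> x \<in> S" "\<And>x. x \<in> S \<Longrightarrow> \<sigma> (\<sigma> x) = x"
  obtains r where "\<And>x. x \<in> S \<Longrightarrow> r x = x \<or> r x = \<sigma> x" "\<And>x. x \<in> S \<Longrightarrow> r (\<sigma> x) = r x"
proof
  define r where "r x = (SOME y. y \<in> {x, \<sigma> x})" for x
  have "r x \<in> {x, \<sigma> x}" for x unfolding r_def by (rule someI) blast
  then show "r x = x \<or> r x = \<sigma> x" if "x \<in> S" for x by blast
  show "r (\<sigma> x) = r x" if "x \<in> S" for x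
  proof -
    have "{\<sigma> x, \<sigma> (\<sigma> x)} = {x, \<sigma> x}" using assms(2)[OF that] by auto
    then show ?thesis unfolding r_def by simp
  qed
qed

text \<open>
  An invariant function is determined by free values on one representative per orbit, and the
  number of orbits is half of \<open>|S|\<close> plus the number of fixed points.
\<close>

lemma card_invariant_functions:
  assumes "finite S" and \<sigma>: "\<And>x. x \<in> S \<Longrightarrow> \<sigma> x \<in> S" "\<And>x. x \<in> S \<Longrightarrow> \<sigma> (\<sigma> x) = x"
  shows "\<exists>n. 2 * n = card S + card {x \<in> S. \<sigma> x = x} \<and>
    card {f \<in> S \<rightarrow>\<^sub>E C. \<forall>x\<in>S. f (\<sigma> x) = f x} = card C ^ n"
proof -
  obtain r where r: "\<And>x. x \<in> S \<Longrightarrow> r x = x \<or> r x = \<sigma> x" "\<And>x. x \<in> S \<Longrightarrow> r (\<sigma> x) = r x"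
    using involution_representatives[of S \<sigma>] \<sigma> by blast
  define T where "T = r ` S"
  have TX: "T \<subseteq> S" using r \<sigma> by (force simp: T_def)
  then have "finite T" using assms(1) finite_subset by blast
  have inj: "inj_on \<sigma> T" using TX \<sigma> by (metis inj_on_inverseI subsetD)
  have rr: "r (r x) = r x" if "x \<in> S" for x using r that by metis
  have "T \<union> \<sigma> ` T = S"
  proof
    show "T \<union> \<sigma> ` T \<subseteq> S" using TX \<sigma> by auto
    show "S \<subseteq> T \<union> \<sigma> ` T"
    proof
      fix x assume x: "x \<in> S"
      then consider "r x = x" | "r x = \<sigma> x" using r by blast
      then show "x \<in> T \<union> \<sigma> ` T"
        using x \<sigma> unfolding T_def by cases (metis UnI1 imageI, metis UnI2 imageI)
    qed
  qed
  moreover have "T \<inter> \<sigma> ` T = {x \<in> S. \<sigma> x = x}"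
  proof
    show "T \<inter> \<sigma> ` T \<subseteq> {x \<in> S. \<sigma> x = x}"
    proof
      fix z assume "z \<in> T \<inter> \<sigma> ` T"
      then obtain x y where xy: "x \<in> S" "z = r x" "y \<in> S" "z = \<sigma> (r y)" unfolding T_def by auto
      then have "r z = r y" "r z = z" using rr r TX T_def by (metis image_subset_iff)+
      then show "z \<in> {x \<in> S. \<sigma> x = x}" using xy TX T_def r \<sigma> by auto
    qed
    show "{x \<in> S. \<sigma> x = x} \<subseteq> T \<inter> \<sigma> ` T"
    proof
      fix z assume "z \<in> {x \<in> S. \<sigma> x = x}"
      then have "z \<in> S" "\<sigma> z = z" "r z = z" using r by force+
      then show "z \<in> T \<inter> \<sigma> ` T" unfolding T_def by (metis IntI imageI)
    qed
  qed
  ultimately have n: "2 * card T = card S + card {x \<in> S. \<sigma> x = x}"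
    using card_Un_Int[of T "\<sigma> ` T"] card_image[OF inj] \<open>finite T\<close> by simp
  have "bij_betw (\<lambda>f. restrict f T) {f \<in> S \<rightarrow>\<^sub>E C. \<forall>x\<in>S. f (\<sigma> x) = f x} (T \<rightarrow>\<^sub>E C)"
  proof (rule bij_betw_byWitness[where f' = "\<lambda>f. \<lambda>x\<in>S. f (r x)"])
    show "\<forall>f\<in>{f \<in> S \<rightarrow>\<^sub>E C. \<forall>x\<in>S. f (\<sigma> x) = f x}. (\<lambda>x\<in>S. restrict f T (r x)) = f"
    proof safe
      fix f assume f: "f \<in> S \<rightarrow>\<^sub>E C" "\<forall>x\<in>S. f (\<sigma> x) = f x"
      show "(\<lambda>x\<in>S. restrict f T (r x)) = f"
      proof
        fix x show "(\<lambda>x\<in>S. restrict f T (r x)) x = f x"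
        proof (cases "x \<in> S")
          case True
          then have "restrict f T (r x) = f (r x)" by (simp add: T_def)
          also have "\<dots> = f x" using r(1)[OF True] f True by auto
          finally show ?thesis using True by simp
        next
          case False
          then show ?thesis using PiE_arb[OF f(1) False] by simp
        qed
      qed
    qed
    show "\<forall>f\<in>T \<rightarrow>\<^sub>E C. restrict (\<lambda>x\<in>S. f (r x)) T = f"
    proof
      fix f assume f: "f \<in> T \<rightarrow>\<^sub>E C"
      show "restrict (\<lambda>x\<in>S. f (r x)) T = f"
      proof
        fix x show "restrict (\<lambda>x\<in>S. f (r x)) T x = f x"
          using f TX rr PiE_arb[OF f, of x] by (cases "x \<in> T") (auto simp: T_def)
      qed
    qed
    show "(\<lambda>f. restrict f T) ` {f \<in> S \<rightarrow>\<^sub>E C. \<forall>x\<in>S. f (\<sigma> x) = f x} \<subseteq> T \<rightarrow>\<^sub>E C"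
      using TX by auto
    show "(\<lambda>f. \<lambda>x\<in>S. f (r x)) ` (T \<rightarrow>\<^sub>E C) \<subseteq> {f \<in> S \<rightarrow>\<^sub>E C. \<forall>x\<in>S. f (\<sigma> x) = f x}"
    proof (intro image_subsetI CollectI conjI ballI)
      fix f assume f: "f \<in> T \<rightarrow>\<^sub>E C"
      then show "(\<lambda>x\<in>S. f (r x)) \<in> S \<rightarrow>\<^sub>E C" by (auto simp: T_def)
      show "(\<lambda>x\<in>S. f (r x)) (\<sigma> x) = (\<lambda>x\<in>S. f (r x)) x" if "x \<in> S" for x
        using r(2)[OF that] \<sigma>(1)[OF that] that by simp
    qed
  qed
  then have "card {f \<in> S \<rightarrow>\<^sub>E C. \<forall>x\<in>S. f (\<sigma> x) = f x} = card C ^ card T"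
    by (simp only: bij_betw_same_card card_funcsetE[OF \<open>finite T\<close>])
  then show ?thesis using n by blast
qed

lemma card_eq_card_times_fibre:
  assumes "finite S" "finite Y" "f \<in> S \<rightarrow> Y" "\<And>y. y \<in> Y \<Longrightarrow> card {x \<in> S. f x = y} = k"
  shows "card S = card Y * k"
proof -
  have "S = (\<Union>y\<in>Y. {x \<in> S. f x = y})" using assms(3) by auto
  also have "card \<dots> = (\<Sum>y\<in>Y. card {x \<in> S. f x = y})"
    using assms by (intro card_UN_disjoint) auto
  finally show ?thesis using assms(4) by simp
qed

section \<open>The group algebra of a finite group\<close>

locale finite_group_algebra = K: cring K + G: group G
  for K :: "('k, 'm) ring_scheme" (structure) and G :: "('g, 'n) monoid_scheme" +
  assumes finite_G: "finite (carrier G)"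
begin

abbreviation "R \<equiv> group_algebra K G"
abbreviation "star \<equiv> gr_star G"
abbreviation "aug \<equiv> augmentation K G"

lemma carrier_R: "carrier R = carrier G \<rightarrow>\<^sub>E carrier K"
  using finite_G by (auto simp: group_algebra_def gr_support_def)

lemma coeff_closed [simp]: "u \<in> carrier R \<Longrightarrow> g \<in> carrier G \<Longrightarrow> u g \<in> carrier K"
  by (auto simp: carrier_R)

lemma group_algebra_eqI:
  "u \<in> carrier R \<Longrightarrow> v \<in> carrier R \<Longrightarrow> (\<And>g. g \<in> carrier G \<Longrightarrow> u g = v g) \<Longrightarrow> u = v"
  unfolding carrier_R by (rule PiE_ext)

lemma lambda_in_R: "(\<And>g. g \<in> carrier G \<Longrightarrow> f g \<in> carrier K) \<Longrightarrow> (\<lambda>g\<in>carrier G. f g) \<in> carrier R"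
  by (auto simp: carrier_R)

lemma mult_coeff:
  assumes "u \<in> carrier R" "v \<in> carrier R" "g \<in> carrier G"
  shows "(u \<otimes>\<^bsub>R\<^esub> v) g = (\<Oplus>x\<in>carrier G. u x \<otimes> v (inv\<^bsub>G\<^esub> x \<otimes>\<^bsub>G\<^esub> g))"
proof -
  have "(\<Oplus>x\<in>gr_support K G u. u x \<otimes> v (inv\<^bsub>G\<^esub> x \<otimes>\<^bsub>G\<^esub> g)) =
    (\<Oplus>x\<in>carrier G. u x \<otimes> v (inv\<^bsub>G\<^esub> x \<otimes>\<^bsub>G\<^esub> g))"
    using assms by (intro K.add.finprod_mono_neutral_cong_left) (auto simp: gr_support_def finite_G)
  then show ?thesis using assms(3) by (simp add: group_algebra_def)
qed

lemma add_coeff: "g \<in> carrier G \<Longrightarrow> (u \<oplus>\<^bsub>R\<^esub> v) g = u g \<oplus> v g"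
  by (simp add: group_algebra_def)

lemma zero_coeff: "g \<in> carrier G \<Longrightarrow> \<zero>\<^bsub>R\<^esub> g = \<zero>"
  by (simp add: group_algebra_def)

lemma one_coeff: "g \<in> carrier G \<Longrightarrow> \<one>\<^bsub>R\<^esub> g = (if g = \<one>\<^bsub>G\<^esub> then \<one> else \<zero>)"
  by (simp add: group_algebra_def)

lemma aug_eq: "u \<in> carrier R \<Longrightarrow> aug u = (\<Oplus>g\<in>carrier G. u g)"
  unfolding augmentation_def
  by (intro K.add.finprod_mono_neutral_cong_left) (auto simp: gr_support_def finite_G)

lemma mult_closed: "u \<in> carrier R \<Longrightarrow> v \<in> carrier R \<Longrightarrow> u \<otimes>\<^bsub>R\<^esub> v \<in> carrier R"
proof -
  assume uv: "u \<in> carrier R" "v \<in> carrier R"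
  have "(u \<otimes>\<^bsub>R\<^esub> v) g \<in> carrier K" if "g \<in> carrier G" for g
    using uv that by (auto simp: mult_coeff intro!: K.finsum_closed)
  moreover have "u \<otimes>\<^bsub>R\<^esub> v \<in> extensional (carrier G)" by (simp add: group_algebra_def)
  ultimately show ?thesis unfolding carrier_R by (simp add: PiE_def)
qed

lemma add_closed: "u \<in> carrier R \<Longrightarrow> v \<in> carrier R \<Longrightarrow> u \<oplus>\<^bsub>R\<^esub> v \<in> carrier R"
  by (auto simp: carrier_R) (auto simp: group_algebra_def)

lemma zero_closed: "\<zero>\<^bsub>R\<^esub> \<in> carrier R"
  by (auto simp: carrier_R) (auto simp: group_algebra_def)

lemma one_closed: "\<one>\<^bsub>R\<^esub> \<in> carrier R"
  by (auto simp: carrier_R) (auto simp: group_algebra_def)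

lemma bij_betw_translation: "a \<in> carrier G \<Longrightarrow> bij_betw (\<lambda>x. a \<otimes>\<^bsub>G\<^esub> x) (carrier G) (carrier G)"
  by (rule bij_betw_byWitness[where f' = "\<lambda>x. inv\<^bsub>G\<^esub> a \<otimes>\<^bsub>G\<^esub> x"])
    (auto simp: G.m_assoc[symmetric])

lemma bij_betw_inverse: "bij_betw (\<lambda>x. inv\<^bsub>G\<^esub> x) (carrier G) (carrier G)"
  by (rule bij_betw_byWitness[where f' = "\<lambda>x. inv\<^bsub>G\<^esub> x"]) auto

lemma finsum_translation:
  "a \<in> carrier G \<Longrightarrow> f \<in> carrier G \<rightarrow> carrier K \<Longrightarrow>
    (\<Oplus>x\<in>carrier G. f (a \<otimes>\<^bsub>G\<^esub> x)) = (\<Oplus>x\<in>carrier G. f x)"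
  using K.finsum_bij_betw[OF bij_betw_translation] by metis

lemma finsum_inverse:
  "f \<in> carrier G \<rightarrow> carrier K \<Longrightarrow> (\<Oplus>x\<in>carrier G. f (inv\<^bsub>G\<^esub> x)) = (\<Oplus>x\<in>carrier G. f x)"
  using K.finsum_bij_betw[OF bij_betw_inverse] by metis

lemma mult_assoc:
  assumes [simp]: "u \<in> carrier R" "v \<in> carrier R" "w \<in> carrier R"
  shows "(u \<otimes>\<^bsub>R\<^esub> v) \<otimes>\<^bsub>R\<^esub> w = u \<otimes>\<^bsub>R\<^esub> (v \<otimes>\<^bsub>R\<^esub> w)"
proof (rule group_algebra_eqI)
  fix g assume g [simp]: "g \<in> carrier G"
  let ?i = "\<lambda>x. inv\<^bsub>G\<^esub> x"
  have "((u \<otimes>\<^bsub>R\<^esub> v) \<otimes>\<^bsub>R\<^esub> w) g =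
    (\<Oplus>y\<in>carrier G. (\<Oplus>x\<in>carrier G. u x \<otimes> v (?i x \<otimes>\<^bsub>G\<^esub> y)) \<otimes> w (?i y \<otimes>\<^bsub>G\<^esub> g))"
    by (subst mult_coeff) (auto simp: mult_closed mult_coeff intro!: K.finsum_cong' K.finsum_closed)
  also have "\<dots> = (\<Oplus>y\<in>carrier G. \<Oplus>x\<in>carrier G. u x \<otimes> (v (?i x \<otimes>\<^bsub>G\<^esub> y) \<otimes> w (?i y \<otimes>\<^bsub>G\<^esub> g)))"
    by (intro K.finsum_cong') (auto simp: K.finsum_ldistr finite_G K.m_assoc intro!: K.finsum_closed K.finsum_cong')
  also have "\<dots> = (\<Oplus>x\<in>carrier G. \<Oplus>y\<in>carrier G. u x \<otimes> (v (?i x \<otimes>\<^bsub>G\<^esub> y) \<otimes> w (?i y \<otimes>\<^bsub>G\<^esub> g)))"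
    by (rule K.finsum_swap) (auto simp: finite_G)
  also have "\<dots> = (\<Oplus>x\<in>carrier G. u x \<otimes> (v \<otimes>\<^bsub>R\<^esub> w) (?i x \<otimes>\<^bsub>G\<^esub> g))"
  proof (rule K.finsum_cong')
    fix x assume x [simp]: "x \<in> carrier G"
    have "(\<Oplus>y\<in>carrier G. u x \<otimes> (v (?i x \<otimes>\<^bsub>G\<^esub> y) \<otimes> w (?i y \<otimes>\<^bsub>G\<^esub> g)))
      = u x \<otimes> (\<Oplus>y\<in>carrier G. v (?i x \<otimes>\<^bsub>G\<^esub> y) \<otimes> w (?i y \<otimes>\<^bsub>G\<^esub> g))"
      by (subst K.finsum_rdistr) (auto simp: finite_G)
    also have "(\<Oplus>y\<in>carrier G. v (?i x \<otimes>\<^bsub>G\<^esub> y) \<otimes> w (?i y \<otimes>\<^bsub>G\<^esub> g)) =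
      (\<Oplus>z\<in>carrier G. v (?i x \<otimes>\<^bsub>G\<^esub> (x \<otimes>\<^bsub>G\<^esub> z)) \<otimes> w (?i (x \<otimes>\<^bsub>G\<^esub> z) \<otimes>\<^bsub>G\<^esub> g))"
      by (subst finsum_translation[OF x, symmetric]) auto
    also have "\<dots> = (\<Oplus>z\<in>carrier G. v z \<otimes> w (?i z \<otimes>\<^bsub>G\<^esub> (?i x \<otimes>\<^bsub>G\<^esub> g)))"
      by (intro K.finsum_cong') (auto simp: G.inv_mult_group G.m_assoc[symmetric])
    also have "\<dots> = (v \<otimes>\<^bsub>R\<^esub> w) (?i x \<otimes>\<^bsub>G\<^esub> g)" by (simp add: mult_coeff)
    finally show "(\<Oplus>y\<in>carrier G. u x \<otimes> (v (?i x \<otimes>\<^bsub>G\<^esub> y) \<otimes> w (?i y \<otimes>\<^bsub>G\<^esub> g))) =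
      u x \<otimes> (v \<otimes>\<^bsub>R\<^esub> w) (?i x \<otimes>\<^bsub>G\<^esub> g)" .
  qed (auto simp: mult_closed)
  also have "\<dots> = (u \<otimes>\<^bsub>R\<^esub> (v \<otimes>\<^bsub>R\<^esub> w)) g"
    by (simp add: mult_coeff mult_closed)
  finally show "((u \<otimes>\<^bsub>R\<^esub> v) \<otimes>\<^bsub>R\<^esub> w) g = (u \<otimes>\<^bsub>R\<^esub> (v \<otimes>\<^bsub>R\<^esub> w)) g" .
qed (simp_all add: mult_closed)

text \<open>
  The element \<open>k a\<close> of the group algebra.
\<close>

definition single :: "'k \<Rightarrow> 'g \<Rightarrow> 'g \<Rightarrow> 'k" where
  "single k a = (\<lambda>g\<in>carrier G. if g = a then k else \<zero>)"

lemma single_closed [simp]: "k \<in> carrier K \<Longrightarrow> single k a \<in> carrier R"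
  unfolding single_def by (rule lambda_in_R) auto

lemma single_coeff: "g \<in> carrier G \<Longrightarrow> single k a g = (if g = a then k else \<zero>)"
  by (simp add: single_def)

lemma one_eq_single: "\<one>\<^bsub>R\<^esub> = single \<one> \<one>\<^bsub>G\<^esub>"
  by (simp add: group_algebra_def single_def)

lemma single_mult_coeff:
  assumes [simp]: "k \<in> carrier K" "a \<in> carrier G" "u \<in> carrier R" "g \<in> carrier G"
  shows "(single k a \<otimes>\<^bsub>R\<^esub> u) g = k \<otimes> u (inv\<^bsub>G\<^esub> a \<otimes>\<^bsub>G\<^esub> g)"
proof -
  have "(single k a \<otimes>\<^bsub>R\<^esub> u) g =
      (\<Oplus>x\<in>carrier G. if x = a then k \<otimes> u (inv\<^bsub>G\<^esub> x \<otimes>\<^bsub>G\<^esub> g) else \<zero>)"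
    by (subst mult_coeff) (auto simp: single_coeff intro!: K.finsum_cong')
  also have "\<dots> = k \<otimes> u (inv\<^bsub>G\<^esub> a \<otimes>\<^bsub>G\<^esub> g)"
    using K.add.finprod_singleton_swap[of a "carrier G" "\<lambda>x. k \<otimes> u (inv\<^bsub>G\<^esub> x \<otimes>\<^bsub>G\<^esub> g)"]
    by (auto simp: finite_G finsum_def)
  finally show ?thesis .
qed

lemma single_mult_single:
  assumes [simp]: "k \<in> carrier K" "l \<in> carrier K" "a \<in> carrier G" "b \<in> carrier G"
  shows "single k a \<otimes>\<^bsub>R\<^esub> single l b = single (k \<otimes> l) (a \<otimes>\<^bsub>G\<^esub> b)"
proof (rule group_algebra_eqI)
  fix g assume [simp]: "g \<in> carrier G"
  have "inv\<^bsub>G\<^esub> a \<otimes>\<^bsub>G\<^esub> g = b \<longleftrightarrow> g = a \<otimes>\<^bsub>G\<^esub> b"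
    using G.inv_solve_left' by auto
  then show "(single k a \<otimes>\<^bsub>R\<^esub> single l b) g = single (k \<otimes> l) (a \<otimes>\<^bsub>G\<^esub> b) g"
    by (simp add: single_mult_coeff single_coeff)
qed (simp_all add: mult_closed)

lemma l_one: "u \<in> carrier R \<Longrightarrow> \<one>\<^bsub>R\<^esub> \<otimes>\<^bsub>R\<^esub> u = u"
  by (rule group_algebra_eqI) (simp_all add: mult_closed one_eq_single single_mult_coeff)

lemma r_one:
  assumes [simp]: "u \<in> carrier R"
  shows "u \<otimes>\<^bsub>R\<^esub> \<one>\<^bsub>R\<^esub> = u"
proof (rule group_algebra_eqI)
  fix g assume [simp]: "g \<in> carrier G"
  have "(u \<otimes>\<^bsub>R\<^esub> \<one>\<^bsub>R\<^esub>) g = (\<Oplus>x\<in>carrier G. if x = g then u x else \<zero>)"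
  proof (subst mult_coeff)
    have "inv\<^bsub>G\<^esub> x \<otimes>\<^bsub>G\<^esub> g = \<one>\<^bsub>G\<^esub> \<longleftrightarrow> x = g" if "x \<in> carrier G" for x
      using that G.inv_equality[of "inv\<^bsub>G\<^esub> x" g] G.inv_inv[of x] G.inv_inv[of g] by auto
    then show "(\<Oplus>x\<in>carrier G. u x \<otimes> \<one>\<^bsub>R\<^esub> (inv\<^bsub>G\<^esub> x \<otimes>\<^bsub>G\<^esub> g)) =
        (\<Oplus>x\<in>carrier G. if x = g then u x else \<zero>)"
      by (intro K.finsum_cong') (auto simp: one_coeff)
  qed (simp_all add: one_closed)
  also have "\<dots> = u g"
    using K.add.finprod_singleton_swap[of g "carrier G" u] by (auto simp: finite_G finsum_def)
  finally show "(u \<otimes>\<^bsub>R\<^esub> \<one>\<^bsub>R\<^esub>) g = u g" .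
qed (simp_all add: mult_closed one_closed)

lemma ring_group_algebra: "ring R"
proof (rule ringI)
  show "abelian_group R"
  proof (rule abelian_groupI)
    fix u assume u: "u \<in> carrier R"
    show "\<exists>v\<in>carrier R. v \<oplus>\<^bsub>R\<^esub> u = \<zero>\<^bsub>R\<^esub>"
    proof
      show c: "(\<lambda>g\<in>carrier G. \<ominus> u g) \<in> carrier R" using u by (intro lambda_in_R) auto
      show "(\<lambda>g\<in>carrier G. \<ominus> u g) \<oplus>\<^bsub>R\<^esub> u = \<zero>\<^bsub>R\<^esub>"
        using u c by (intro group_algebra_eqI) (auto simp: add_closed zero_closed add_coeff zero_coeff K.l_neg)
    qed
  qed (auto simp: add_closed zero_closed add_coeff zero_coeff K.a_ac intro!: group_algebra_eqI)
  show "monoid R"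
    by (rule monoidI) (auto simp: mult_closed one_closed mult_assoc l_one r_one)
next
  fix u v w assume [simp]: "u \<in> carrier R" "v \<in> carrier R" "w \<in> carrier R"
  show "(u \<oplus>\<^bsub>R\<^esub> v) \<otimes>\<^bsub>R\<^esub> w = u \<otimes>\<^bsub>R\<^esub> w \<oplus>\<^bsub>R\<^esub> v \<otimes>\<^bsub>R\<^esub> w"
  proof (rule group_algebra_eqI)
    fix g assume [simp]: "g \<in> carrier G"
    show "((u \<oplus>\<^bsub>R\<^esub> v) \<otimes>\<^bsub>R\<^esub> w) g = (u \<otimes>\<^bsub>R\<^esub> w \<oplus>\<^bsub>R\<^esub> v \<otimes>\<^bsub>R\<^esub> w) g"
    proof -
      have "((u \<oplus>\<^bsub>R\<^esub> v) \<otimes>\<^bsub>R\<^esub> w) g =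
          (\<Oplus>x\<in>carrier G. u x \<otimes> w (inv\<^bsub>G\<^esub> x \<otimes>\<^bsub>G\<^esub> g) \<oplus> v x \<otimes> w (inv\<^bsub>G\<^esub> x \<otimes>\<^bsub>G\<^esub> g))"
        by (subst mult_coeff, (simp add: add_closed; fail)+, intro K.finsum_cong') (auto simp: add_coeff K.l_distr)
      also have "\<dots> = (u \<otimes>\<^bsub>R\<^esub> w \<oplus>\<^bsub>R\<^esub> v \<otimes>\<^bsub>R\<^esub> w) g"
        by (simp add: mult_coeff add_coeff K.finsum_addf Pi_def)
      finally show ?thesis .
    qed
  qed (simp_all add: mult_closed add_closed)
  show "w \<otimes>\<^bsub>R\<^esub> (u \<oplus>\<^bsub>R\<^esub> v) = w \<otimes>\<^bsub>R\<^esub> u \<oplus>\<^bsub>R\<^esub> w \<otimes>\<^bsub>R\<^esub> v"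
  proof (rule group_algebra_eqI)
    fix g assume [simp]: "g \<in> carrier G"
    show "(w \<otimes>\<^bsub>R\<^esub> (u \<oplus>\<^bsub>R\<^esub> v)) g = (w \<otimes>\<^bsub>R\<^esub> u \<oplus>\<^bsub>R\<^esub> w \<otimes>\<^bsub>R\<^esub> v) g"
    proof -
      have "(w \<otimes>\<^bsub>R\<^esub> (u \<oplus>\<^bsub>R\<^esub> v)) g =
          (\<Oplus>x\<in>carrier G. w x \<otimes> u (inv\<^bsub>G\<^esub> x \<otimes>\<^bsub>G\<^esub> g) \<oplus> w x \<otimes> v (inv\<^bsub>G\<^esub> x \<otimes>\<^bsub>G\<^esub> g))"
        by (subst mult_coeff, (simp add: add_closed; fail)+, intro K.finsum_cong') (auto simp: add_coeff K.r_distr)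
      also have "\<dots> = (w \<otimes>\<^bsub>R\<^esub> u \<oplus>\<^bsub>R\<^esub> w \<otimes>\<^bsub>R\<^esub> v) g"
        by (simp add: mult_coeff add_coeff K.finsum_addf Pi_def)
      finally show ?thesis .
    qed
  qed (simp_all add: mult_closed add_closed)
qed

sublocale R: ring R by (rule ring_group_algebra)

lemma aug_closed [simp]: "u \<in> carrier R \<Longrightarrow> aug u \<in> carrier K"
  by (auto simp: aug_eq intro!: K.finsum_closed)

lemma aug_add: "u \<in> carrier R \<Longrightarrow> v \<in> carrier R \<Longrightarrow> aug (u \<oplus>\<^bsub>R\<^esub> v) = aug u \<oplus> aug v"
  by (simp add: aug_eq add_coeff add_closed Pi_def K.finsum_addf cong: K.finsum_cong)

lemma aug_mult:
  assumes [simp]: "u \<in> carrier R" "v \<in> carrier R"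
  shows "aug (u \<otimes>\<^bsub>R\<^esub> v) = aug u \<otimes> aug v"
proof -
  have "aug (u \<otimes>\<^bsub>R\<^esub> v) = (\<Oplus>g\<in>carrier G. \<Oplus>x\<in>carrier G. u x \<otimes> v (inv\<^bsub>G\<^esub> x \<otimes>\<^bsub>G\<^esub> g))"
    by (simp add: aug_eq) (auto simp: mult_coeff intro!: K.finsum_cong' K.finsum_closed)
  also have "\<dots> = (\<Oplus>x\<in>carrier G. \<Oplus>g\<in>carrier G. u x \<otimes> v (inv\<^bsub>G\<^esub> x \<otimes>\<^bsub>G\<^esub> g))"
    by (rule K.finsum_swap) (auto simp: finite_G)
  also have "\<dots> = (\<Oplus>x\<in>carrier G. u x \<otimes> aug v)"
  proof (rule K.finsum_cong')
    fix x assume x [simp]: "x \<in> carrier G"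
    have "(\<Oplus>g\<in>carrier G. v (inv\<^bsub>G\<^esub> x \<otimes>\<^bsub>G\<^esub> g)) = aug v"
      by (subst finsum_translation) (auto simp: aug_eq)
    then show "(\<Oplus>g\<in>carrier G. u x \<otimes> v (inv\<^bsub>G\<^esub> x \<otimes>\<^bsub>G\<^esub> g)) = u x \<otimes> aug v"
      by (subst K.finsum_rdistr[symmetric]) (auto simp: finite_G)
  qed auto
  also have "\<dots> = aug u \<otimes> aug v"
    by (subst K.finsum_ldistr[symmetric]) (auto simp: finite_G aug_eq)
  finally show ?thesis .
qed

lemma aug_single: "k \<in> carrier K \<Longrightarrow> a \<in> carrier G \<Longrightarrow> aug (single k a) = k"
  using K.add.finprod_singleton_swap[of a "carrier G" "\<lambda>_. k"]
  by (auto simp: aug_eq finite_G finsum_def single_coeff cong: K.finsum_cong[unfolded finsum_def])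

lemma aug_one: "aug \<one>\<^bsub>R\<^esub> = \<one>"
  by (simp add: one_eq_single aug_single)

lemma star_coeff: "g \<in> carrier G \<Longrightarrow> star u g = u (inv\<^bsub>G\<^esub> g)"
  by (simp add: gr_star_def)

lemma star_closed [simp]: "u \<in> carrier R \<Longrightarrow> star u \<in> carrier R"
  unfolding gr_star_def by (rule lambda_in_R) simp

lemma star_star: "u \<in> carrier R \<Longrightarrow> star (star u) = u"
  by (rule group_algebra_eqI) (simp_all add: star_coeff)

lemma star_add: "u \<in> carrier R \<Longrightarrow> v \<in> carrier R \<Longrightarrow> star (u \<oplus>\<^bsub>R\<^esub> v) = star u \<oplus>\<^bsub>R\<^esub> star v"
  by (rule group_algebra_eqI) (simp_all add: star_coeff add_coeff)

lemma star_single: "k \<in> carrier K \<Longrightarrow> a \<in> carrier G \<Longrightarrow> star (single k a) = single k (inv\<^bsub>G\<^esub> a)"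
  by (rule group_algebra_eqI) (auto simp: star_coeff single_coeff)

lemma aug_star: "u \<in> carrier R \<Longrightarrow> aug (star u) = aug u"
  by (simp add: aug_eq star_coeff Pi_def finsum_inverse cong: K.finsum_cong)

text \<open>
  The coefficients of \<open>u v\<^sup>*\<close> are correlation sums, free of inverses of the summation variable.
\<close>

lemma norm_coeff:
  assumes [simp]: "u \<in> carrier R" "v \<in> carrier R" "g \<in> carrier G"
  shows "(u \<otimes>\<^bsub>R\<^esub> star v) g = (\<Oplus>x\<in>carrier G. u x \<otimes> v (inv\<^bsub>G\<^esub> g \<otimes>\<^bsub>G\<^esub> x))"
  by (subst mult_coeff) (auto simp: star_coeff G.inv_mult_group intro!: K.finsum_cong')

end

section \<open>Coefficients in characteristic two\<close>

locale char2_group_algebra = finite_group_algebra K G + K: field K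
  for K :: "('k, 'm) ring_scheme" (structure) and G :: "('g, 'n) monoid_scheme" +
  assumes finite_K: "finite (carrier K)" and one_one: "\<one> \<oplus> \<one> = \<zero>"
begin

lemma K_double: "x \<in> carrier K \<Longrightarrow> x \<oplus> x = \<zero>"
  using K.l_distr[of \<one> \<one> x] one_one by simp

lemma K_double_left: "x \<in> carrier K \<Longrightarrow> y \<in> carrier K \<Longrightarrow> x \<oplus> (x \<oplus> y) = y"
  by (simp add: K.a_assoc[symmetric] K_double)

lemmas K_add_ac = K.a_ac K_double K_double_left

lemma R_double: "u \<in> carrier R \<Longrightarrow> u \<oplus>\<^bsub>R\<^esub> u = \<zero>\<^bsub>R\<^esub>"
  by (rule group_algebra_eqI) (simp_all add: add_coeff zero_coeff K_double)

lemma R_double_left: "u \<in> carrier R \<Longrightarrow> v \<in> carrier R \<Longrightarrow> u \<oplus>\<^bsub>R\<^esub> (u \<oplus>\<^bsub>R\<^esub> v) = v"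
  by (simp add: R.a_assoc[symmetric] R_double)

lemmas R_add_ac = R.a_ac R_double R_double_left

lemma K_eq_iff: "x \<in> carrier K \<Longrightarrow> y \<in> carrier K \<Longrightarrow> x \<oplus> y = \<zero> \<longleftrightarrow> x = y"
  by (metis K_double K_double_left K.r_zero)

lemma R_eq_iff: "u \<in> carrier R \<Longrightarrow> v \<in> carrier R \<Longrightarrow> u \<oplus>\<^bsub>R\<^esub> v = \<zero>\<^bsub>R\<^esub> \<longleftrightarrow> u = v"
  by (metis R_double R_double_left R.r_zero)

lemma K_square_add:
  "x \<in> carrier K \<Longrightarrow> y \<in> carrier K \<Longrightarrow> (x \<oplus> y) \<otimes> (x \<oplus> y) = x \<otimes> x \<oplus> y \<otimes> y"
  by (simp add: K.l_distr K.r_distr K.m_comm K_add_ac)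

lemma K_square_inj:
  assumes "x \<in> carrier K" "y \<in> carrier K" "x \<otimes> x = y \<otimes> y"
  shows "x = y"
proof -
  have "(x \<oplus> y) \<otimes> (x \<oplus> y) = \<zero>"
    unfolding K_square_add[OF assms(1,2)] assms(3) using assms(2) by (simp add: K_double)
  then have "x \<oplus> y = \<zero>" using K.integral[of "x \<oplus> y" "x \<oplus> y"] assms(1,2) by simp
  then show ?thesis by (simp only: K_eq_iff[OF assms(1,2)])
qed

text \<open>
  The Frobenius map of a finite field is bijective.
\<close>

lemma K_square_surj:
  assumes "x \<in> carrier K"
  obtains y where "y \<in> carrier K" "x = y \<otimes> y"
proof -
  have "(\<lambda>y. y \<otimes> y) ` carrier K = carrier K"
    by (rule endo_inj_surj[OF finite_K]) (auto intro: inj_onI K_square_inj)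
  then show ?thesis using assms that by blast
qed

lemma K_pow_nonzero: "x \<in> carrier K \<Longrightarrow> x \<noteq> \<zero> \<Longrightarrow> x [^] (n::nat) \<noteq> \<zero>"
  by (induction n) (auto simp: K.integral_iff)

lemma finite_R: "finite (carrier R)"
  unfolding carrier_R by (rule finite_PiE) (auto simp: finite_G finite_K)

lemma card_R: "card (carrier R) = card (carrier K) ^ card (carrier G)"
  unfolding carrier_R by (simp add: card_funcsetE finite_G)

lemma K_involution:
  assumes "finite S" "\<And>x. x \<in> S \<Longrightarrow> \<sigma> x \<in> S" "\<And>x. x \<in> S \<Longrightarrow> \<sigma> (\<sigma> x) = x"
    and "f \<in> S \<rightarrow> carrier K" "\<And>x. x \<in> S \<Longrightarrow> f (\<sigma> x) = f x"
  shows "(\<Oplus>x\<in>S. f x) = (\<Oplus>x\<in>{x \<in> S. \<sigma> x = x}. f x)"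
  using assms by (intro K.finsum_involution) (auto simp: K_double)

lemma card_aug_one:
  "card (carrier K) * card {w \<in> carrier R. aug w = \<one>} = card (carrier K) ^ card (carrier G)"
proof -
  have "card {w \<in> carrier R. aug w = k} = card {w \<in> carrier R. aug w = \<one>}"
    if k: "k \<in> carrier K" for k
  proof -
    \<comment> \<open>adding a suitable scalar exchanges augmentation \<open>k\<close> and augmentation \<open>1\<close>\<close>
    let ?t = "\<lambda>w. w \<oplus>\<^bsub>R\<^esub> single (k \<oplus> \<one>) \<one>\<^bsub>G\<^esub>"
    have "bij_betw ?t {w \<in> carrier R. aug w = k} {w \<in> carrier R. aug w = \<one>}"
    proof (rule bij_betw_byWitness[where f' = ?t])
    show "\<forall>w\<in>{w \<in> carrier R. aug w = k}. ?t (?t w) = w"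
      "\<forall>w\<in>{w \<in> carrier R. aug w = \<one>}. ?t (?t w) = w"
      using k by (auto simp: R_add_ac)
    show "?t ` {w \<in> carrier R. aug w = k} \<subseteq> {w \<in> carrier R. aug w = \<one>}"
      "?t ` {w \<in> carrier R. aug w = \<one>} \<subseteq> {w \<in> carrier R. aug w = k}"
      using k by (auto simp: aug_add aug_single K_add_ac)
    qed
    then show ?thesis by (rule bij_betw_same_card)
  qed
  then have "card (carrier R) = card (carrier K) * card {w \<in> carrier R. aug w = \<one>}"
    by (intro card_eq_card_times_fibre[OF finite_R finite_K, of aug] Pi_I aug_closed)
  then show ?thesis by (simp only: card_R)
qed

text \<open>
  The image of the Artin--Schreier map, whose kernel is the prime field.
\<close>

definition "artin_schreier = (\<lambda>x. x \<oplus> x \<otimes> x) ` carrier K"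

lemma artin_schreier_subset: "artin_schreier \<subseteq> carrier K"
  by (auto simp: artin_schreier_def)

lemma artin_schreier_add:
  assumes "x \<in> artin_schreier" "y \<in> artin_schreier"
  shows "x \<oplus> y \<in> artin_schreier"
proof -
  obtain a b where ab: "a \<in> carrier K" "x = a \<oplus> a \<otimes> a" "b \<in> carrier K" "y = b \<oplus> b \<otimes> b"
    using assms by (auto simp: artin_schreier_def)
  then have "x \<oplus> y = (a \<oplus> b) \<oplus> (a \<oplus> b) \<otimes> (a \<oplus> b)"
    by (simp add: K_square_add K.a_ac)
  then show ?thesis unfolding artin_schreier_def using ab by blast
qed

text \<open>
  The fibres of \<open>x \<mapsto> x + x\<^sup>2\<close> are the pairs \<open>{a, a + 1}\<close>, so its image has half the order of \<open>K\<close>.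
\<close>

lemma artin_schreier_index_two:
  obtains l where "l \<in> carrier K" "l \<notin> artin_schreier"
    "\<And>x. x \<in> carrier K \<Longrightarrow> x \<in> artin_schreier \<or> x \<oplus> l \<in> artin_schreier"
proof -
  let ?P = "artin_schreier" and ?f = "\<lambda>x. x \<oplus> x \<otimes> x"
  have fin: "finite ?P" using artin_schreier_subset finite_K finite_subset by blast
  have "card {x \<in> carrier K. ?f x = y} = 2" if y: "y \<in> ?P" for y
  proof -
    obtain a where a: "a \<in> carrier K" "y = ?f a" using y by (auto simp: artin_schreier_def)
    have "{x \<in> carrier K. ?f x = y} = {a, a \<oplus> \<one>}"
    proof
      show "{x \<in> carrier K. ?f x = y} \<subseteq> {a, a \<oplus> \<one>}"
      proof
        fix x assume "x \<in> {x \<in> carrier K. ?f x = y}"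
        then have x: "x \<in> carrier K" "?f x = ?f a" using a by auto
        \<comment> \<open>\<open>x + x\<^sup>2 = a + a\<^sup>2\<close> says that \<open>x + a\<close> is a root of \<open>X (X + 1)\<close>\<close>
        have "(x \<oplus> a) \<otimes> ((x \<oplus> a) \<oplus> \<one>) = ?f x \<oplus> ?f a"
          using x(1) a(1) by (simp add: K.l_distr K.r_distr K.m_comm K_add_ac)
        also have "\<dots> = \<zero>" unfolding x(2) using a(1) by (simp add: K_double)
        finally have "x \<oplus> a = \<zero> \<or> (x \<oplus> a) \<oplus> \<one> = \<zero>"
          using x(1) a(1) by (simp add: K.integral_iff)
        then have "x = a \<or> x \<oplus> a = \<one>" using x(1) a(1) by (simp add: K_eq_iff)
        moreover have "x = a \<oplus> (x \<oplus> a)" using x(1) a(1) by (simp add: K_add_ac)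
        ultimately show "x \<in> {a, a \<oplus> \<one>}" by auto
      qed
      show "{a, a \<oplus> \<one>} \<subseteq> {x \<in> carrier K. ?f x = y}"
        using a by (auto simp: K.l_distr K.r_distr K_add_ac)
    qed
    moreover have "a \<noteq> a \<oplus> \<one>"
    proof
      assume "a = a \<oplus> \<one>"
      then have "a \<oplus> a = a \<oplus> (a \<oplus> \<one>)" by simp
      then show False using a(1) by (simp add: K_double K_double_left)
    qed
    ultimately show ?thesis by simp
  qed
  then have card: "card (carrier K) = card ?P * 2"
    by (intro card_eq_card_times_fibre[where f = ?f]) (auto simp: finite_K fin artin_schreier_def)
  moreover have "card ?P > 0" using fin by (auto simp: card_gt_0_iff artin_schreier_def)
  ultimately obtain l where l: "l \<in> carrier K" "l \<notin> ?P"
    using artin_schreier_subset by (metis less_irrefl mult_2_right nat_add_left_cancel_less add_0_right subset_antisym subsetI)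
  let ?Q = "(\<lambda>x. x \<oplus> l) ` ?P"
  have inj: "inj_on (\<lambda>x. x \<oplus> l) ?P"
    using artin_schreier_subset l by (auto simp: inj_on_def subset_iff)
  have "?P \<inter> ?Q = {}"
  proof -
    have "l \<in> ?P" if "x \<in> ?P" "x \<oplus> l \<in> ?P" for x
      using artin_schreier_add[OF that] that(1) l artin_schreier_subset by (auto simp: K_add_ac subset_iff)
    then show ?thesis using l by auto
  qed
  then have "card (?P \<union> ?Q) = card (carrier K)"
    using fin card card_image[OF inj] by (simp add: card_Un_disjoint)
  moreover have "?P \<union> ?Q \<subseteq> carrier K" using artin_schreier_subset l by auto
  ultimately have "?P \<union> ?Q = carrier K" by (intro card_subset_eq[OF finite_K])
  then have "x \<in> ?P \<or> x \<oplus> l \<in> ?P" if x: "x \<in> carrier K" for x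
  proof -
    have "x \<in> ?P \<union> ?Q" using \<open>?P \<union> ?Q = carrier K\<close> x by simp
    moreover have "y \<oplus> l \<oplus> l = y" if "y \<in> ?P" for y
      using that artin_schreier_subset l(1) by (auto simp: K.a_assoc K_double)
    ultimately show ?thesis by auto
  qed
  then show ?thesis using l that by blast
qed

end

section \<open>Norms and units in the group algebra of an abelian 2-group\<close>

locale abelian_2_group_algebra = char2_group_algebra K G + G: comm_group G
  for K :: "('k, 'm) ring_scheme" (structure) and G :: "('g, 'n) monoid_scheme" +
  fixes m :: nat
  assumes card_G: "card (carrier G) = 2 ^ m"
begin

lemma mult_comm:
  assumes [simp]: "u \<in> carrier R" "v \<in> carrier R"
  shows "u \<otimes>\<^bsub>R\<^esub> v = v \<otimes>\<^bsub>R\<^esub> u"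
proof (rule group_algebra_eqI)
  fix g assume [simp]: "g \<in> carrier G"
  have "bij_betw (\<lambda>x. inv\<^bsub>G\<^esub> x \<otimes>\<^bsub>G\<^esub> g) (carrier G) (carrier G)"
    by (rule bij_betw_byWitness[where f' = "\<lambda>x. inv\<^bsub>G\<^esub> x \<otimes>\<^bsub>G\<^esub> g"])
      (auto simp: G.inv_mult_group G.m_ac G.m_assoc[symmetric])
  note * = K.finsum_bij_betw[OF this]
  have "(\<Oplus>x\<in>carrier G. u x \<otimes> v (inv\<^bsub>G\<^esub> x \<otimes>\<^bsub>G\<^esub> g)) =
    (\<Oplus>x\<in>carrier G. u (inv\<^bsub>G\<^esub> x \<otimes>\<^bsub>G\<^esub> g) \<otimes> v (inv\<^bsub>G\<^esub> (inv\<^bsub>G\<^esub> x \<otimes>\<^bsub>G\<^esub> g) \<otimes>\<^bsub>G\<^esub> g))"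
    by (rule *) auto
  also have "\<dots> = (\<Oplus>x\<in>carrier G. v x \<otimes> u (inv\<^bsub>G\<^esub> x \<otimes>\<^bsub>G\<^esub> g))"
  proof (rule K.finsum_cong')
    fix x assume [simp]: "x \<in> carrier G"
    have "inv\<^bsub>G\<^esub> (inv\<^bsub>G\<^esub> x \<otimes>\<^bsub>G\<^esub> g) \<otimes>\<^bsub>G\<^esub> g = x"
      by (simp add: G.inv_mult_group G.m_comm G.m_assoc[symmetric])
    then show "u (inv\<^bsub>G\<^esub> x \<otimes>\<^bsub>G\<^esub> g) \<otimes> v (inv\<^bsub>G\<^esub> (inv\<^bsub>G\<^esub> x \<otimes>\<^bsub>G\<^esub> g) \<otimes>\<^bsub>G\<^esub> g) =
        v x \<otimes> u (inv\<^bsub>G\<^esub> x \<otimes>\<^bsub>G\<^esub> g)"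
      by (simp add: K.m_comm)
  qed auto
  finally show "(u \<otimes>\<^bsub>R\<^esub> v) g = (v \<otimes>\<^bsub>R\<^esub> u) g" by (simp add: mult_coeff)
qed simp_all

sublocale R: cring R
  by (rule cring.intro[OF ring_group_algebra])
    (auto intro!: comm_monoid.intro comm_monoid_axioms.intro simp: R.monoid_axioms mult_comm)

lemma star_mult:
  assumes [simp]: "u \<in> carrier R" "v \<in> carrier R"
  shows "star (u \<otimes>\<^bsub>R\<^esub> v) = star u \<otimes>\<^bsub>R\<^esub> star v"
proof (rule group_algebra_eqI)
  fix g assume [simp]: "g \<in> carrier G"
  have "star (u \<otimes>\<^bsub>R\<^esub> v) g = (\<Oplus>x\<in>carrier G. u x \<otimes> v (inv\<^bsub>G\<^esub> x \<otimes>\<^bsub>G\<^esub> inv\<^bsub>G\<^esub> g))"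
    by (simp add: star_coeff mult_coeff)
  also have "\<dots> = (\<Oplus>x\<in>carrier G. u (inv\<^bsub>G\<^esub> x) \<otimes> v (inv\<^bsub>G\<^esub> (inv\<^bsub>G\<^esub> x) \<otimes>\<^bsub>G\<^esub> inv\<^bsub>G\<^esub> g))"
    by (rule finsum_inverse[symmetric]) auto
  also have "\<dots> = (\<Oplus>x\<in>carrier G. star u x \<otimes> star v (inv\<^bsub>G\<^esub> x \<otimes>\<^bsub>G\<^esub> g))"
    by (intro K.finsum_cong') (auto simp: star_coeff G.inv_mult)
  finally show "star (u \<otimes>\<^bsub>R\<^esub> v) g = (star u \<otimes>\<^bsub>R\<^esub> star v) g" by (simp add: mult_coeff)
qed simp_all

definition norm where "norm u = u \<otimes>\<^bsub>R\<^esub> star u"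

lemma norm_closed [simp]: "u \<in> carrier R \<Longrightarrow> norm u \<in> carrier R"
  by (simp add: norm_def)

lemma norm_mult: "u \<in> carrier R \<Longrightarrow> v \<in> carrier R \<Longrightarrow> norm (u \<otimes>\<^bsub>R\<^esub> v) = norm u \<otimes>\<^bsub>R\<^esub> norm v"
  by (simp add: norm_def star_mult R.m_ac)

lemma star_one: "star \<one>\<^bsub>R\<^esub> = \<one>\<^bsub>R\<^esub>"
  by (simp add: one_eq_single star_single)

lemma norm_one: "norm \<one>\<^bsub>R\<^esub> = \<one>\<^bsub>R\<^esub>"
  by (simp add: norm_def star_one)

lemma norm_one_add:
  "u \<in> carrier R \<Longrightarrow> norm (\<one>\<^bsub>R\<^esub> \<oplus>\<^bsub>R\<^esub> u) = \<one>\<^bsub>R\<^esub> \<oplus>\<^bsub>R\<^esub> ((u \<oplus>\<^bsub>R\<^esub> star u) \<oplus>\<^bsub>R\<^esub> norm u)"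
  by (simp add: norm_def star_add star_one R.l_distr R.r_distr R.a_ac)

lemma star_norm: "u \<in> carrier R \<Longrightarrow> star (norm u) = norm u"
  by (simp add: norm_def star_mult star_star R.m_comm)

lemma aug_norm: "u \<in> carrier R \<Longrightarrow> aug (norm u) = aug u \<otimes> aug u"
  by (simp add: norm_def aug_mult aug_star)

abbreviation "tor \<equiv> {x \<in> carrier G. x \<otimes>\<^bsub>G\<^esub> x = \<one>\<^bsub>G\<^esub>}"

lemma inv_eq_self_iff: "x \<in> carrier G \<Longrightarrow> inv\<^bsub>G\<^esub> x = x \<longleftrightarrow> x \<otimes>\<^bsub>G\<^esub> x = \<one>\<^bsub>G\<^esub>"
  by (metis G.inv_equality G.r_inv)

text \<open>
  In the correlation sum for \<open>x\<close> of order two the terms for \<open>y\<close> and \<open>x y\<close> coincide.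
\<close>

lemma norm_coeff_involution:
  assumes u: "u \<in> carrier R" and x: "x \<in> tor" "x \<noteq> \<one>\<^bsub>G\<^esub>"
  shows "norm u x = \<zero>"
proof -
  have [simp]: "x \<in> carrier G" "inv\<^bsub>G\<^esub> x = x" using x by (auto simp: inv_eq_self_iff)
  have "norm u x = (\<Oplus>y\<in>carrier G. u y \<otimes> u (x \<otimes>\<^bsub>G\<^esub> y))"
    using u by (simp add: norm_def norm_coeff)
  also have "\<dots> = (\<Oplus>y\<in>{y \<in> carrier G. x \<otimes>\<^bsub>G\<^esub> y = y}. u y \<otimes> u (x \<otimes>\<^bsub>G\<^esub> y))"
    using u x by (intro K_involution) (auto simp: finite_G K.m_comm G.m_assoc[symmetric])
  also have "{y \<in> carrier G. x \<otimes>\<^bsub>G\<^esub> y = y} = {}" using x by auto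
  finally show ?thesis by simp
qed

lemma symmetric_coeff: "star u = u \<Longrightarrow> x \<in> carrier G \<Longrightarrow> u (inv\<^bsub>G\<^esub> x) = u x"
  by (metis star_coeff)

lemma aug_symmetric:
  assumes "u \<in> carrier R" "star u = u"
  shows "aug u = (\<Oplus>x\<in>tor. u x)"
proof -
  have "aug u = (\<Oplus>x\<in>{x \<in> carrier G. inv\<^bsub>G\<^esub> x = x}. u x)"
    unfolding aug_eq[OF assms(1)]
    using assms by (intro K_involution) (auto simp: finite_G symmetric_coeff)
  then show ?thesis by (simp add: inv_eq_self_iff cong: conj_cong)
qed

text \<open>
  The augmentation of the symmetric element \<open>u u\<^sup>*\<close> is the sum of its coefficients on the
  \<open>2\<close>-torsion, of which only the one at the identity survives.
\<close>

lemma norm_coeff_one: "u \<in> carrier R \<Longrightarrow> norm u \<one>\<^bsub>G\<^esub> = aug u \<otimes> aug u"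
proof -
  assume u: "u \<in> carrier R"
  have "aug (norm u) = (\<Oplus>x\<in>tor. norm u x)"
    using u by (intro aug_symmetric) (auto simp: star_norm)
  also have "\<dots> = (\<Oplus>x\<in>{\<one>\<^bsub>G\<^esub>}. norm u x)"
    using u by (intro K.add.finprod_mono_neutral_cong_right) (auto simp: finite_G norm_coeff_involution)
  also have "\<dots> = norm u \<one>\<^bsub>G\<^esub>" using u by (simp add: K.finsum_insert)
  finally show ?thesis using u by (simp add: aug_norm)
qed

lemma aug_eq_one_of_norm: "u \<in> carrier R \<Longrightarrow> norm u = \<one>\<^bsub>R\<^esub> \<Longrightarrow> aug u = \<one>"
proof -
  assume u: "u \<in> carrier R" "norm u = \<one>\<^bsub>R\<^esub>"
  have "aug u \<otimes> aug u = norm u \<one>\<^bsub>G\<^esub>" by (rule norm_coeff_one[OF u(1), symmetric])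
  also have "\<dots> = \<one> \<otimes> \<one>" unfolding u(2) by (simp add: one_coeff)
  finally have "aug u \<otimes> aug u = \<one> \<otimes> \<one>" .
  then show ?thesis by (rule K_square_inj[OF aug_closed[OF u(1)] K.one_closed])
qed

lemma square_coeff:
  assumes u: "u \<in> carrier R" and g: "g \<in> carrier G"
  shows "(u \<otimes>\<^bsub>R\<^esub> u) g = (\<Oplus>x\<in>{x \<in> carrier G. x \<otimes>\<^bsub>G\<^esub> x = g}. u x \<otimes> u x)"
proof -
  let ?s = "\<lambda>x. inv\<^bsub>G\<^esub> x \<otimes>\<^bsub>G\<^esub> g"
  have ss: "?s (?s x) = x" if "x \<in> carrier G" for x
    using that g by (simp add: G.inv_mult_group G.m_comm G.m_assoc[symmetric])
  have fix_iff: "?s x = x \<longleftrightarrow> x \<otimes>\<^bsub>G\<^esub> x = g" if "x \<in> carrier G" for x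
    using that g G.inv_solve_left'[of x x g] by auto
  have "(u \<otimes>\<^bsub>R\<^esub> u) g = (\<Oplus>x\<in>carrier G. u x \<otimes> u (?s x))" using u g by (simp add: mult_coeff)
  also have "\<dots> = (\<Oplus>x\<in>{x \<in> carrier G. ?s x = x}. u x \<otimes> u (?s x))"
    using u g by (intro K_involution) (auto simp: finite_G ss K.m_comm)
  also have "\<dots> = (\<Oplus>x\<in>{x \<in> carrier G. x \<otimes>\<^bsub>G\<^esub> x = g}. u x \<otimes> u x)"
  proof (rule K.finsum_cong')
    fix x assume "x \<in> {x \<in> carrier G. x \<otimes>\<^bsub>G\<^esub> x = g}"
    then have "?s x = x" using fix_iff by blast
    then show "u x \<otimes> u (?s x) = u x \<otimes> u x" by simp
  qed (use u fix_iff in auto)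
  finally show ?thesis .
qed

text \<open>
  Squaring in characteristic two moves the support into the squares, without mixed terms.
\<close>

lemma pow_support:
  assumes u: "u \<in> carrier R"
  shows "g \<in> carrier G \<Longrightarrow> (u [^]\<^bsub>R\<^esub> ((2::nat) ^ k)) g \<noteq> \<zero> \<Longrightarrow>
    \<exists>x\<in>carrier G. g = x [^]\<^bsub>G\<^esub> ((2::nat) ^ k)"
proof (induction k arbitrary: g)
  case 0
  then show ?case by auto
next
  case (Suc k)
  let ?w = "u [^]\<^bsub>R\<^esub> ((2::nat) ^ k)"
  have w: "?w \<in> carrier R" using u by simp
  have "u [^]\<^bsub>R\<^esub> ((2::nat) ^ Suc k) = ?w \<otimes>\<^bsub>R\<^esub> ?w"
    using u by (simp add: R.nat_pow_mult mult_2)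
  then have "(\<Oplus>x\<in>{x \<in> carrier G. x \<otimes>\<^bsub>G\<^esub> x = g}. ?w x \<otimes> ?w x) \<noteq> \<zero>"
    using Suc.prems w by (simp add: square_coeff)
  then obtain y where y: "y \<in> carrier G" "y \<otimes>\<^bsub>G\<^esub> y = g" "?w y \<noteq> \<zero>"
    using K.add.finprod_one_eqI[of "{x \<in> carrier G. x \<otimes>\<^bsub>G\<^esub> x = g}" "\<lambda>x. ?w x \<otimes> ?w x"]
    by (fastforce simp: finsum_def)
  then obtain x where "x \<in> carrier G" "y = x [^]\<^bsub>G\<^esub> ((2::nat) ^ k)"
    using Suc.IH[of y] by fastforce
  then have "g = x [^]\<^bsub>G\<^esub> ((2::nat) ^ Suc k)"
    using y by (simp add: G.nat_pow_mult mult_2)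
  then show ?case using \<open>x \<in> carrier G\<close> by blast
qed

lemma aug_pow: "u \<in> carrier R \<Longrightarrow> aug (u [^]\<^bsub>R\<^esub> (n::nat)) = aug u [^] n"
  by (induction n) (simp_all add: aug_mult one_eq_single aug_single)

text \<open>
  The power of \<open>u\<close> with exponent \<open>2\<^sup>m\<close> is supported at the identity, hence is a nonzero scalar.
\<close>

lemma inverse_exists:
  assumes u: "u \<in> carrier R" and nz: "aug u \<noteq> \<zero>"
  obtains w where "w \<in> carrier R" "u \<otimes>\<^bsub>R\<^esub> w = \<one>\<^bsub>R\<^esub>"
proof -
  let ?v = "u [^]\<^bsub>R\<^esub> ((2::nat) ^ m)"
  let ?a = "?v \<one>\<^bsub>G\<^esub>"
  have v: "?v \<in> carrier R" "?a \<in> carrier K" using u by simp_all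
  have "?v = single ?a \<one>\<^bsub>G\<^esub>"
  proof (rule group_algebra_eqI)
    fix g assume g: "g \<in> carrier G"
    have "g = \<one>\<^bsub>G\<^esub>" if "?v g \<noteq> \<zero>"
      using pow_support[OF u g that] G.pow_order_eq_1 card_G by (auto simp: order_def)
    then show "?v g = single ?a \<one>\<^bsub>G\<^esub> g" using g by (auto simp: single_coeff)
  qed (use v in auto)
  moreover from this have "?a = aug u [^] ((2::nat) ^ m)"
    using aug_single[OF v(2), of "\<one>\<^bsub>G\<^esub>"] aug_pow[OF u] by simp
  then have a0: "?a \<noteq> \<zero>" using nz u K_pow_nonzero by simp
  then have ia: "inv ?a \<in> carrier K" "?a \<otimes> inv ?a = \<one>" 
    using v K.field_Units by auto
  have "u \<otimes>\<^bsub>R\<^esub> u [^]\<^bsub>R\<^esub> ((2::nat) ^ m - 1) = ?v"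
    using u R.nat_pow_mult[of u 1 "2 ^ m - 1"] by simp
  ultimately have "u \<otimes>\<^bsub>R\<^esub> (u [^]\<^bsub>R\<^esub> ((2::nat) ^ m - 1) \<otimes>\<^bsub>R\<^esub> single (inv ?a) \<one>\<^bsub>G\<^esub>) = \<one>\<^bsub>R\<^esub>"
    using u ia v by (simp add: R.m_assoc[symmetric] one_eq_single) (metis G.l_one G.one_closed ia single_mult_single v(2))
  then show ?thesis using u ia by (intro that) auto
qed

definition "Sym = {u \<in> carrier R. star u = u}"

lemma card_Sym: "\<exists>n. 2 * n = card (carrier G) + card tor \<and> card Sym = card (carrier K) ^ n"
proof -
  have "Sym = {f \<in> carrier G \<rightarrow>\<^sub>E carrier K. \<forall>x\<in>carrier G. f (inv\<^bsub>G\<^esub> x) = f x}"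
    unfolding Sym_def carrier_R[symmetric]
    by (auto simp: symmetric_coeff star_coeff intro!: group_algebra_eqI)
  then show ?thesis
    using card_invariant_functions[of "carrier G" "\<lambda>x. inv\<^bsub>G\<^esub> x" "carrier K"]
    by (auto simp: finite_G inv_eq_self_iff cong: conj_cong)
qed

text \<open>
  Take \<open>z\<close> to agree with \<open>s\<close> on one element of each pair \<open>{x, x\<^sup>-\<^sup>1}\<close> and to vanish elsewhere; at
  the fixed points of inversion nothing is asked for, because \<open>s\<close> is zero there.
\<close>

lemma symmetric_eq_trace:
  assumes s: "s \<in> Sym" and zero: "\<And>x. x \<in> tor \<Longrightarrow> s x = \<zero>"
  obtains z where "z \<in> carrier R" "s = z \<oplus>\<^bsub>R\<^esub> star z"
proof -
  obtain r where r: "\<And>x. x \<in> carrier G \<Longrightarrow> r x = x \<or> r x = inv\<^bsub>G\<^esub> x"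
      "\<And>x. x \<in> carrier G \<Longrightarrow> r (inv\<^bsub>G\<^esub> x) = r x"
    using involution_representatives[of "carrier G" "\<lambda>x. inv\<^bsub>G\<^esub> x"] by auto
  define z where "z = (\<lambda>x\<in>carrier G. if r x = x then s x else \<zero>)"
  have z: "z \<in> carrier R" unfolding z_def using s by (intro lambda_in_R) (auto simp: Sym_def)
  have "s = z \<oplus>\<^bsub>R\<^esub> star z"
  proof (rule group_algebra_eqI)
    fix x assume x: "x \<in> carrier G"
    have sx: "s (inv\<^bsub>G\<^esub> x) = s x" using s x by (simp add: Sym_def symmetric_coeff)
    show "s x = (z \<oplus>\<^bsub>R\<^esub> star z) x"
    proof (cases "inv\<^bsub>G\<^esub> x = x")
      case True
      then show ?thesis using x z zero[of x] inv_eq_self_iff[OF x]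
        by (simp add: add_coeff star_coeff K_double)
    next
      case False
      then show ?thesis using r[OF x] x sx s
        by (auto simp: add_coeff star_coeff z_def Sym_def)
    qed
  qed (use s z in \<open>auto simp: Sym_def\<close>)
  then show ?thesis using z that by blast
qed

end

section \<open>Pairs of elements whose norms add up to one\<close>

context abelian_2_group_algebra
begin

lemma norm_torsion:
  assumes u: "u \<in> carrier R" "aug u = \<one>" and x: "x \<in> tor"
  shows "norm u x = \<one>\<^bsub>R\<^esub> x"
  using assms norm_coeff_involution[OF u(1) x] norm_coeff_one[OF u(1)] by (auto simp: one_coeff)

text \<open>
  The sum \<open>w = u + v\<close> has augmentation one, and for given \<open>w\<close> the equation is affine in
  \<open>y = w\<^sup>-\<^sup>1 v\<close> with the symmetric elements as its space of directions. Solvability uses that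
  \<open>1 + w\<^sup>-\<^sup>1 (w\<^sup>-\<^sup>1)\<^sup>*\<close> vanishes on the \<open>2\<close>-torsion.
\<close>

lemma card_norm_pairs:
  obtains s where "2 * s = card (carrier G) + card tor"
    "card {(u, v). u \<in> carrier R \<and> v \<in> carrier R \<and> norm u \<oplus>\<^bsub>R\<^esub> norm v = \<one>\<^bsub>R\<^esub>} =
      card {w \<in> carrier R. aug w = \<one>} * card (carrier K) ^ s"
proof -
  let ?P = "{(u, v). u \<in> carrier R \<and> v \<in> carrier R \<and> norm u \<oplus>\<^bsub>R\<^esub> norm v = \<one>\<^bsub>R\<^esub>}"
  let ?f = "\<lambda>(u, v). u \<oplus>\<^bsub>R\<^esub> v"
  have "card {p \<in> ?P. ?f p = w} = card Sym" if "w \<in> {w \<in> carrier R. aug w = \<one>}" for w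
  proof -
    have w: "w \<in> carrier R" "aug w = \<one>" using that by auto
    obtain w' where w': "w' \<in> carrier R" "w \<otimes>\<^bsub>R\<^esub> w' = \<one>\<^bsub>R\<^esub>"
      using inverse_exists[of w] w by auto
    have augw': "aug w' = \<one>"
      using aug_mult[OF w(1) w'(1)] w w' by (simp add: one_eq_single aug_single)
    let ?s = "\<one>\<^bsub>R\<^esub> \<oplus>\<^bsub>R\<^esub> norm w'"
    have sS: "?s \<in> Sym" using w' by (simp add: Sym_def star_add star_one star_norm)
    have s0: "?s x = \<zero>" if "x \<in> tor" for x
      using norm_torsion[OF w'(1) augw' that] that by (simp add: add_coeff K_double one_closed)
    obtain z0 where z0: "z0 \<in> carrier R" "?s = z0 \<oplus>\<^bsub>R\<^esub> star z0"
      by (rule symmetric_eq_trace[OF sS s0])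
    have nw: "norm w \<otimes>\<^bsub>R\<^esub> norm w' = \<one>\<^bsub>R\<^esub>"
      using w w' by (simp add: norm_mult[symmetric] norm_one)
    \<comment> \<open>the substitution \<open>v = w y\<close> turns the equation into \<open>y + y\<^sup>* = 1 + w\<^sup>-\<^sup>1 (w\<^sup>-\<^sup>1)\<^sup>*\<close>\<close>
    have key: "norm (w \<oplus>\<^bsub>R\<^esub> w \<otimes>\<^bsub>R\<^esub> y) \<oplus>\<^bsub>R\<^esub> norm (w \<otimes>\<^bsub>R\<^esub> y) = \<one>\<^bsub>R\<^esub> \<longleftrightarrow>
        y \<oplus>\<^bsub>R\<^esub> z0 \<in> Sym" if y: "y \<in> carrier R" for y
    proof -
      have "w \<oplus>\<^bsub>R\<^esub> w \<otimes>\<^bsub>R\<^esub> y = w \<otimes>\<^bsub>R\<^esub> (\<one>\<^bsub>R\<^esub> \<oplus>\<^bsub>R\<^esub> y)" using w y by (simp add: R.r_distr)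
      then have "norm (w \<oplus>\<^bsub>R\<^esub> w \<otimes>\<^bsub>R\<^esub> y) \<oplus>\<^bsub>R\<^esub> norm (w \<otimes>\<^bsub>R\<^esub> y) =
          norm w \<otimes>\<^bsub>R\<^esub> (norm (\<one>\<^bsub>R\<^esub> \<oplus>\<^bsub>R\<^esub> y) \<oplus>\<^bsub>R\<^esub> norm y)"
        using w y by (simp add: norm_mult R.r_distr[of "norm (\<one>\<^bsub>R\<^esub> \<oplus>\<^bsub>R\<^esub> y)"])
      also have "norm (\<one>\<^bsub>R\<^esub> \<oplus>\<^bsub>R\<^esub> y) \<oplus>\<^bsub>R\<^esub> norm y = \<one>\<^bsub>R\<^esub> \<oplus>\<^bsub>R\<^esub> (y \<oplus>\<^bsub>R\<^esub> star y)"
        unfolding norm_one_add[OF y] using y by (simp add: R_add_ac)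
      finally have "norm (w \<oplus>\<^bsub>R\<^esub> w \<otimes>\<^bsub>R\<^esub> y) \<oplus>\<^bsub>R\<^esub> norm (w \<otimes>\<^bsub>R\<^esub> y) = \<one>\<^bsub>R\<^esub> \<longleftrightarrow>
          norm w \<otimes>\<^bsub>R\<^esub> (\<one>\<^bsub>R\<^esub> \<oplus>\<^bsub>R\<^esub> (y \<oplus>\<^bsub>R\<^esub> star y)) = \<one>\<^bsub>R\<^esub>" by simp
      also have "\<dots> \<longleftrightarrow> \<one>\<^bsub>R\<^esub> \<oplus>\<^bsub>R\<^esub> (y \<oplus>\<^bsub>R\<^esub> star y) = norm w'"
      proof
        assume e: "norm w \<otimes>\<^bsub>R\<^esub> (\<one>\<^bsub>R\<^esub> \<oplus>\<^bsub>R\<^esub> (y \<oplus>\<^bsub>R\<^esub> star y)) = \<one>\<^bsub>R\<^esub>"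
        have "\<one>\<^bsub>R\<^esub> \<oplus>\<^bsub>R\<^esub> (y \<oplus>\<^bsub>R\<^esub> star y) =
            (norm w' \<otimes>\<^bsub>R\<^esub> norm w) \<otimes>\<^bsub>R\<^esub> (\<one>\<^bsub>R\<^esub> \<oplus>\<^bsub>R\<^esub> (y \<oplus>\<^bsub>R\<^esub> star y))"
          using nw w w' y by (simp add: R.m_comm[of "norm w'" "norm w"])
        also have "\<dots> = norm w'" using e w w' y by (simp add: R.m_assoc)
        finally show "\<one>\<^bsub>R\<^esub> \<oplus>\<^bsub>R\<^esub> (y \<oplus>\<^bsub>R\<^esub> star y) = norm w'" .
      qed (use nw in simp)
      also have "\<dots> \<longleftrightarrow> y \<oplus>\<^bsub>R\<^esub> star y = ?s"
      proof
        assume "\<one>\<^bsub>R\<^esub> \<oplus>\<^bsub>R\<^esub> (y \<oplus>\<^bsub>R\<^esub> star y) = norm w'"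
        then show "y \<oplus>\<^bsub>R\<^esub> star y = ?s" using y R_double_left[of "\<one>\<^bsub>R\<^esub>" "y \<oplus>\<^bsub>R\<^esub> star y"] by simp
      next
        assume "y \<oplus>\<^bsub>R\<^esub> star y = ?s"
        then show "\<one>\<^bsub>R\<^esub> \<oplus>\<^bsub>R\<^esub> (y \<oplus>\<^bsub>R\<^esub> star y) = norm w'" using w' by (simp add: R_double_left)
      qed
      also have "\<dots> \<longleftrightarrow> (y \<oplus>\<^bsub>R\<^esub> star y) \<oplus>\<^bsub>R\<^esub> (z0 \<oplus>\<^bsub>R\<^esub> star z0) = \<zero>\<^bsub>R\<^esub>"
        using y z0 by (simp add: R_eq_iff)
      also have "\<dots> \<longleftrightarrow> star (y \<oplus>\<^bsub>R\<^esub> z0) \<oplus>\<^bsub>R\<^esub> (y \<oplus>\<^bsub>R\<^esub> z0) = \<zero>\<^bsub>R\<^esub>"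
        using y z0 by (simp add: star_add R.a_ac)
      also have "\<dots> \<longleftrightarrow> y \<oplus>\<^bsub>R\<^esub> z0 \<in> Sym" using y z0 by (simp add: R_eq_iff Sym_def)
      finally show ?thesis .
    qed
    have w'w: "w' \<otimes>\<^bsub>R\<^esub> (w \<otimes>\<^bsub>R\<^esub> y) = y" "w \<otimes>\<^bsub>R\<^esub> (w' \<otimes>\<^bsub>R\<^esub> y) = y" if "y \<in> carrier R" for y
      using w w' that by (simp_all add: R.m_assoc[symmetric] R.m_comm[of w' w])
    have "bij_betw (\<lambda>y. (w \<oplus>\<^bsub>R\<^esub> w \<otimes>\<^bsub>R\<^esub> (y \<oplus>\<^bsub>R\<^esub> z0), w \<otimes>\<^bsub>R\<^esub> (y \<oplus>\<^bsub>R\<^esub> z0))) Sym {p \<in> ?P. ?f p = w}"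
    proof (rule bij_betw_byWitness[where f' = "\<lambda>p. w' \<otimes>\<^bsub>R\<^esub> snd p \<oplus>\<^bsub>R\<^esub> z0"])
      show "\<forall>y\<in>Sym. w' \<otimes>\<^bsub>R\<^esub> snd (w \<oplus>\<^bsub>R\<^esub> w \<otimes>\<^bsub>R\<^esub> (y \<oplus>\<^bsub>R\<^esub> z0), w \<otimes>\<^bsub>R\<^esub> (y \<oplus>\<^bsub>R\<^esub> z0)) \<oplus>\<^bsub>R\<^esub> z0 = y"
        using z0 by (auto simp: Sym_def w'w R_add_ac)
      have uv: "u = w \<oplus>\<^bsub>R\<^esub> v" if "u \<in> carrier R" "v \<in> carrier R" "u \<oplus>\<^bsub>R\<^esub> v = w" for u v
        using that by (auto simp: R_add_ac)
      show "\<forall>p\<in>{p \<in> ?P. ?f p = w}. (w \<oplus>\<^bsub>R\<^esub> w \<otimes>\<^bsub>R\<^esub> (w' \<otimes>\<^bsub>R\<^esub> snd p \<oplus>\<^bsub>R\<^esub> z0 \<oplus>\<^bsub>R\<^esub> z0),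
          w \<otimes>\<^bsub>R\<^esub> (w' \<otimes>\<^bsub>R\<^esub> snd p \<oplus>\<^bsub>R\<^esub> z0 \<oplus>\<^bsub>R\<^esub> z0)) = p"
        using z0 w' uv by (auto simp: R.a_assoc R_double w'w)
      show "(\<lambda>y. (w \<oplus>\<^bsub>R\<^esub> w \<otimes>\<^bsub>R\<^esub> (y \<oplus>\<^bsub>R\<^esub> z0), w \<otimes>\<^bsub>R\<^esub> (y \<oplus>\<^bsub>R\<^esub> z0))) ` Sym \<subseteq> {p \<in> ?P. ?f p = w}"
      proof (rule image_subsetI)
        fix y assume y: "y \<in> Sym"
        then have yR: "y \<in> carrier R" by (simp add: Sym_def)
        have "(y \<oplus>\<^bsub>R\<^esub> z0) \<oplus>\<^bsub>R\<^esub> z0 \<in> Sym" using y yR z0 by (simp add: R.a_assoc R_double)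
        then have "norm (w \<oplus>\<^bsub>R\<^esub> w \<otimes>\<^bsub>R\<^esub> (y \<oplus>\<^bsub>R\<^esub> z0)) \<oplus>\<^bsub>R\<^esub> norm (w \<otimes>\<^bsub>R\<^esub> (y \<oplus>\<^bsub>R\<^esub> z0)) = \<one>\<^bsub>R\<^esub>"
          using key[of "y \<oplus>\<^bsub>R\<^esub> z0"] yR z0 by simp
        then show "(w \<oplus>\<^bsub>R\<^esub> w \<otimes>\<^bsub>R\<^esub> (y \<oplus>\<^bsub>R\<^esub> z0), w \<otimes>\<^bsub>R\<^esub> (y \<oplus>\<^bsub>R\<^esub> z0)) \<in> {p \<in> ?P. ?f p = w}"
          using yR z0 w by (simp add: R.a_assoc R_double)
      qed
      show "(\<lambda>p. w' \<otimes>\<^bsub>R\<^esub> snd p \<oplus>\<^bsub>R\<^esub> z0) ` {p \<in> ?P. ?f p = w} \<subseteq> Sym"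
      proof (rule image_subsetI)
        fix p assume "p \<in> {p \<in> ?P. ?f p = w}"
        then obtain u v where p: "p = (u, v)" "u \<in> carrier R" "v \<in> carrier R" "u \<oplus>\<^bsub>R\<^esub> v = w"
          "norm u \<oplus>\<^bsub>R\<^esub> norm v = \<one>\<^bsub>R\<^esub>" by auto
        have u: "u = w \<oplus>\<^bsub>R\<^esub> v" by (rule uv) (use p in auto)
        have "norm (w \<oplus>\<^bsub>R\<^esub> w \<otimes>\<^bsub>R\<^esub> (w' \<otimes>\<^bsub>R\<^esub> v)) \<oplus>\<^bsub>R\<^esub> norm (w \<otimes>\<^bsub>R\<^esub> (w' \<otimes>\<^bsub>R\<^esub> v)) = \<one>\<^bsub>R\<^esub>"
          unfolding w'w(2)[OF p(3)] using p(5) unfolding u .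
        then show "w' \<otimes>\<^bsub>R\<^esub> snd p \<oplus>\<^bsub>R\<^esub> z0 \<in> Sym"
          using key[of "w' \<otimes>\<^bsub>R\<^esub> v"] p w' by simp
      qed
    qed
    then show ?thesis using bij_betw_same_card[of _ Sym] by fastforce
  qed
  moreover have "?f \<in> ?P \<rightarrow> {w \<in> carrier R. aug w = \<one>}"
  proof
    fix p assume "p \<in> ?P"
    then obtain u v where p: "p = (u, v)" "u \<in> carrier R" "v \<in> carrier R"
      "norm u \<oplus>\<^bsub>R\<^esub> norm v = \<one>\<^bsub>R\<^esub>" by auto
    have "(aug u \<oplus> aug v) \<otimes> (aug u \<oplus> aug v) = aug (norm u \<oplus>\<^bsub>R\<^esub> norm v)"
      using p(2,3) by (simp add: K_square_add aug_add aug_norm)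
    also have "\<dots> = \<one> \<otimes> \<one>" unfolding p(4) by (simp add: one_eq_single aug_single)
    finally have "(aug u \<oplus> aug v) \<otimes> (aug u \<oplus> aug v) = \<one> \<otimes> \<one>" .
    then have "aug u \<oplus> aug v = \<one>" by (rule K_square_inj[rotated 2]) (use p(2,3) in simp_all)
    then show "?f p \<in> {w \<in> carrier R. aug w = \<one>}" using p by (simp add: aug_add)
  qed
  moreover have "finite ?P"
    by (rule finite_subset[of _ "carrier R \<times> carrier R"]) (auto simp: finite_R)
  ultimately have "card ?P = card {w \<in> carrier R. aug w = \<one>} * card Sym"
    by (intro card_eq_card_times_fibre[where f = ?f]) (auto simp: finite_R)
  then show ?thesis using card_Sym that by auto
qed

end

section \<open>Elements invariant under translation by an involution\<close>

context abelian_2_group_algebra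
begin

definition "invariant c u \<longleftrightarrow> (\<forall>x\<in>carrier G. u (c \<otimes>\<^bsub>G\<^esub> x) = u x)"

lemma invariant_add: "c \<in> carrier G \<Longrightarrow> invariant c u \<Longrightarrow> invariant c v \<Longrightarrow> invariant c (u \<oplus>\<^bsub>R\<^esub> v)"
  by (auto simp: invariant_def add_coeff)

definition "unitary = {u \<in> carrier R. norm u = \<one>\<^bsub>R\<^esub>}"

end

locale central_involution = abelian_2_group_algebra K G m
  for K :: "('k, 'm) ring_scheme" (structure) and G :: "('g, 'n) monoid_scheme" and m :: nat +
  fixes c :: 'g
  assumes c: "c \<in> carrier G" "c \<otimes>\<^bsub>G\<^esub> c = \<one>\<^bsub>G\<^esub>" "c \<noteq> \<one>\<^bsub>G\<^esub>"
begin

lemma c_c: "x \<in> carrier G \<Longrightarrow> c \<otimes>\<^bsub>G\<^esub> (c \<otimes>\<^bsub>G\<^esub> x) = x"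
  using c by (simp add: G.m_assoc[symmetric])

lemma c_neq: "x \<in> carrier G \<Longrightarrow> c \<otimes>\<^bsub>G\<^esub> x \<noteq> x"
  using c by simp

lemma inv_c: "inv\<^bsub>G\<^esub> c = c"
  using c inv_eq_self_iff by blast

lemma invariant_iff:
  assumes u: "u \<in> carrier R"
  shows "invariant c u \<longleftrightarrow> single \<one> c \<otimes>\<^bsub>R\<^esub> u = u"
proof
  assume i: "invariant c u"
  show "single \<one> c \<otimes>\<^bsub>R\<^esub> u = u"
    by (rule group_algebra_eqI) (use u c i in \<open>auto simp: single_mult_coeff inv_c invariant_def\<close>)
next
  assume e: "single \<one> c \<otimes>\<^bsub>R\<^esub> u = u"
  have "u (c \<otimes>\<^bsub>G\<^esub> x) = u x" if "x \<in> carrier G" for x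
    using single_mult_coeff[of \<one> c u x] e u c that by (simp add: inv_c)
  then show "invariant c u" by (simp add: invariant_def)
qed

text \<open>
  Invariant elements are multiples of \<open>1 + c\<close>, whose square is zero. In terms of coefficients,
  the terms for \<open>x\<close> and \<open>c x\<close> in the convolution cancel.
\<close>

lemma invariant_mult_zero:
  assumes "u \<in> carrier R" "v \<in> carrier R" "invariant c u" "invariant c v"
  shows "u \<otimes>\<^bsub>R\<^esub> v = \<zero>\<^bsub>R\<^esub>"
proof (rule group_algebra_eqI)
  fix g assume g: "g \<in> carrier G"
  have "(u \<otimes>\<^bsub>R\<^esub> v) g = (\<Oplus>x\<in>carrier G. u x \<otimes> v (inv\<^bsub>G\<^esub> x \<otimes>\<^bsub>G\<^esub> g))"
    using assms g by (simp add: mult_coeff)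
  also have "\<dots> = (\<Oplus>x\<in>{x \<in> carrier G. c \<otimes>\<^bsub>G\<^esub> x = x}. u x \<otimes> v (inv\<^bsub>G\<^esub> x \<otimes>\<^bsub>G\<^esub> g))"
  proof (rule K_involution)
    fix x assume x: "x \<in> carrier G"
    have "v (c \<otimes>\<^bsub>G\<^esub> (inv\<^bsub>G\<^esub> x \<otimes>\<^bsub>G\<^esub> g)) = v (inv\<^bsub>G\<^esub> x \<otimes>\<^bsub>G\<^esub> g)"
      using assms x g by (simp add: invariant_def)
    moreover have "inv\<^bsub>G\<^esub> (c \<otimes>\<^bsub>G\<^esub> x) \<otimes>\<^bsub>G\<^esub> g = c \<otimes>\<^bsub>G\<^esub> (inv\<^bsub>G\<^esub> x \<otimes>\<^bsub>G\<^esub> g)"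
      using x g c by (simp add: G.inv_mult inv_c G.m_assoc)
    ultimately show "u (c \<otimes>\<^bsub>G\<^esub> x) \<otimes> v (inv\<^bsub>G\<^esub> (c \<otimes>\<^bsub>G\<^esub> x) \<otimes>\<^bsub>G\<^esub> g) = u x \<otimes> v (inv\<^bsub>G\<^esub> x \<otimes>\<^bsub>G\<^esub> g)"
      using assms x by (simp add: invariant_def)
  qed (use assms g c in \<open>auto simp: finite_G c_c\<close>)
  also have "{x \<in> carrier G. c \<otimes>\<^bsub>G\<^esub> x = x} = {}" using c_neq by auto
  finally show "(u \<otimes>\<^bsub>R\<^esub> v) g = \<zero>\<^bsub>R\<^esub> g" using g by (simp add: zero_coeff)
qed (use assms in auto)

lemma invariant_star: "u \<in> carrier R \<Longrightarrow> invariant c u \<Longrightarrow> invariant c (star u)"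
  using c by (auto simp: invariant_def star_coeff G.inv_mult inv_c)

lemma norm_invariant: "u \<in> carrier R \<Longrightarrow> invariant c u \<Longrightarrow> norm u = \<zero>\<^bsub>R\<^esub>"
  unfolding norm_def by (intro invariant_mult_zero) (auto simp: invariant_star)

lemma card_invariant:
  "\<exists>n. 2 * n = card (carrier G) \<and> card {u \<in> carrier R. invariant c u} = card (carrier K) ^ n"
proof -
  have e: "{x \<in> carrier G. c \<otimes>\<^bsub>G\<^esub> x = x} = {}" using c_neq by auto
  have "\<exists>n. 2 * n = card (carrier G) + card {x \<in> carrier G. c \<otimes>\<^bsub>G\<^esub> x = x} \<and>
      card {u \<in> carrier G \<rightarrow>\<^sub>E carrier K. \<forall>x\<in>carrier G. u (c \<otimes>\<^bsub>G\<^esub> x) = u x} = card (carrier K) ^ n"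
    by (rule card_invariant_functions) (use c in \<open>auto simp: finite_G c_c\<close>)
  then show ?thesis unfolding e by (simp add: invariant_def carrier_R)
qed

text \<open>
  The augmentations of \<open>u\<close> and \<open>v\<close> cannot both vanish. Cancelling a factor of nonzero
  augmentation from \<open>u v\<close> makes the other factor invariant, hence of norm zero, so both
  augmentations cannot be nonzero either.
\<close>

lemma card_norm_pairs_invariant:
  "card {(u, v). u \<in> carrier R \<and> v \<in> carrier R \<and> norm u \<oplus>\<^bsub>R\<^esub> norm v = \<one>\<^bsub>R\<^esub> \<and> invariant c (u \<otimes>\<^bsub>R\<^esub> v)}
    = 2 * card unitary * card {u \<in> carrier R. invariant c u}"
proof -
  let ?P = "{(u, v). u \<in> carrier R \<and> v \<in> carrier R \<and> norm u \<oplus>\<^bsub>R\<^esub> norm v = \<one>\<^bsub>R\<^esub> \<and> invariant c (u \<otimes>\<^bsub>R\<^esub> v)}"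
  let ?I = "{u \<in> carrier R. invariant c u}"
  have sc: "single \<one> c \<in> carrier R" by simp
  have cancel: "invariant c v" if uv: "u \<in> carrier R" "v \<in> carrier R" "aug u \<noteq> \<zero>" "invariant c (u \<otimes>\<^bsub>R\<^esub> v)" for u v
  proof -
    obtain w where w: "w \<in> carrier R" "u \<otimes>\<^bsub>R\<^esub> w = \<one>\<^bsub>R\<^esub>" using inverse_exists uv by metis
    have v: "v = w \<otimes>\<^bsub>R\<^esub> (u \<otimes>\<^bsub>R\<^esub> v)"
      using uv w by (simp add: R.m_assoc[symmetric] R.m_comm[of w u])
    have "single \<one> c \<otimes>\<^bsub>R\<^esub> (w \<otimes>\<^bsub>R\<^esub> (u \<otimes>\<^bsub>R\<^esub> v)) = w \<otimes>\<^bsub>R\<^esub> (single \<one> c \<otimes>\<^bsub>R\<^esub> (u \<otimes>\<^bsub>R\<^esub> v))"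
      using uv w sc by (simp add: R.m_lcomm)
    also have "single \<one> c \<otimes>\<^bsub>R\<^esub> (u \<otimes>\<^bsub>R\<^esub> v) = u \<otimes>\<^bsub>R\<^esub> v" using uv invariant_iff[of "u \<otimes>\<^bsub>R\<^esub> v"] by simp
    finally show ?thesis using v uv invariant_iff[of v] by simp
  qed
  have inv_mult: "invariant c (u \<otimes>\<^bsub>R\<^esub> v)" if "u \<in> carrier R" "v \<in> carrier R" "invariant c v" for u v
  proof -
    have "single \<one> c \<otimes>\<^bsub>R\<^esub> (u \<otimes>\<^bsub>R\<^esub> v) = u \<otimes>\<^bsub>R\<^esub> (single \<one> c \<otimes>\<^bsub>R\<^esub> v)"
      using that sc by (simp add: R.m_lcomm)
    then show ?thesis using that by (simp add: invariant_iff)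
  qed
  have inv_mult': "invariant c (v \<otimes>\<^bsub>R\<^esub> u)" if "u \<in> carrier R" "v \<in> carrier R" "invariant c v" for u v
    using inv_mult[OF that] that by (simp add: R.m_comm)
  have "?P = unitary \<times> ?I \<union> ?I \<times> unitary"
  proof
    show "?P \<subseteq> unitary \<times> ?I \<union> ?I \<times> unitary"
    proof
      fix p assume "p \<in> ?P"
      then obtain u v where p: "p = (u, v)" "u \<in> carrier R" "v \<in> carrier R"
        "norm u \<oplus>\<^bsub>R\<^esub> norm v = \<one>\<^bsub>R\<^esub>" "invariant c (u \<otimes>\<^bsub>R\<^esub> v)" by auto
      show "p \<in> unitary \<times> ?I \<union> ?I \<times> unitary"
      proof (cases "aug u = \<zero>")
        case False
        then have "invariant c v" using cancel p by blast
        then show ?thesis using p norm_invariant[of v] by (simp add: unitary_def)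
      next
        case True
        have "aug (norm u) \<oplus> aug (norm v) = \<one>"
          using p(2,3) arg_cong[OF p(4), of aug] by (simp add: aug_add aug_one)
        then have "aug v \<noteq> \<zero>" using True p by (auto simp: aug_norm)
        then have "invariant c u" using cancel[of v u] p by (simp add: R.m_comm[of v u])
        then show ?thesis using p norm_invariant[of u] by (simp add: unitary_def)
      qed
    qed
    show "unitary \<times> ?I \<union> ?I \<times> unitary \<subseteq> ?P"
      using inv_mult inv_mult' by (auto simp: unitary_def norm_invariant)
  qed
  moreover have "unitary \<times> ?I \<inter> ?I \<times> unitary = {}"
  proof -
    have "\<zero>\<^bsub>R\<^esub> \<noteq> \<one>\<^bsub>R\<^esub>" using zero_coeff[of "\<one>\<^bsub>G\<^esub>"] one_coeff[of "\<one>\<^bsub>G\<^esub>"] by auto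
    then have "unitary \<inter> ?I = {}" using norm_invariant by (auto simp: unitary_def)
    then show ?thesis by blast
  qed
  moreover have "finite unitary" "finite ?I"
    using finite_R by (auto simp: unitary_def)
  ultimately show ?thesis by (simp add: card_Un_disjoint card_cartesian_product)
qed

section \<open>Norms that differ from one by an invariant element\<close>

text \<open>
  The element \<open>l (1 + c) h\<close>; such elements span the invariant ones.
\<close>

definition "pair l h = single l h \<oplus>\<^bsub>R\<^esub> single l (c \<otimes>\<^bsub>G\<^esub> h)"

text \<open>
  The necessary conditions on an invariant \<open>t\<close> for \<open>1 + t\<close> to be a norm.
\<close>

definition "norm_targets = {t \<in> Sym. invariant c t \<and> (\<forall>x\<in>tor. t x = \<zero>)}"

definition "attained = {t \<in> carrier R. invariant c t \<and> (\<exists>u\<in>carrier R. aug u = \<one> \<and> norm u = \<one>\<^bsub>R\<^esub> \<oplus>\<^bsub>R\<^esub> t)}"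

lemma pair_closed [simp]: "l \<in> carrier K \<Longrightarrow> pair l h \<in> carrier R"
  by (simp add: pair_def)

lemma pair_coeff: "l \<in> carrier K \<Longrightarrow> h \<in> carrier G \<Longrightarrow> x \<in> carrier G \<Longrightarrow>
    pair l h x = (if x = h \<or> x = c \<otimes>\<^bsub>G\<^esub> h then l else \<zero>)"
  using c_neq[of h] by (auto simp: pair_def add_coeff single_coeff)

lemma pair_add: "l \<in> carrier K \<Longrightarrow> l' \<in> carrier K \<Longrightarrow> h \<in> carrier G \<Longrightarrow> pair l h \<oplus>\<^bsub>R\<^esub> pair l' h = pair (l \<oplus> l') h"
  by (rule group_algebra_eqI) (auto simp: add_coeff pair_coeff)

lemma pair_invariant: "l \<in> carrier K \<Longrightarrow> h \<in> carrier G \<Longrightarrow> invariant c (pair l h)"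
  unfolding invariant_def using c by (auto simp: pair_coeff c_c)

lemma pair_translate: "l \<in> carrier K \<Longrightarrow> h \<in> carrier G \<Longrightarrow> pair l (c \<otimes>\<^bsub>G\<^esub> h) = pair l h"
  by (rule group_algebra_eqI) (use c in \<open>auto simp: pair_coeff c_c\<close>)

lemma star_pair: "l \<in> carrier K \<Longrightarrow> h \<in> carrier G \<Longrightarrow> star (pair l h) = pair l (inv\<^bsub>G\<^esub> h)"
  using c by (simp add: pair_def star_add star_single G.inv_mult inv_c)

lemma aug_pair: "l \<in> carrier K \<Longrightarrow> h \<in> carrier G \<Longrightarrow> aug (pair l h) = \<zero>"
  using c by (simp add: pair_def aug_add aug_single K_double)

lemma attained_closed: "t \<in> attained \<Longrightarrow> t \<in> carrier R"
  by (simp add: attained_def)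

lemma attained_subset_norm_targets: "attained \<subseteq> norm_targets"
proof
  fix t assume "t \<in> attained"
  then obtain u where t: "t \<in> carrier R" "invariant c t" and u: "u \<in> carrier R" "aug u = \<one>" "norm u = \<one>\<^bsub>R\<^esub> \<oplus>\<^bsub>R\<^esub> t"
    unfolding attained_def by auto
  have e: "t = \<one>\<^bsub>R\<^esub> \<oplus>\<^bsub>R\<^esub> norm u" using t by (simp add: u(3) R_double_left)
  have "star t = t" unfolding e using u(1) by (simp add: star_add star_one star_norm)
  moreover have "t x = \<zero>" if "x \<in> tor" for x
    using norm_torsion[OF u(1,2) that] that unfolding e by (simp add: add_coeff K_double one_closed)
  ultimately show "t \<in> norm_targets" using t by (auto simp: norm_targets_def Sym_def)
qed

text \<open>
  Multiplying the elements of norm \<open>1 + t\<close> and \<open>1 + t'\<close> adds \<open>t\<close> and \<open>t'\<close>, because \<open>t t' = 0\<close>.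
\<close>

lemma attained_add:
  assumes "t \<in> attained" "t' \<in> attained"
  shows "t \<oplus>\<^bsub>R\<^esub> t' \<in> attained"
proof -
  obtain u u' where t: "t \<in> carrier R" "invariant c t" "t' \<in> carrier R" "invariant c t'"
    and u: "u \<in> carrier R" "aug u = \<one>" "norm u = \<one>\<^bsub>R\<^esub> \<oplus>\<^bsub>R\<^esub> t"
      "u' \<in> carrier R" "aug u' = \<one>" "norm u' = \<one>\<^bsub>R\<^esub> \<oplus>\<^bsub>R\<^esub> t'"
    using assms unfolding attained_def by auto
  have "norm (u \<otimes>\<^bsub>R\<^esub> u') = (\<one>\<^bsub>R\<^esub> \<oplus>\<^bsub>R\<^esub> t) \<otimes>\<^bsub>R\<^esub> (\<one>\<^bsub>R\<^esub> \<oplus>\<^bsub>R\<^esub> t')" using u by (simp add: norm_mult)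
  also have "\<dots> = \<one>\<^bsub>R\<^esub> \<oplus>\<^bsub>R\<^esub> (t \<oplus>\<^bsub>R\<^esub> t')"
    using t invariant_mult_zero[of t t'] by (simp add: R.l_distr R.r_distr R.a_ac)
  finally show ?thesis
    using t u c by (auto simp: attained_def invariant_add aug_mult intro!: bexI[of _ "u \<otimes>\<^bsub>R\<^esub> u'"])
qed

lemma zero_in_attained: "\<zero>\<^bsub>R\<^esub> \<in> attained"
  using c unfolding attained_def
  by (auto simp: invariant_def zero_coeff norm_one aug_one intro!: bexI[of _ "\<one>\<^bsub>R\<^esub>"])

text \<open>
  Witnessed by \<open>1 + l (1 + c) k\<close>, where the second summand has norm zero.
\<close>

lemma trace_in_attained:
  assumes [simp]: "l \<in> carrier K" "k \<in> carrier G"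
  shows "pair l k \<oplus>\<^bsub>R\<^esub> pair l (inv\<^bsub>G\<^esub> k) \<in> attained"
proof -
  have "norm (\<one>\<^bsub>R\<^esub> \<oplus>\<^bsub>R\<^esub> pair l k) = \<one>\<^bsub>R\<^esub> \<oplus>\<^bsub>R\<^esub> (pair l k \<oplus>\<^bsub>R\<^esub> pair l (inv\<^bsub>G\<^esub> k))"
    by (simp add: norm_one_add star_pair norm_invariant pair_invariant)
  moreover have "aug (\<one>\<^bsub>R\<^esub> \<oplus>\<^bsub>R\<^esub> pair l k) = \<one>" by (simp add: aug_add aug_pair aug_one)
  ultimately show ?thesis
    using c by (auto simp: attained_def invariant_add pair_invariant intro!: bexI[of _ "\<one>\<^bsub>R\<^esub> \<oplus>\<^bsub>R\<^esub> pair l k"])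
qed

lemma inv_of_root: "h \<in> carrier G \<Longrightarrow> h \<otimes>\<^bsub>G\<^esub> h = c \<Longrightarrow> inv\<^bsub>G\<^esub> h = c \<otimes>\<^bsub>G\<^esub> h"
  using c by (intro G.inv_equality) (simp_all add: G.m_assoc)

text \<open>
  For \<open>h\<^sup>2 = c\<close> one has \<open>(1 + h) (1 + h)\<^sup>* = h + h\<^sup>-\<^sup>1 = (1 + c) h\<close>, so the norm of \<open>1 + l k (1 + h)\<close>
  contains the quadratic term \<open>l\<^sup>2 (1 + c) h\<close> besides a trace.
\<close>

lemma norm_one_add_pair:
  assumes [simp]: "l \<in> carrier K" "k \<in> carrier G" "h \<in> carrier G" and h: "h \<otimes>\<^bsub>G\<^esub> h = c"
  shows "norm (\<one>\<^bsub>R\<^esub> \<oplus>\<^bsub>R\<^esub> (single l k \<oplus>\<^bsub>R\<^esub> single l (k \<otimes>\<^bsub>G\<^esub> h))) = \<one>\<^bsub>R\<^esub> \<oplus>\<^bsub>R\<^esub>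
    ((single l k \<oplus>\<^bsub>R\<^esub> single l (k \<otimes>\<^bsub>G\<^esub> h)) \<oplus>\<^bsub>R\<^esub> (single l (inv\<^bsub>G\<^esub> k) \<oplus>\<^bsub>R\<^esub> single l (inv\<^bsub>G\<^esub> k \<otimes>\<^bsub>G\<^esub> (c \<otimes>\<^bsub>G\<^esub> h)))
      \<oplus>\<^bsub>R\<^esub> pair (l \<otimes> l) h)"
proof -
  let ?x = "single l k \<oplus>\<^bsub>R\<^esub> single l (k \<otimes>\<^bsub>G\<^esub> h)"
  have [simp]: "c \<in> carrier G" by (rule c)
  have sx: "star ?x = single l (inv\<^bsub>G\<^esub> k) \<oplus>\<^bsub>R\<^esub> single l (inv\<^bsub>G\<^esub> k \<otimes>\<^bsub>G\<^esub> (c \<otimes>\<^bsub>G\<^esub> h))"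
    by (simp add: star_add star_single G.inv_mult inv_of_root h)
  have g: "k \<otimes>\<^bsub>G\<^esub> (inv\<^bsub>G\<^esub> k \<otimes>\<^bsub>G\<^esub> (c \<otimes>\<^bsub>G\<^esub> h)) = c \<otimes>\<^bsub>G\<^esub> h"
    "k \<otimes>\<^bsub>G\<^esub> h \<otimes>\<^bsub>G\<^esub> inv\<^bsub>G\<^esub> k = h"
    "k \<otimes>\<^bsub>G\<^esub> h \<otimes>\<^bsub>G\<^esub> (inv\<^bsub>G\<^esub> k \<otimes>\<^bsub>G\<^esub> (c \<otimes>\<^bsub>G\<^esub> h)) = \<one>\<^bsub>G\<^esub>"
  proof -
    show "k \<otimes>\<^bsub>G\<^esub> (inv\<^bsub>G\<^esub> k \<otimes>\<^bsub>G\<^esub> (c \<otimes>\<^bsub>G\<^esub> h)) = c \<otimes>\<^bsub>G\<^esub> h" by (simp add: G.m_assoc[symmetric])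
    show 2: "k \<otimes>\<^bsub>G\<^esub> h \<otimes>\<^bsub>G\<^esub> inv\<^bsub>G\<^esub> k = h" by (simp add: G.m_comm[of k h] G.m_assoc)
    have "k \<otimes>\<^bsub>G\<^esub> h \<otimes>\<^bsub>G\<^esub> (inv\<^bsub>G\<^esub> k \<otimes>\<^bsub>G\<^esub> (c \<otimes>\<^bsub>G\<^esub> h)) = (k \<otimes>\<^bsub>G\<^esub> h \<otimes>\<^bsub>G\<^esub> inv\<^bsub>G\<^esub> k) \<otimes>\<^bsub>G\<^esub> (c \<otimes>\<^bsub>G\<^esub> h)"
      by (simp add: G.m_assoc)
    also have "\<dots> = c \<otimes>\<^bsub>G\<^esub> (h \<otimes>\<^bsub>G\<^esub> h)" unfolding 2 by (simp add: G.m_lcomm)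
    finally show "k \<otimes>\<^bsub>G\<^esub> h \<otimes>\<^bsub>G\<^esub> (inv\<^bsub>G\<^esub> k \<otimes>\<^bsub>G\<^esub> (c \<otimes>\<^bsub>G\<^esub> h)) = \<one>\<^bsub>G\<^esub>" using c h by simp
  qed
  have "norm ?x = pair (l \<otimes> l) h"
    unfolding norm_def sx pair_def
    by (simp add: R.l_distr R.r_distr single_mult_single g R_add_ac)
  then show ?thesis
    using norm_one_add[of ?x] unfolding sx by simp
qed

lemma pair_in_attained:
  assumes "l \<in> carrier K" "k \<in> carrier G" "h \<in> carrier G" "h \<otimes>\<^bsub>G\<^esub> h = c"
    and "t \<in> carrier R" "invariant c t"
    and "(single l k \<oplus>\<^bsub>R\<^esub> single l (k \<otimes>\<^bsub>G\<^esub> h)) \<oplus>\<^bsub>R\<^esub> (single l (inv\<^bsub>G\<^esub> k) \<oplus>\<^bsub>R\<^esub> single l (inv\<^bsub>G\<^esub> k \<otimes>\<^bsub>G\<^esub> (c \<otimes>\<^bsub>G\<^esub> h))) = t"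
  shows "t \<oplus>\<^bsub>R\<^esub> pair (l \<otimes> l) h \<in> attained"
proof -
  let ?u = "\<one>\<^bsub>R\<^esub> \<oplus>\<^bsub>R\<^esub> (single l k \<oplus>\<^bsub>R\<^esub> single l (k \<otimes>\<^bsub>G\<^esub> h))"
  have "norm ?u = \<one>\<^bsub>R\<^esub> \<oplus>\<^bsub>R\<^esub> (t \<oplus>\<^bsub>R\<^esub> pair (l \<otimes> l) h)"
    using norm_one_add_pair[OF assms(1-4)] assms(7) by simp
  moreover have "aug ?u = \<one>" using assms(1-3) by (simp add: aug_add aug_one aug_single K_double)
  ultimately show ?thesis
    using assms(1-6) c by (auto simp: attained_def invariant_add pair_invariant intro!: bexI[of _ ?u])
qed

text \<open>
  For \<open>k\<^sup>2 = c\<close> the trace of \<open>l k (1 + h)\<close> is \<open>l (1 + c) k\<close>. With \<open>k = h\<close> this attains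
  \<open>(l + l\<^sup>2) (1 + c) h\<close>.
\<close>

lemma roots_in_attained:
  assumes l [simp]: "l \<in> carrier K" and h: "h \<in> carrier G" "h \<otimes>\<^bsub>G\<^esub> h = c" "k \<in> carrier G" "k \<otimes>\<^bsub>G\<^esub> k = c"
  shows "pair l k \<oplus>\<^bsub>R\<^esub> pair (l \<otimes> l) h \<in> attained"
proof (rule pair_in_attained[where k = k and h = h])
  have "c \<otimes>\<^bsub>G\<^esub> k \<otimes>\<^bsub>G\<^esub> (c \<otimes>\<^bsub>G\<^esub> h) = c \<otimes>\<^bsub>G\<^esub> (c \<otimes>\<^bsub>G\<^esub> (k \<otimes>\<^bsub>G\<^esub> h))"
    using h c by (simp add: G.m_assoc G.m_lcomm)
  then have "c \<otimes>\<^bsub>G\<^esub> k \<otimes>\<^bsub>G\<^esub> (c \<otimes>\<^bsub>G\<^esub> h) = k \<otimes>\<^bsub>G\<^esub> h" using h by (simp add: c_c)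
  then show "(single l k \<oplus>\<^bsub>R\<^esub> single l (k \<otimes>\<^bsub>G\<^esub> h)) \<oplus>\<^bsub>R\<^esub> (single l (inv\<^bsub>G\<^esub> k) \<oplus>\<^bsub>R\<^esub> single l (inv\<^bsub>G\<^esub> k \<otimes>\<^bsub>G\<^esub> (c \<otimes>\<^bsub>G\<^esub> h))) = pair l k"
    using h by (simp add: inv_of_root pair_def R_add_ac)
qed (use h in \<open>auto simp: pair_invariant\<close>)

text \<open>
  For \<open>k\<^sup>2 = h\<close> the trace of \<open>l k (1 + h)\<close> is already attained, which leaves the quadratic term.
\<close>

lemma root_square_in_attained:
  assumes l [simp]: "l \<in> carrier K" and h: "h \<in> carrier G" "h \<otimes>\<^bsub>G\<^esub> h = c" "k \<in> carrier G" "k \<otimes>\<^bsub>G\<^esub> k = h"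
  shows "pair (l \<otimes> l) h \<in> attained"
proof -
  have ik: "inv\<^bsub>G\<^esub> k = c \<otimes>\<^bsub>G\<^esub> (k \<otimes>\<^bsub>G\<^esub> h)"
  proof (rule G.inv_equality)
    have "c \<otimes>\<^bsub>G\<^esub> (k \<otimes>\<^bsub>G\<^esub> h) \<otimes>\<^bsub>G\<^esub> k = c \<otimes>\<^bsub>G\<^esub> (h \<otimes>\<^bsub>G\<^esub> (k \<otimes>\<^bsub>G\<^esub> k))"
      using h(1,3) c by (simp add: G.m_assoc G.m_comm G.m_lcomm)
    then show "c \<otimes>\<^bsub>G\<^esub> (k \<otimes>\<^bsub>G\<^esub> h) \<otimes>\<^bsub>G\<^esub> k = \<one>\<^bsub>G\<^esub>" using h c by simp
  qed (use h c in auto)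
  have ik': "inv\<^bsub>G\<^esub> k \<otimes>\<^bsub>G\<^esub> (c \<otimes>\<^bsub>G\<^esub> h) = c \<otimes>\<^bsub>G\<^esub> k"
  proof -
    have "inv\<^bsub>G\<^esub> k \<otimes>\<^bsub>G\<^esub> (c \<otimes>\<^bsub>G\<^esub> h) = (c \<otimes>\<^bsub>G\<^esub> c) \<otimes>\<^bsub>G\<^esub> (k \<otimes>\<^bsub>G\<^esub> (h \<otimes>\<^bsub>G\<^esub> h))"
      unfolding ik using h(1,3) c(1) by (simp add: G.m_assoc G.m_lcomm)
    then show ?thesis using h c by (simp add: G.m_comm)
  qed
  have t: "pair l k \<oplus>\<^bsub>R\<^esub> pair l (inv\<^bsub>G\<^esub> k) \<in> attained" using h by (simp add: trace_in_attained)
  have tr: "pair l k \<oplus>\<^bsub>R\<^esub> pair l (inv\<^bsub>G\<^esub> k) \<oplus>\<^bsub>R\<^esub> pair (l \<otimes> l) h \<in> attained"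
  proof (rule pair_in_attained[where k = k and h = h])
    have "pair l (inv\<^bsub>G\<^esub> k) = single l (inv\<^bsub>G\<^esub> k) \<oplus>\<^bsub>R\<^esub> single l (k \<otimes>\<^bsub>G\<^esub> h)"
      unfolding pair_def ik using h by (simp add: c_c)
    then show "(single l k \<oplus>\<^bsub>R\<^esub> single l (k \<otimes>\<^bsub>G\<^esub> h)) \<oplus>\<^bsub>R\<^esub> (single l (inv\<^bsub>G\<^esub> k) \<oplus>\<^bsub>R\<^esub> single l (inv\<^bsub>G\<^esub> k \<otimes>\<^bsub>G\<^esub> (c \<otimes>\<^bsub>G\<^esub> h))) =
        pair l k \<oplus>\<^bsub>R\<^esub> pair l (inv\<^bsub>G\<^esub> k)"
      unfolding ik' by (simp add: pair_def[of l k] R.a_ac)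
  qed (use h c in \<open>auto simp: pair_invariant invariant_add\<close>)
  show ?thesis using attained_add[OF t tr] h by (simp add: R_double_left R.a_assoc[symmetric] R_double)
qed

lemma norm_targets_closed: "t \<in> norm_targets \<Longrightarrow> t \<in> carrier R"
  by (simp add: norm_targets_def Sym_def)

lemma norm_targets_add: "t \<in> norm_targets \<Longrightarrow> t' \<in> norm_targets \<Longrightarrow> t \<oplus>\<^bsub>R\<^esub> t' \<in> norm_targets"
  using c by (auto simp: norm_targets_def Sym_def star_add invariant_add add_coeff)

lemma pair_in_norm_targets:
  assumes "l \<in> carrier K" "h \<in> carrier G" "h \<otimes>\<^bsub>G\<^esub> h = c"
  shows "pair l h \<in> norm_targets"
proof -
  have "star (pair l h) = pair l h" using assms by (simp add: star_pair inv_of_root pair_translate)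
  moreover have "pair l h x = \<zero>" if x: "x \<in> carrier G" "x \<otimes>\<^bsub>G\<^esub> x = \<one>\<^bsub>G\<^esub>" for x
  proof -
    have "(c \<otimes>\<^bsub>G\<^esub> h) \<otimes>\<^bsub>G\<^esub> (c \<otimes>\<^bsub>G\<^esub> h) = c \<otimes>\<^bsub>G\<^esub> (c \<otimes>\<^bsub>G\<^esub> (h \<otimes>\<^bsub>G\<^esub> h))"
      using assms(2) c(1) by (simp add: G.m_assoc G.m_lcomm)
    then have "(c \<otimes>\<^bsub>G\<^esub> h) \<otimes>\<^bsub>G\<^esub> (c \<otimes>\<^bsub>G\<^esub> h) = c" using assms c by (simp add: c_c)
    then have "x \<noteq> h" "x \<noteq> c \<otimes>\<^bsub>G\<^esub> h" using x assms(3) c(3) by auto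
    then show ?thesis using x assms by (simp add: pair_coeff)
  qed
  ultimately show ?thesis using assms by (simp add: norm_targets_def Sym_def pair_invariant)
qed

lemma roots_congruent:
  assumes "l \<in> carrier K" "h \<in> carrier G" "h \<otimes>\<^bsub>G\<^esub> h = c" "k \<in> carrier G" "k \<otimes>\<^bsub>G\<^esub> k = c"
  shows "pair l h \<oplus>\<^bsub>R\<^esub> pair l k \<in> attained"
proof -
  have "(pair l h \<oplus>\<^bsub>R\<^esub> pair (l \<otimes> l) k) \<oplus>\<^bsub>R\<^esub> (pair l k \<oplus>\<^bsub>R\<^esub> pair (l \<otimes> l) k) \<in> attained"
    using assms by (intro attained_add roots_in_attained)
  then show ?thesis using assms(1) by (simp add: R_add_ac)
qed

text \<open>
  Induction on the support. If \<open>h\<close> lies in the support of \<open>t\<close>, then \<open>t\<close> has the same coefficient on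
  \<open>{h, c h, h\<^sup>-\<^sup>1, c h\<^sup>-\<^sup>1}\<close>. These are four elements that an attained trace removes, unless \<open>h\<^sup>2 = c\<close>;
  then they are two, and the corresponding pair is moved to \<open>g\<close>.
\<close>

lemma reduce_mod_attained:
  assumes g: "g \<in> carrier G" "g \<otimes>\<^bsub>G\<^esub> g = c"
  shows "t \<in> norm_targets \<Longrightarrow> \<exists>l\<in>carrier K. t \<oplus>\<^bsub>R\<^esub> pair l g \<in> attained"
proof (induction "card (gr_support K G t)" arbitrary: t rule: less_induct)
  case less
  note t = norm_targets_closed[OF less.prems]
  show ?case
  proof (cases "\<exists>h\<in>carrier G. t h \<noteq> \<zero>")
    case False
    then have "t = \<zero>\<^bsub>R\<^esub>" using t by (intro group_algebra_eqI) (auto simp: zero_coeff)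
    moreover have "pair \<zero> g = \<zero>\<^bsub>R\<^esub>"
      using g by (intro group_algebra_eqI) (auto simp: zero_coeff pair_coeff)
    ultimately show ?thesis using zero_in_attained by (intro bexI[of _ \<zero>]) auto
  next
    case True
    then obtain h where h: "h \<in> carrier G" "t h \<noteq> \<zero>" by auto
    define l where "l = t h"
    have l: "l \<in> carrier K" using t h by (simp add: l_def)
    have hc: "t (c \<otimes>\<^bsub>G\<^esub> h) = l" using less.prems h by (simp add: norm_targets_def invariant_def l_def)
    have step: "\<exists>l\<in>carrier K. t \<oplus>\<^bsub>R\<^esub> pair l g \<in> attained"
      if d: "d \<in> norm_targets" "\<mu> \<in> carrier K" "d \<oplus>\<^bsub>R\<^esub> pair \<mu> g \<in> attained" "d h = l"
        "\<And>x. x \<in> carrier G \<Longrightarrow> t x = \<zero> \<Longrightarrow> d x = \<zero>" for d \<mu>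
    proof -
      have "gr_support K G (t \<oplus>\<^bsub>R\<^esub> d) \<subset> gr_support K G t"
      proof
        show "gr_support K G (t \<oplus>\<^bsub>R\<^esub> d) \<subseteq> gr_support K G t"
          using d(5) by (auto simp: gr_support_def add_coeff)
        have "h \<in> gr_support K G t" "h \<notin> gr_support K G (t \<oplus>\<^bsub>R\<^esub> d)"
          using h d(4) l by (auto simp: gr_support_def add_coeff l_def K_double)
        then show "gr_support K G (t \<oplus>\<^bsub>R\<^esub> d) \<noteq> gr_support K G t" by blast
      qed
      then have "card (gr_support K G (t \<oplus>\<^bsub>R\<^esub> d)) < card (gr_support K G t)"
        by (intro psubset_card_mono) (auto simp: gr_support_def finite_G)
      then obtain \<nu> where nu: "\<nu> \<in> carrier K" "t \<oplus>\<^bsub>R\<^esub> d \<oplus>\<^bsub>R\<^esub> pair \<nu> g \<in> attained"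
        using less.hyps norm_targets_add[OF less.prems d(1)] by blast
      have "(t \<oplus>\<^bsub>R\<^esub> d \<oplus>\<^bsub>R\<^esub> pair \<nu> g) \<oplus>\<^bsub>R\<^esub> (d \<oplus>\<^bsub>R\<^esub> pair \<mu> g) \<in> attained" by (rule attained_add[OF nu(2) d(3)])
      also have "(t \<oplus>\<^bsub>R\<^esub> d \<oplus>\<^bsub>R\<^esub> pair \<nu> g) \<oplus>\<^bsub>R\<^esub> (d \<oplus>\<^bsub>R\<^esub> pair \<mu> g) = t \<oplus>\<^bsub>R\<^esub> pair (\<nu> \<oplus> \<mu>) g"
        using t norm_targets_closed[OF d(1)] nu(1) d(2) g by (simp add: pair_add[symmetric] R_add_ac)
      finally show ?thesis using nu(1) d(2) by blast
    qed
    show ?thesis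
    proof (cases "h \<otimes>\<^bsub>G\<^esub> h = c")
      case True
      show ?thesis
      proof (rule step[of "pair l h" l])
        show "pair l h x = \<zero>" if "x \<in> carrier G" "t x = \<zero>" for x
          using that h l hc by (auto simp: pair_coeff)
      qed (use h l g True in \<open>auto simp: pair_in_norm_targets pair_coeff roots_congruent\<close>)
    next
      case False
      have ih: "t (inv\<^bsub>G\<^esub> h) = l" "t (c \<otimes>\<^bsub>G\<^esub> inv\<^bsub>G\<^esub> h) = l"
        using less.prems h by (auto simp: norm_targets_def Sym_def symmetric_coeff invariant_def l_def)
      have ne: "h \<noteq> inv\<^bsub>G\<^esub> h" "h \<noteq> c \<otimes>\<^bsub>G\<^esub> inv\<^bsub>G\<^esub> h"
      proof -
        have "h \<notin> tor" using less.prems h by (auto simp: norm_targets_def)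
        then show "h \<noteq> inv\<^bsub>G\<^esub> h" using h inv_eq_self_iff[of h] by auto
        show "h \<noteq> c \<otimes>\<^bsub>G\<^esub> inv\<^bsub>G\<^esub> h"
        proof
          assume "h = c \<otimes>\<^bsub>G\<^esub> inv\<^bsub>G\<^esub> h"
          then have "h \<otimes>\<^bsub>G\<^esub> h = c \<otimes>\<^bsub>G\<^esub> inv\<^bsub>G\<^esub> h \<otimes>\<^bsub>G\<^esub> h" by simp
          then show False using False h c by (simp add: G.m_assoc)
        qed
      qed
      show ?thesis
      proof (rule step[of "pair l h \<oplus>\<^bsub>R\<^esub> pair l (inv\<^bsub>G\<^esub> h)" \<zero>])
        show "pair l h \<oplus>\<^bsub>R\<^esub> pair l (inv\<^bsub>G\<^esub> h) \<in> norm_targets" using trace_in_attained attained_subset_norm_targets l h by blast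
        have "pair \<zero> g = \<zero>\<^bsub>R\<^esub>"
          using g by (intro group_algebra_eqI) (auto simp: zero_coeff pair_coeff)
        then show "pair l h \<oplus>\<^bsub>R\<^esub> pair l (inv\<^bsub>G\<^esub> h) \<oplus>\<^bsub>R\<^esub> pair \<zero> g \<in> attained" using trace_in_attained[OF l h(1)] l by simp
        show "(pair l h \<oplus>\<^bsub>R\<^esub> pair l (inv\<^bsub>G\<^esub> h)) h = l" using ne l h by (simp add: add_coeff pair_coeff)
        show "(pair l h \<oplus>\<^bsub>R\<^esub> pair l (inv\<^bsub>G\<^esub> h)) x = \<zero>" if "x \<in> carrier G" "t x = \<zero>" for x
        proof -
          have "x \<notin> {h, c \<otimes>\<^bsub>G\<^esub> h, inv\<^bsub>G\<^esub> h, c \<otimes>\<^bsub>G\<^esub> inv\<^bsub>G\<^esub> h}"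
            using that h l hc ih l_def by auto
          then show ?thesis using that h l by (simp add: add_coeff pair_coeff)
        qed
      qed auto
    qed
  qed
qed

text \<open>
  With \<open>g = k\<^sup>2\<close> all pairs \<open>l\<^sup>2 (1 + c) g\<close> are attained, and every scalar is a square.
\<close>

lemma attained_eq_norm_targets:
  assumes "k \<in> carrier G" "(k \<otimes>\<^bsub>G\<^esub> k) \<otimes>\<^bsub>G\<^esub> (k \<otimes>\<^bsub>G\<^esub> k) = c"
  shows "attained = norm_targets"
proof
  show "norm_targets \<subseteq> attained"
  proof
    fix t assume t: "t \<in> norm_targets"
    let ?g = "k \<otimes>\<^bsub>G\<^esub> k"
    obtain l where l: "l \<in> carrier K" "t \<oplus>\<^bsub>R\<^esub> pair l ?g \<in> attained"
      using reduce_mod_attained[of ?g t] assms t by auto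
    obtain y where "y \<in> carrier K" "l = y \<otimes> y" using K_square_surj[OF l(1)] by auto
    then have "pair l ?g \<in> attained" using assms root_square_in_attained[of y ?g k] by simp
    from attained_add[OF l(2) this] show "t \<in> attained"
      using norm_targets_closed[OF t] l(1) assms by (simp add: R.a_assoc R_double)
  qed
qed (rule attained_subset_norm_targets)

end

section \<open>The norms attained when the involution is no fourth power\<close>

context central_involution
begin

text \<open>
  If \<open>g\<close> were the product of an element of order at most two and a square, \<open>c = g\<^sup>2\<close> would be a
  fourth power. Hence some subgroup containing the \<open>2\<close>-torsion and the squares avoids \<open>g\<close>. A
  maximal one has index two, since its quotient has exponent two and adjoining any further element
  brings in \<open>g\<close>.
\<close>

lemma index_two_subgroup:
  assumes g: "g \<in> carrier G" "g \<otimes>\<^bsub>G\<^esub> g = c"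
    and no_root: "\<And>k. k \<in> carrier G \<Longrightarrow> (k \<otimes>\<^bsub>G\<^esub> k) \<otimes>\<^bsub>G\<^esub> (k \<otimes>\<^bsub>G\<^esub> k) \<noteq> c"
  obtains M where "subgroup M G" "tor \<subseteq> M" "g \<notin> M" "\<forall>x\<in>carrier G - M. g \<otimes>\<^bsub>G\<^esub> x \<in> M"
proof -
  \<comment> \<open>the subgroup generated by the torsion and the squares\<close>
  define Z where "Z = {x \<otimes>\<^bsub>G\<^esub> (y \<otimes>\<^bsub>G\<^esub> y) | x y. x \<in> tor \<and> y \<in> carrier G}"
  have "subgroup Z G"
  proof (rule G.subgroupI)
    show "Z \<subseteq> carrier G" by (auto simp: Z_def)
    have "\<one>\<^bsub>G\<^esub> \<in> tor" by simp
    then show "Z \<noteq> {}" unfolding Z_def by blast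
  next
    fix a assume "a \<in> Z"
    then obtain x y where a: "a = x \<otimes>\<^bsub>G\<^esub> (y \<otimes>\<^bsub>G\<^esub> y)" "x \<in> tor" "y \<in> carrier G" by (auto simp: Z_def)
    then have "inv\<^bsub>G\<^esub> a = inv\<^bsub>G\<^esub> x \<otimes>\<^bsub>G\<^esub> (inv\<^bsub>G\<^esub> y \<otimes>\<^bsub>G\<^esub> inv\<^bsub>G\<^esub> y)" by (simp add: G.inv_mult)
    moreover have "inv\<^bsub>G\<^esub> x \<in> tor" using a by (simp add: G.inv_mult[symmetric])
    ultimately show "inv\<^bsub>G\<^esub> a \<in> Z" using a unfolding Z_def by blast
  next
    fix a b assume "a \<in> Z" "b \<in> Z"
    then obtain x y x' y' where ab: "a = x \<otimes>\<^bsub>G\<^esub> (y \<otimes>\<^bsub>G\<^esub> y)" "x \<in> tor" "y \<in> carrier G"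
      "b = x' \<otimes>\<^bsub>G\<^esub> (y' \<otimes>\<^bsub>G\<^esub> y')" "x' \<in> tor" "y' \<in> carrier G" by (auto simp: Z_def)
    then have "a \<otimes>\<^bsub>G\<^esub> b = (x \<otimes>\<^bsub>G\<^esub> x') \<otimes>\<^bsub>G\<^esub> ((y \<otimes>\<^bsub>G\<^esub> y') \<otimes>\<^bsub>G\<^esub> (y \<otimes>\<^bsub>G\<^esub> y'))" by (simp add: G.m_ac)
    moreover have "x \<otimes>\<^bsub>G\<^esub> x' \<in> tor"
    proof -
      have xG: "x \<in> carrier G" "x' \<in> carrier G" using ab by auto
      have "(x \<otimes>\<^bsub>G\<^esub> x') \<otimes>\<^bsub>G\<^esub> (x \<otimes>\<^bsub>G\<^esub> x') = (x \<otimes>\<^bsub>G\<^esub> x) \<otimes>\<^bsub>G\<^esub> (x' \<otimes>\<^bsub>G\<^esub> x')"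
        using xG by (simp only: G.m_ac G.m_closed)
      then show ?thesis using ab by simp
    qed
    ultimately show "a \<otimes>\<^bsub>G\<^esub> b \<in> Z" using ab unfolding Z_def by blast
  qed
  moreover have "g \<notin> Z"
  proof
    assume "g \<in> Z"
    then obtain x y where xy: "g = x \<otimes>\<^bsub>G\<^esub> (y \<otimes>\<^bsub>G\<^esub> y)" "x \<in> tor" "y \<in> carrier G" by (auto simp: Z_def)
    have xG: "x \<in> carrier G" using xy by auto
    have "c = (x \<otimes>\<^bsub>G\<^esub> x) \<otimes>\<^bsub>G\<^esub> ((y \<otimes>\<^bsub>G\<^esub> y) \<otimes>\<^bsub>G\<^esub> (y \<otimes>\<^bsub>G\<^esub> y))"
      unfolding g(2)[symmetric] xy(1) using xG xy(3) by (simp only: G.m_ac G.m_closed)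
    then show False using no_root[of y] xy by simp
  qed
  moreover define F where "F = {M. subgroup M G \<and> Z \<subseteq> M \<and> g \<notin> M}"
  ultimately have "Z \<in> F" by simp
  moreover have "finite F"
    by (rule finite_subset[of _ "Pow (carrier G)"]) (auto simp: F_def finite_G dest: subgroup.subset)
  ultimately obtain M where M: "M \<in> F" "\<And>N. N \<in> F \<Longrightarrow> M \<subseteq> N \<Longrightarrow> M = N"
    using finite_has_maximal[of F] by blast
  have sub: "subgroup M G" "Z \<subseteq> M" "g \<notin> M" using M(1) by (auto simp: F_def)
  have MG: "M \<subseteq> carrier G" using sub(1) by (rule subgroup.subset)
  have sq: "y \<otimes>\<^bsub>G\<^esub> y \<in> M" if "y \<in> carrier G" for y
  proof -
    have "\<one>\<^bsub>G\<^esub> \<otimes>\<^bsub>G\<^esub> (y \<otimes>\<^bsub>G\<^esub> y) \<in> Z" 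
      using that G.one_closed G.l_one[OF G.one_closed] unfolding Z_def by blast
    then show ?thesis using sub(2) that by auto
  qed
  have tor: "tor \<subseteq> M"
  proof
    fix x assume x: "x \<in> tor"
    then have "x \<otimes>\<^bsub>G\<^esub> (\<one>\<^bsub>G\<^esub> \<otimes>\<^bsub>G\<^esub> \<one>\<^bsub>G\<^esub>) \<in> Z" using G.one_closed unfolding Z_def by blast
    then show "x \<in> M" using sub(2) x by auto
  qed
  have "g \<otimes>\<^bsub>G\<^esub> x \<in> M" if x: "x \<in> carrier G" "x \<notin> M" for x
  proof -
    define N where "N = M \<union> (\<lambda>y. x \<otimes>\<^bsub>G\<^esub> y) ` M"
    have "subgroup N G"
    proof (rule G.subgroupI)
      show "N \<subseteq> carrier G" "N \<noteq> {}" using MG x subgroup.one_closed[OF sub(1)] by (auto simp: N_def)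
    next
      fix a assume "a \<in> N"
      then consider "a \<in> M" | y where "y \<in> M" "a = x \<otimes>\<^bsub>G\<^esub> y" by (auto simp: N_def)
      then show "inv\<^bsub>G\<^esub> a \<in> N"
      proof cases
        case 1
        then show ?thesis using sub(1) by (simp add: N_def subgroup.m_inv_closed)
      next
        case 2
        have y: "y \<in> carrier G" using 2 MG by auto
        have "inv\<^bsub>G\<^esub> a = x \<otimes>\<^bsub>G\<^esub> (inv\<^bsub>G\<^esub> (x \<otimes>\<^bsub>G\<^esub> x) \<otimes>\<^bsub>G\<^esub> inv\<^bsub>G\<^esub> y)"
          unfolding 2 using x y by (simp add: G.inv_mult G.m_assoc[symmetric])
        moreover have "inv\<^bsub>G\<^esub> (x \<otimes>\<^bsub>G\<^esub> x) \<otimes>\<^bsub>G\<^esub> inv\<^bsub>G\<^esub> y \<in> M"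
          using sq[OF x(1)] 2 sub(1) by (simp add: subgroup.m_inv_closed subgroup.m_closed)
        ultimately show ?thesis by (simp add: N_def)
      qed
    next
      fix a b assume "a \<in> N" "b \<in> N"
      then consider "a \<in> M" "b \<in> M" | y where "y \<in> M" "a = x \<otimes>\<^bsub>G\<^esub> y" "b \<in> M"
        | z where "a \<in> M" "z \<in> M" "b = x \<otimes>\<^bsub>G\<^esub> z"
        | y z where "y \<in> M" "a = x \<otimes>\<^bsub>G\<^esub> y" "z \<in> M" "b = x \<otimes>\<^bsub>G\<^esub> z" by (auto simp: N_def)
      then show "a \<otimes>\<^bsub>G\<^esub> b \<in> N"
      proof cases
        case 1
        then show ?thesis using sub(1) by (simp add: N_def subgroup.m_closed)
      next
        case 2
        then have "a \<otimes>\<^bsub>G\<^esub> b = x \<otimes>\<^bsub>G\<^esub> (y \<otimes>\<^bsub>G\<^esub> b)" using x MG by (auto simp: G.m_assoc subset_iff)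
        then show ?thesis using 2 sub(1) by (simp add: N_def subgroup.m_closed)
      next
        case 3
        then have "a \<otimes>\<^bsub>G\<^esub> b = x \<otimes>\<^bsub>G\<^esub> (a \<otimes>\<^bsub>G\<^esub> z)" using x MG by (auto simp: G.m_lcomm subset_iff)
        then show ?thesis using 3 sub(1) by (simp add: N_def subgroup.m_closed)
      next
        case 4
        then have yz: "y \<in> carrier G" "z \<in> carrier G" using MG by auto
        have "a \<otimes>\<^bsub>G\<^esub> b = (x \<otimes>\<^bsub>G\<^esub> x) \<otimes>\<^bsub>G\<^esub> (y \<otimes>\<^bsub>G\<^esub> z)" unfolding 4 using x yz by (simp add: G.m_ac)
        then show ?thesis using 4 sub(1) sq[OF x(1)] by (simp add: N_def subgroup.m_closed)
      qed
    qed
    moreover have "x \<in> N"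
      using x(1) subgroup.one_closed[OF sub(1)] unfolding N_def by force
    ultimately have "g \<in> N" using M(2)[of N] sub(2) x(2) by (auto simp: F_def N_def)
    then obtain y where y: "y \<in> M" "g = x \<otimes>\<^bsub>G\<^esub> y" using sub(3) by (auto simp: N_def)
    then have "g \<otimes>\<^bsub>G\<^esub> x = (x \<otimes>\<^bsub>G\<^esub> x) \<otimes>\<^bsub>G\<^esub> y" using x MG by (auto simp: G.m_ac subset_iff)
    then show ?thesis using y sq[OF x(1)] sub(1) by (simp add: subgroup.m_closed)
  qed
  then show ?thesis using that sub tor by blast
qed

text \<open>
  Let \<open>x\<close> and \<open>y = 1 + x\<close> be the sums of the coefficients of \<open>u\<close> over a subgroup \<open>M\<close> of index two
  avoiding \<open>g\<close> and over its complement \<open>N\<close>. Then \<open>x y\<close> is the sum over \<open>h\<close> in \<open>N\<close> of the half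
  correlations \<open>S h\<close>, in which only \<open>a \<in> M\<close> are summed, while the full coefficient of the norm at \<open>h\<close>
  is \<open>S h + S h\<^sup>-\<^sup>1\<close>. It vanishes on \<open>N\<close> except at \<open>g\<close> and \<open>g\<^sup>-\<^sup>1\<close>, and inversion has no fixed points on
  \<open>N\<close>, so \<open>x y\<close> reduces to \<open>S g + S g\<^sup>-\<^sup>1 = l\<close>.
\<close>

lemma pair_notin_attained:
  assumes g: "g \<in> carrier G" "g \<otimes>\<^bsub>G\<^esub> g = c"
    and no_root: "\<And>k. k \<in> carrier G \<Longrightarrow> (k \<otimes>\<^bsub>G\<^esub> k) \<otimes>\<^bsub>G\<^esub> (k \<otimes>\<^bsub>G\<^esub> k) \<noteq> c"
    and l: "l \<in> carrier K" "pair l g \<in> attained"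
  shows "l \<in> artin_schreier"
proof -
  obtain u where u: "u \<in> carrier R" "aug u = \<one>" "norm u = \<one>\<^bsub>R\<^esub> \<oplus>\<^bsub>R\<^esub> pair l g"
    using l by (auto simp: attained_def)
  obtain M where M: "subgroup M G" "tor \<subseteq> M" "g \<notin> M" "\<forall>x\<in>carrier G - M. g \<otimes>\<^bsub>G\<^esub> x \<in> M"
    by (rule index_two_subgroup[OF g no_root]) blast
  define N where "N = carrier G - M"
  have MG: "M \<subseteq> carrier G" using M(1) by (rule subgroup.subset)
  have fin: "finite M" "finite N" using MG finite_G finite_subset by (auto simp: N_def)
  have split: "(\<Oplus>a\<in>carrier G. f a) = (\<Oplus>a\<in>M. f a) \<oplus> (\<Oplus>a\<in>N. f a)"
    if "f \<in> carrier G \<rightarrow> carrier K" for f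
  proof -
    have "carrier G = M \<union> N" "M \<inter> N = {}" using MG by (auto simp: N_def)
    then show ?thesis using fin that MG K.finsum_Un_disjoint[of M N f] by (auto simp: Pi_iff N_def)
  qed
  have MM: "a \<otimes>\<^bsub>G\<^esub> b \<in> M" "inv\<^bsub>G\<^esub> a \<in> M" if "a \<in> M" "b \<in> M" for a b
    using M(1) that by (auto simp: subgroup.m_closed subgroup.m_inv_closed)
  have invN: "inv\<^bsub>G\<^esub> h \<in> N" if "h \<in> N" for h
    using that MM(2)[of "inv\<^bsub>G\<^esub> h"] by (auto simp: N_def)
  have NM: "h \<otimes>\<^bsub>G\<^esub> a \<in> N" if "h \<in> N" "a \<in> M" for h a
  proof -
    have "h \<in> M" if "h \<otimes>\<^bsub>G\<^esub> a \<in> M"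
    proof -
      have "h \<otimes>\<^bsub>G\<^esub> a \<otimes>\<^bsub>G\<^esub> inv\<^bsub>G\<^esub> a = h" using \<open>h \<in> N\<close> \<open>a \<in> M\<close> MG by (auto simp: N_def G.m_assoc)
      then show ?thesis using MM(1)[OF that MM(2)[OF \<open>a \<in> M\<close> \<open>a \<in> M\<close>]] by simp
    qed
    then show ?thesis using that MG by (auto simp: N_def)
  qed
  have NN: "h \<otimes>\<^bsub>G\<^esub> b \<in> M" if "h \<in> N" "b \<in> N" for h b
  proof -
    have hb: "h \<in> carrier G" "b \<in> carrier G" using that by (auto simp: N_def)
    have "(g \<otimes>\<^bsub>G\<^esub> h) \<otimes>\<^bsub>G\<^esub> (g \<otimes>\<^bsub>G\<^esub> b) \<in> M" by (rule MM(1)) (use that M(4) in \<open>auto simp: N_def\<close>)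
    moreover have "c \<in> M" using c M(2) by auto
    ultimately have "c \<otimes>\<^bsub>G\<^esub> ((g \<otimes>\<^bsub>G\<^esub> h) \<otimes>\<^bsub>G\<^esub> (g \<otimes>\<^bsub>G\<^esub> b)) \<in> M" using MM(1) by blast
    also have "(g \<otimes>\<^bsub>G\<^esub> h) \<otimes>\<^bsub>G\<^esub> (g \<otimes>\<^bsub>G\<^esub> b) = (g \<otimes>\<^bsub>G\<^esub> g) \<otimes>\<^bsub>G\<^esub> (h \<otimes>\<^bsub>G\<^esub> b)" using hb g(1) by (simp add: G.m_ac)
    also have "c \<otimes>\<^bsub>G\<^esub> ((g \<otimes>\<^bsub>G\<^esub> g) \<otimes>\<^bsub>G\<^esub> (h \<otimes>\<^bsub>G\<^esub> b)) = h \<otimes>\<^bsub>G\<^esub> b" unfolding g(2) using hb by (simp add: c_c)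
    finally show ?thesis .
  qed
  define S where "S h = (\<Oplus>a\<in>M. u a \<otimes> u (h \<otimes>\<^bsub>G\<^esub> a))" for h
  have Scl: "S h \<in> carrier K" if "h \<in> carrier G" for h
    unfolding S_def using that u(1) MG by (intro K.finsum_closed) auto
  have norm_S: "norm u h = S (inv\<^bsub>G\<^esub> h) \<oplus> S h" if h: "h \<in> N" for h
  proof -
    have hG: "h \<in> carrier G" using h by (simp add: N_def)
    have bij: "bij_betw (\<lambda>a. h \<otimes>\<^bsub>G\<^esub> a) M N"
    proof (rule bij_betw_byWitness[where f' = "\<lambda>a. inv\<^bsub>G\<^esub> h \<otimes>\<^bsub>G\<^esub> a"])
      show "(\<lambda>a. h \<otimes>\<^bsub>G\<^esub> a) ` M \<subseteq> N" using NM[OF h] by auto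
      show "(\<lambda>a. inv\<^bsub>G\<^esub> h \<otimes>\<^bsub>G\<^esub> a) ` N \<subseteq> M" using NN[OF invN[OF h]] by auto
    qed (use hG MG in \<open>auto simp: N_def G.m_assoc[symmetric] subset_iff\<close>)
    have "norm u h = (\<Oplus>a\<in>carrier G. u a \<otimes> u (inv\<^bsub>G\<^esub> h \<otimes>\<^bsub>G\<^esub> a))"
      using u(1) hG by (simp add: norm_def norm_coeff)
    also have "\<dots> = S (inv\<^bsub>G\<^esub> h) \<oplus> (\<Oplus>a\<in>N. u a \<otimes> u (inv\<^bsub>G\<^esub> h \<otimes>\<^bsub>G\<^esub> a))"
      unfolding S_def using u(1) hG by (intro split) auto
    also have "(\<Oplus>a\<in>N. u a \<otimes> u (inv\<^bsub>G\<^esub> h \<otimes>\<^bsub>G\<^esub> a)) =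
        (\<Oplus>a\<in>M. u (h \<otimes>\<^bsub>G\<^esub> a) \<otimes> u (inv\<^bsub>G\<^esub> h \<otimes>\<^bsub>G\<^esub> (h \<otimes>\<^bsub>G\<^esub> a)))"
      using u(1) hG by (intro K.finsum_bij_betw[OF bij]) (auto simp: N_def)
    also have "\<dots> = S h"
      unfolding S_def using u(1) hG MG
      by (intro K.finsum_cong') (auto simp: G.m_assoc[symmetric] K.m_comm subset_iff)
    finally show ?thesis .
  qed
  define x y where "x = (\<Oplus>a\<in>M. u a)" and "y = (\<Oplus>a\<in>N. u a)"
  have xy: "x \<in> carrier K" "y \<in> carrier K"
    unfolding x_def y_def using u(1) MG by (auto intro!: K.finsum_closed simp: N_def)
  have "\<one> = x \<oplus> y" using split[of u] u by (auto simp: aug_eq x_def y_def)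
  then have y: "y = \<one> \<oplus> x" using xy by (simp add: K_add_ac)
  have "(\<Oplus>h\<in>N. S h) = (\<Oplus>a\<in>M. \<Oplus>h\<in>N. u a \<otimes> u (h \<otimes>\<^bsub>G\<^esub> a))"
    unfolding S_def using fin u(1) MG by (intro K.finsum_swap) (auto simp: N_def)
  also have "\<dots> = (\<Oplus>a\<in>M. u a \<otimes> y)"
  proof (rule K.finsum_cong')
    fix a assume a: "a \<in> M"
    then have aG: "a \<in> carrier G" using MG by auto
    have bij: "bij_betw (\<lambda>h. h \<otimes>\<^bsub>G\<^esub> a) N N"
    proof (rule bij_betw_byWitness[where f' = "\<lambda>h. h \<otimes>\<^bsub>G\<^esub> inv\<^bsub>G\<^esub> a"])
      show "(\<lambda>h. h \<otimes>\<^bsub>G\<^esub> a) ` N \<subseteq> N" "(\<lambda>h. h \<otimes>\<^bsub>G\<^esub> inv\<^bsub>G\<^esub> a) ` N \<subseteq> N" using NM a MM(2) by auto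
    qed (use aG in \<open>auto simp: N_def G.m_assoc\<close>)
    have "y = (\<Oplus>h\<in>N. u (h \<otimes>\<^bsub>G\<^esub> a))"
      unfolding y_def using u(1) by (intro K.finsum_bij_betw[OF bij]) (auto simp: N_def)
    then show "(\<Oplus>h\<in>N. u a \<otimes> u (h \<otimes>\<^bsub>G\<^esub> a)) = u a \<otimes> y"
      using u(1) aG fin by (subst K.finsum_rdistr[symmetric]) (auto simp: N_def)
  qed (use u(1) MG xy in auto)
  also have "\<dots> = x \<otimes> y"
    unfolding x_def using u(1) MG xy fin by (subst K.finsum_ldistr[symmetric]) auto
  finally have sum1: "(\<Oplus>h\<in>N. S h) = x \<otimes> y" .
  have gN: "g \<in> N" "inv\<^bsub>G\<^esub> g \<in> N" using g(1) M(3) invN by (auto simp: N_def)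
  have gg: "g \<noteq> inv\<^bsub>G\<^esub> g" using g c inv_eq_self_iff[of g] by auto
  have NT: "h \<notin> tor" if "h \<in> N" for h using that M(2) by (auto simp: N_def)
  let ?N = "N - {g, inv\<^bsub>G\<^esub> g}"
  have "N = insert g (insert (inv\<^bsub>G\<^esub> g) ?N)" using gN by auto
  then have "(\<Oplus>h\<in>N. S h) = (\<Oplus>h\<in>insert g (insert (inv\<^bsub>G\<^esub> g) ?N). S h)" by simp
  also have "\<dots> = S g \<oplus> (S (inv\<^bsub>G\<^esub> g) \<oplus> (\<Oplus>h\<in>?N. S h))"
    using gg fin gN Scl by (subst K.finsum_insert) (auto simp: N_def K.finsum_insert)
  also have "(\<Oplus>h\<in>?N. S h) = (\<Oplus>h\<in>{h \<in> ?N. inv\<^bsub>G\<^esub> h = h}. S h)"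
  proof (rule K_involution)
    fix h assume h: "h \<in> ?N"
    then have hG: "h \<in> carrier G" by (simp add: N_def)
    show "inv\<^bsub>G\<^esub> h \<in> ?N" using h hG g(1) invN by auto
    have "h \<noteq> \<one>\<^bsub>G\<^esub>" using NT[of h] h by auto
    moreover have "h \<noteq> c \<otimes>\<^bsub>G\<^esub> g" using h inv_of_root[OF g] by auto
    ultimately have "norm u h = \<zero>" unfolding u(3) using h hG g l(1) by (simp add: add_coeff one_coeff pair_coeff)
    then have "S (inv\<^bsub>G\<^esub> h) \<oplus> S h = \<zero>" using norm_S[of h] h by simp
    then show "S (inv\<^bsub>G\<^esub> h) = S h" using Scl hG by (simp add: K_eq_iff)
  qed (use fin Scl in \<open>auto simp: N_def\<close>)
  also have "{h \<in> ?N. inv\<^bsub>G\<^esub> h = h} = {}" using NT inv_eq_self_iff by (auto simp: N_def)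
  also have "S g \<oplus> (S (inv\<^bsub>G\<^esub> g) \<oplus> (\<Oplus>h\<in>{}. S h)) = S (inv\<^bsub>G\<^esub> g) \<oplus> S g"
    using Scl g(1) by (simp add: K.a_comm K.finsum_empty)
  also have "\<dots> = norm u g" using norm_S gN by simp
  also have "\<dots> = l"
  proof -
    have "g \<noteq> \<one>\<^bsub>G\<^esub>" using NT[OF gN(1)] g(1) by auto
    then show ?thesis unfolding u(3) using g(1) l(1) by (simp add: add_coeff one_coeff pair_coeff)
  qed
  finally have "l = x \<otimes> y" using sum1 by simp
  then have "l = x \<oplus> x \<otimes> x" using xy unfolding y by (simp add: K.r_distr)
  then show ?thesis using xy by (simp add: artin_schreier_def)
qed

lemma card_norm_targets_eq_double:
  assumes g: "g \<in> carrier G" "g \<otimes>\<^bsub>G\<^esub> g = c"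
    and no_root: "\<And>k. k \<in> carrier G \<Longrightarrow> (k \<otimes>\<^bsub>G\<^esub> k) \<otimes>\<^bsub>G\<^esub> (k \<otimes>\<^bsub>G\<^esub> k) \<noteq> c"
  shows "card norm_targets = 2 * card attained"
proof -
  obtain l where l: "l \<in> carrier K" "l \<notin> artin_schreier"
    "\<And>x. x \<in> carrier K \<Longrightarrow> x \<in> artin_schreier \<or> x \<oplus> l \<in> artin_schreier"
    by (rule artin_schreier_index_two) blast
  have AS: "pair x g \<in> attained" if x: "x \<in> artin_schreier" for x
  proof -
    obtain a where a: "a \<in> carrier K" "x = a \<oplus> a \<otimes> a" using x by (auto simp: artin_schreier_def)
    then show ?thesis using roots_in_attained[OF a(1) g g] g by (simp add: pair_add)
  qed
  let ?s = "\<lambda>t. t \<oplus>\<^bsub>R\<^esub> pair l g"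
  have ss: "?s (?s t) = t" if "t \<in> carrier R" for t using that l(1) by (simp add: R.a_assoc R_double)
  have inj: "inj_on ?s attained" by (rule inj_on_inverseI[where g = ?s]) (simp add: ss attained_closed)
  have "norm_targets = attained \<union> ?s ` attained"
  proof
    show "attained \<union> ?s ` attained \<subseteq> norm_targets"
      using attained_subset_norm_targets pair_in_norm_targets[OF l(1) g] by (auto intro: norm_targets_add)
    show "norm_targets \<subseteq> attained \<union> ?s ` attained"
    proof
      fix t assume t: "t \<in> norm_targets"
      then have tR: "t \<in> carrier R" by (rule norm_targets_closed)
      obtain x where x: "x \<in> carrier K" "t \<oplus>\<^bsub>R\<^esub> pair x g \<in> attained" using reduce_mod_attained[OF g t] by auto
      show "t \<in> attained \<union> ?s ` attained"
      proof (cases "x \<in> artin_schreier")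
        case True
        from attained_add[OF x(2) AS[OF this]] show ?thesis
          using tR x(1) by (simp add: R.a_assoc R_double)
      next
        case False
        then have "x \<oplus> l \<in> artin_schreier" using l(3) x(1) by blast
        from attained_add[OF x(2) AS[OF this]] have "?s t \<in> attained"
          using tR x(1) l(1) g by (simp add: pair_add[symmetric] R_add_ac)
        then show ?thesis using ss[OF tR] by (metis UnI2 imageI)
      qed
    qed
  qed
  moreover have "attained \<inter> ?s ` attained = {}"
  proof -
    have False if "t \<in> attained" "?s t \<in> attained" for t
      using attained_add[OF that] pair_notin_attained[OF g no_root l(1)] l attained_closed[OF that(1)]
      by (simp add: R.a_assoc[symmetric] R_double)
    then show ?thesis by auto
  qed
  moreover have "finite attained" using finite_R attained_closed by (auto intro: finite_subset)
  ultimately show ?thesis using card_image[OF inj] by (simp add: card_Un_disjoint)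
qed

text \<open>
  The elements of \<open>KA\<close> whose image in the group algebra of the quotient by \<open>c\<close> is unitary.
\<close>

definition "almost_unitary = {u \<in> carrier R. aug u = \<one> \<and> invariant c (norm u \<oplus>\<^bsub>R\<^esub> \<one>\<^bsub>R\<^esub>)}"

text \<open>
  The elements of a given norm form a coset of the unitary ones.
\<close>

lemma card_almost_unitary: "card almost_unitary = card attained * card unitary"
proof (rule card_eq_card_times_fibre[where f = "\<lambda>u. norm u \<oplus>\<^bsub>R\<^esub> \<one>\<^bsub>R\<^esub>"])
  show "finite almost_unitary" "finite attained"
    using finite_R attained_closed by (auto intro: finite_subset simp: almost_unitary_def)
  show "(\<lambda>u. norm u \<oplus>\<^bsub>R\<^esub> \<one>\<^bsub>R\<^esub>) \<in> almost_unitary \<rightarrow> attained"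
  proof
    fix u assume u: "u \<in> almost_unitary"
    then have "norm u = \<one>\<^bsub>R\<^esub> \<oplus>\<^bsub>R\<^esub> (norm u \<oplus>\<^bsub>R\<^esub> \<one>\<^bsub>R\<^esub>)"
      by (simp add: almost_unitary_def R_add_ac)
    then show "norm u \<oplus>\<^bsub>R\<^esub> \<one>\<^bsub>R\<^esub> \<in> attained" using u by (auto simp: almost_unitary_def attained_def)
  qed
next
  fix t assume t: "t \<in> attained"
  then obtain u where u: "u \<in> carrier R" "aug u = \<one>" "norm u = \<one>\<^bsub>R\<^esub> \<oplus>\<^bsub>R\<^esub> t"
    by (auto simp: attained_def)
  have tR: "t \<in> carrier R" "invariant c t" using t by (auto simp: attained_def)
  obtain w where w: "w \<in> carrier R" "u \<otimes>\<^bsub>R\<^esub> w = \<one>\<^bsub>R\<^esub>" using inverse_exists[of u] u by auto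
  have uw: "w \<otimes>\<^bsub>R\<^esub> (u \<otimes>\<^bsub>R\<^esub> v) = v" "u \<otimes>\<^bsub>R\<^esub> (w \<otimes>\<^bsub>R\<^esub> v) = v" if "v \<in> carrier R" for v
    using u(1) w that by (simp_all add: R.m_assoc[symmetric] R.m_comm[of w u])
  have nw: "norm w \<otimes>\<^bsub>R\<^esub> norm u = \<one>\<^bsub>R\<^esub>"
    using u(1) w by (simp add: norm_mult[symmetric] R.m_comm[of w u] norm_one)
  have iff: "v \<in> almost_unitary \<and> norm v \<oplus>\<^bsub>R\<^esub> \<one>\<^bsub>R\<^esub> = t \<longleftrightarrow> v \<in> carrier R \<and> aug v = \<one> \<and> norm v = norm u" for v
  proof -
    have "norm v \<oplus>\<^bsub>R\<^esub> \<one>\<^bsub>R\<^esub> = t \<longleftrightarrow> norm v = \<one>\<^bsub>R\<^esub> \<oplus>\<^bsub>R\<^esub> t" if "v \<in> carrier R"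
    proof
      assume "norm v \<oplus>\<^bsub>R\<^esub> \<one>\<^bsub>R\<^esub> = t"
      then show "norm v = \<one>\<^bsub>R\<^esub> \<oplus>\<^bsub>R\<^esub> t" using that by (auto simp: R_add_ac)
    next
      assume "norm v = \<one>\<^bsub>R\<^esub> \<oplus>\<^bsub>R\<^esub> t"
      then show "norm v \<oplus>\<^bsub>R\<^esub> \<one>\<^bsub>R\<^esub> = t" using tR by (simp add: R_add_ac)
    qed
    then show ?thesis using u(3) tR by (auto simp: almost_unitary_def)
  qed
  have "bij_betw (\<lambda>v. u \<otimes>\<^bsub>R\<^esub> v) unitary {v \<in> almost_unitary. norm v \<oplus>\<^bsub>R\<^esub> \<one>\<^bsub>R\<^esub> = t}"
    unfolding iff
  proof (rule bij_betw_byWitness[where f' = "\<lambda>v. w \<otimes>\<^bsub>R\<^esub> v"])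
    show "(\<lambda>v. u \<otimes>\<^bsub>R\<^esub> v) ` unitary \<subseteq> {v. v \<in> carrier R \<and> aug v = \<one> \<and> norm v = norm u}"
      using u(1,2) by (auto simp: unitary_def aug_mult norm_mult aug_eq_one_of_norm)
    show "(\<lambda>v. w \<otimes>\<^bsub>R\<^esub> v) ` {v. v \<in> carrier R \<and> aug v = \<one> \<and> norm v = norm u} \<subseteq> unitary"
      using w(1) nw by (auto simp: unitary_def norm_mult)
  qed (use uw in \<open>auto simp: unitary_def\<close>)
  then show "card {v \<in> almost_unitary. norm v \<oplus>\<^bsub>R\<^esub> \<one>\<^bsub>R\<^esub> = t} = card unitary"
    by (simp only: bij_betw_same_card)
qed

end

section \<open>Passage to the quotient by an involution\<close>

context abelian_2_group_algebra
begin

definition "square_torsion = {y \<in> tor. \<exists>x\<in>carrier G. y = x \<otimes>\<^bsub>G\<^esub> x}"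

end

text \<open>
  The quotient enters through a surjection with fibres \<open>{x, c x}\<close>, which leaves its carrier free:
  the induction needs quotients on the same type as the group.
\<close>

locale quotient_by_involution =
  A: central_involution K A "Suc m" c + B: abelian_2_group_algebra K B m
  for K :: "('k, 'm) ring_scheme" (structure) and A :: "('g, 'n) monoid_scheme"
    and B :: "('h, 'l) monoid_scheme" and m :: nat and c :: 'g +
  fixes \<pi> :: "'g \<Rightarrow> 'h"
  assumes hom: "\<pi> \<in> hom A B" and surj: "\<pi> ` carrier A = carrier B"
    and fibres: "\<And>x y. x \<in> carrier A \<Longrightarrow> y \<in> carrier A \<Longrightarrow> \<pi> x = \<pi> y \<longleftrightarrow> y = x \<or> y = c \<otimes>\<^bsub>A\<^esub> x"
begin

sublocale \<pi>: group_hom A B \<pi>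
  by unfold_locales (rule hom)

lemma pi_c [simp]: "\<pi> c = \<one>\<^bsub>B\<^esub>"
  using fibres[of "\<one>\<^bsub>A\<^esub>" c] A.c(1) by simp

lemma fibre_eq:
  assumes x: "x \<in> carrier A"
  shows "{a \<in> carrier A. \<pi> a = \<pi> x} = {x, c \<otimes>\<^bsub>A\<^esub> x}"
proof -
  have "\<pi> a = \<pi> x \<longleftrightarrow> a = x \<or> a = c \<otimes>\<^bsub>A\<^esub> x" if "a \<in> carrier A" for a
    unfolding fibres[OF x that, symmetric] by (rule eq_commute)
  then show ?thesis using x A.c(1) by auto
qed

text \<open>
  The image of \<open>u\<close> under the map of group algebras induced by \<open>\<pi>\<close>.
\<close>

definition push where "push u = (\<lambda>\<beta>\<in>carrier B. \<Oplus>a\<in>{a \<in> carrier A. \<pi> a = \<beta>}. u a)"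

lemma push_coeff: "u \<in> carrier A.R \<Longrightarrow> x \<in> carrier A \<Longrightarrow> push u (\<pi> x) = u x \<oplus> u (c \<otimes>\<^bsub>A\<^esub> x)"
  using A.c_neq[of x] A.c(1) by (auto simp: push_def fibre_eq A.K.finsum_insert A.K.finsum_empty)

lemma push_closed [simp]: "u \<in> carrier A.R \<Longrightarrow> push u \<in> carrier B.R"
  unfolding push_def by (intro B.lambda_in_R A.K.finsum_closed) auto

lemma push_sum:
  assumes u: "u \<in> carrier A.R" and H: "\<And>\<beta>. \<beta> \<in> carrier B \<Longrightarrow> H \<beta> \<in> carrier K"
  shows "(\<Oplus>a\<in>carrier A. u a \<otimes> H (\<pi> a)) = (\<Oplus>\<beta>\<in>carrier B. push u \<beta> \<otimes> H \<beta>)"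
proof -
  have "(\<Oplus>a\<in>carrier A. u a \<otimes> H (\<pi> a)) =
      (\<Oplus>\<beta>\<in>carrier B. \<Oplus>a\<in>{a \<in> carrier A. \<pi> a = \<beta>}. u a \<otimes> H (\<pi> a))"
    using u H by (intro A.K.finsum_fibres) (auto simp: A.finite_G B.finite_G)
  also have "\<dots> = (\<Oplus>\<beta>\<in>carrier B. push u \<beta> \<otimes> H \<beta>)"
  proof (rule A.K.finsum_cong')
    fix \<beta> assume b: "\<beta> \<in> carrier B"
    have "(\<Oplus>a\<in>{a \<in> carrier A. \<pi> a = \<beta>}. u a \<otimes> H (\<pi> a)) = (\<Oplus>a\<in>{a \<in> carrier A. \<pi> a = \<beta>}. u a \<otimes> H \<beta>)"
      using u H b by (intro A.K.finsum_cong') auto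
    also have "\<dots> = (\<Oplus>a\<in>{a \<in> carrier A. \<pi> a = \<beta>}. u a) \<otimes> H \<beta>"
      using u H b by (subst A.K.finsum_ldistr) (auto simp: A.finite_G)
    finally show "(\<Oplus>a\<in>{a \<in> carrier A. \<pi> a = \<beta>}. u a \<otimes> H (\<pi> a)) = push u \<beta> \<otimes> H \<beta>"
      using b by (simp add: push_def)
  qed (use u H in auto)
  finally show ?thesis .
qed

text \<open>
  The induced map commutes with norms.
\<close>

lemma norm_push:
  assumes u: "u \<in> carrier A.R" and g: "g \<in> carrier A"
  shows "B.norm (push u) (\<pi> g) = A.norm u g \<oplus> A.norm u (c \<otimes>\<^bsub>A\<^esub> g)"
proof -
  have [simp]: "c \<in> carrier A" by (rule A.c)
  have "B.norm (push u) (\<pi> g) = (\<Oplus>\<beta>\<in>carrier B. push u \<beta> \<otimes> push u (inv\<^bsub>B\<^esub> (\<pi> g) \<otimes>\<^bsub>B\<^esub> \<beta>))"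
    using u g by (simp add: B.norm_def B.norm_coeff)
  also have "\<dots> = (\<Oplus>a\<in>carrier A. u a \<otimes> push u (inv\<^bsub>B\<^esub> (\<pi> g) \<otimes>\<^bsub>B\<^esub> \<pi> a))"
    using u g by (intro push_sum[symmetric]) auto
  also have "\<dots> = (\<Oplus>a\<in>carrier A. u a \<otimes> u (inv\<^bsub>A\<^esub> g \<otimes>\<^bsub>A\<^esub> a) \<oplus> u a \<otimes> u (inv\<^bsub>A\<^esub> (c \<otimes>\<^bsub>A\<^esub> g) \<otimes>\<^bsub>A\<^esub> a))"
  proof (rule A.K.finsum_cong')
    fix a assume a: "a \<in> carrier A"
    have "inv\<^bsub>B\<^esub> (\<pi> g) \<otimes>\<^bsub>B\<^esub> \<pi> a = \<pi> (inv\<^bsub>A\<^esub> g \<otimes>\<^bsub>A\<^esub> a)" using a g by simp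
    moreover have "inv\<^bsub>A\<^esub> (c \<otimes>\<^bsub>A\<^esub> g) \<otimes>\<^bsub>A\<^esub> a = c \<otimes>\<^bsub>A\<^esub> (inv\<^bsub>A\<^esub> g \<otimes>\<^bsub>A\<^esub> a)"
      using a g by (simp add: A.G.inv_mult A.inv_c A.G.m_assoc)
    ultimately show "u a \<otimes> push u (inv\<^bsub>B\<^esub> (\<pi> g) \<otimes>\<^bsub>B\<^esub> \<pi> a) =
        u a \<otimes> u (inv\<^bsub>A\<^esub> g \<otimes>\<^bsub>A\<^esub> a) \<oplus> u a \<otimes> u (inv\<^bsub>A\<^esub> (c \<otimes>\<^bsub>A\<^esub> g) \<otimes>\<^bsub>A\<^esub> a)"
      using u a g push_coeff[OF u, of "inv\<^bsub>A\<^esub> g \<otimes>\<^bsub>A\<^esub> a"] by (simp add: A.K.r_distr)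
  qed (use u g in auto)
  also have "\<dots> = A.norm u g \<oplus> A.norm u (c \<otimes>\<^bsub>A\<^esub> g)"
    using u g by (simp add: A.norm_def A.norm_coeff A.K.finsum_addf Pi_def)
  finally show ?thesis .
qed

lemma aug_push: "u \<in> carrier A.R \<Longrightarrow> B.aug (push u) = A.aug u"
  using push_sum[of u "\<lambda>_. \<one>"]
  by (simp add: A.aug_eq B.aug_eq Pi_def cong: A.K.finsum_cong)

lemma pi_eq_one_iff: "x \<in> carrier A \<Longrightarrow> \<pi> x = \<one>\<^bsub>B\<^esub> \<longleftrightarrow> x = \<one>\<^bsub>A\<^esub> \<or> x = c"
  using fibres[of "\<one>\<^bsub>A\<^esub>" x] A.c(1) by auto

text \<open>
  An element of the group algebra maps to \<open>1\<close> iff it differs from \<open>1\<close> by an invariant element.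
\<close>

lemma push_unitary_iff:
  assumes u: "u \<in> carrier A.R"
  shows "push u \<in> B.unitary \<longleftrightarrow> u \<in> A.almost_unitary"
proof -
  have [simp]: "c \<in> carrier A" by (rule A.c)
  have "A.invariant c (A.norm u \<oplus>\<^bsub>A.R\<^esub> \<one>\<^bsub>A.R\<^esub>) \<longleftrightarrow>
      (\<forall>x\<in>carrier A. B.norm (push u) (\<pi> x) = \<one>\<^bsub>B.R\<^esub> (\<pi> x))"
    unfolding A.invariant_def
  proof (rule ball_cong[OF refl])
    fix x assume x: "x \<in> carrier A"
    have cx: "c \<otimes>\<^bsub>A\<^esub> x = \<one>\<^bsub>A\<^esub> \<longleftrightarrow> x = c"
      using x A.c A.c_c[OF x] by auto
    have one: "\<one>\<^bsub>B.R\<^esub> (\<pi> x) = \<one>\<^bsub>A.R\<^esub> x \<oplus> \<one>\<^bsub>A.R\<^esub> (c \<otimes>\<^bsub>A\<^esub> x)"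
      using x A.c by (auto simp: A.one_coeff B.one_coeff pi_eq_one_iff cx)
    have k: "A.norm u x \<in> carrier K" "A.norm u (c \<otimes>\<^bsub>A\<^esub> x) \<in> carrier K" 
      "\<one>\<^bsub>A.R\<^esub> x \<in> carrier K" "\<one>\<^bsub>A.R\<^esub> (c \<otimes>\<^bsub>A\<^esub> x) \<in> carrier K" using u x by simp_all
    have "(A.norm u \<oplus>\<^bsub>A.R\<^esub> \<one>\<^bsub>A.R\<^esub>) (c \<otimes>\<^bsub>A\<^esub> x) = (A.norm u \<oplus>\<^bsub>A.R\<^esub> \<one>\<^bsub>A.R\<^esub>) x \<longleftrightarrow>
      (A.norm u (c \<otimes>\<^bsub>A\<^esub> x) \<oplus> \<one>\<^bsub>A.R\<^esub> (c \<otimes>\<^bsub>A\<^esub> x)) \<oplus> (A.norm u x \<oplus> \<one>\<^bsub>A.R\<^esub> x) = \<zero>"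
      using k x by (simp add: A.add_coeff A.K_eq_iff)
    also have "\<dots> \<longleftrightarrow> (A.norm u x \<oplus> A.norm u (c \<otimes>\<^bsub>A\<^esub> x)) \<oplus> (\<one>\<^bsub>A.R\<^esub> x \<oplus> \<one>\<^bsub>A.R\<^esub> (c \<otimes>\<^bsub>A\<^esub> x)) = \<zero>"
      using k by (simp only: A.K.a_ac A.K.a_closed)
    also have "\<dots> \<longleftrightarrow> B.norm (push u) (\<pi> x) = \<one>\<^bsub>B.R\<^esub> (\<pi> x)"
      unfolding norm_push[OF u x] one using k by (simp add: A.K_eq_iff)
    finally show "(A.norm u \<oplus>\<^bsub>A.R\<^esub> \<one>\<^bsub>A.R\<^esub>) (c \<otimes>\<^bsub>A\<^esub> x) = (A.norm u \<oplus>\<^bsub>A.R\<^esub> \<one>\<^bsub>A.R\<^esub>) x \<longleftrightarrow>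
      B.norm (push u) (\<pi> x) = \<one>\<^bsub>B.R\<^esub> (\<pi> x)" .
  qed
  also have "\<dots> \<longleftrightarrow> B.norm (push u) = \<one>\<^bsub>B.R\<^esub>"
  proof
    assume a: "\<forall>x\<in>carrier A. B.norm (push u) (\<pi> x) = \<one>\<^bsub>B.R\<^esub> (\<pi> x)"
    show "B.norm (push u) = \<one>\<^bsub>B.R\<^esub>"
    proof (rule B.group_algebra_eqI)
      fix \<beta> assume "\<beta> \<in> carrier B"
      then obtain x where "x \<in> carrier A" "\<beta> = \<pi> x" using surj by auto
      then show "B.norm (push u) \<beta> = \<one>\<^bsub>B.R\<^esub> \<beta>" using a by simp
    qed (use u in auto)
  qed simp
  finally show ?thesis
    using u aug_push[OF u] B.aug_eq_one_of_norm[of "push u"]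
    by (auto simp: B.unitary_def A.almost_unitary_def)
qed

definition rep where "rep \<beta> = (SOME a. a \<in> carrier A \<and> \<pi> a = \<beta>)"

lemma rep: "\<beta> \<in> carrier B \<Longrightarrow> rep \<beta> \<in> carrier A \<and> \<pi> (rep \<beta>) = \<beta>"
proof -
  assume "\<beta> \<in> carrier B"
  then have "\<exists>a. a \<in> carrier A \<and> \<pi> a = \<beta>" unfolding surj[symmetric] by auto
  then show ?thesis unfolding rep_def by (rule someI_ex)
qed

lemma rep_pi: "x \<in> carrier A \<Longrightarrow> rep (\<pi> x) = x \<or> rep (\<pi> x) = c \<otimes>\<^bsub>A\<^esub> x"
  using rep[of "\<pi> x"] fibres[of x "rep (\<pi> x)"] by auto

lemma push_surj:
  assumes w: "w \<in> carrier B.R"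
  obtains u where "u \<in> carrier A.R" "push u = w"
proof -
  define u where "u = (\<lambda>a\<in>carrier A. if rep (\<pi> a) = a then w (\<pi> a) else \<zero>)"
  have u: "u \<in> carrier A.R" unfolding u_def using w by (intro A.lambda_in_R) auto
  have "push u = w"
  proof (rule B.group_algebra_eqI)
    fix \<beta> assume "\<beta> \<in> carrier B"
    then obtain x where x: "x \<in> carrier A" "\<beta> = \<pi> x" using surj by auto
    have "u x \<oplus> u (c \<otimes>\<^bsub>A\<^esub> x) = w (\<pi> x)"
      using rep_pi[OF x(1)] x(1) A.c(1) A.c_neq[OF x(1)] w by (auto simp: u_def)
    then show "push u \<beta> = w \<beta>" unfolding x(2) using push_coeff[OF u x(1)] by simp
  qed (use u w in auto)
  then show ?thesis using u that by blast
qed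

lemma push_eq_iff:
  assumes u: "u \<in> carrier A.R" "v \<in> carrier A.R"
  shows "push u = push v \<longleftrightarrow> A.invariant c (u \<oplus>\<^bsub>A.R\<^esub> v)"
proof -
  have [simp]: "c \<in> carrier A" by (rule A.c)
  have "push u = push v \<longleftrightarrow> (\<forall>x\<in>carrier A. push u (\<pi> x) = push v (\<pi> x))"
  proof
    assume a: "\<forall>x\<in>carrier A. push u (\<pi> x) = push v (\<pi> x)"
    show "push u = push v"
    proof (rule B.group_algebra_eqI)
      fix \<beta> assume "\<beta> \<in> carrier B"
      then obtain x where "x \<in> carrier A" "\<beta> = \<pi> x" using surj by auto
      then show "push u \<beta> = push v \<beta>" using a by simp
    qed (use u in auto)
  qed simp
  also have "\<dots> \<longleftrightarrow> A.invariant c (u \<oplus>\<^bsub>A.R\<^esub> v)"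
    unfolding A.invariant_def
  proof (rule ball_cong[OF refl])
    fix x assume x: "x \<in> carrier A"
    have k: "u x \<in> carrier K" "v x \<in> carrier K" "u (c \<otimes>\<^bsub>A\<^esub> x) \<in> carrier K" "v (c \<otimes>\<^bsub>A\<^esub> x) \<in> carrier K"
      using u x by auto
    have "push u (\<pi> x) = push v (\<pi> x) \<longleftrightarrow> (u x \<oplus> u (c \<otimes>\<^bsub>A\<^esub> x)) \<oplus> (v x \<oplus> v (c \<otimes>\<^bsub>A\<^esub> x)) = \<zero>"
      using u x k by (simp add: push_coeff A.K_eq_iff)
    also have "\<dots> \<longleftrightarrow> (u (c \<otimes>\<^bsub>A\<^esub> x) \<oplus> v (c \<otimes>\<^bsub>A\<^esub> x)) \<oplus> (u x \<oplus> v x) = \<zero>"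
      using k by (simp only: A.K.a_ac A.K.a_closed)
    also have "\<dots> \<longleftrightarrow> (u \<oplus>\<^bsub>A.R\<^esub> v) (c \<otimes>\<^bsub>A\<^esub> x) = (u \<oplus>\<^bsub>A.R\<^esub> v) x"
      using x k by (simp add: A.add_coeff A.K_eq_iff)
    finally show "push u (\<pi> x) = push v (\<pi> x) \<longleftrightarrow> (u \<oplus>\<^bsub>A.R\<^esub> v) (c \<otimes>\<^bsub>A\<^esub> x) = (u \<oplus>\<^bsub>A.R\<^esub> v) x" .
  qed
  finally show ?thesis .
qed

text \<open>
  The induced map is onto, and its kernel consists of the invariant elements.
\<close>

lemma card_almost_unitary_quotient:
  "card A.almost_unitary = card B.unitary * card {u \<in> carrier A.R. A.invariant c u}"
proof (rule card_eq_card_times_fibre[where f = push])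
  show "finite A.almost_unitary" "finite B.unitary"
    using A.finite_R B.finite_R by (auto simp: A.almost_unitary_def B.unitary_def)
  show "push \<in> A.almost_unitary \<rightarrow> B.unitary"
    using push_unitary_iff by (auto simp: A.almost_unitary_def)
next
  fix w assume w: "w \<in> B.unitary"
  then obtain u where u: "u \<in> carrier A.R" "push u = w"
    by (auto simp: B.unitary_def elim: push_surj[of w])
  have fib: "{v \<in> A.almost_unitary. push v = w} = {v \<in> carrier A.R. A.invariant c (v \<oplus>\<^bsub>A.R\<^esub> u)}"
    using push_eq_iff[of _ u] u push_unitary_iff w by (auto simp: A.almost_unitary_def)
  have "bij_betw (\<lambda>v. v \<oplus>\<^bsub>A.R\<^esub> u) {u \<in> carrier A.R. A.invariant c u} {v \<in> A.almost_unitary. push v = w}"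
    unfolding fib by (rule bij_betw_byWitness[where f' = "\<lambda>v. v \<oplus>\<^bsub>A.R\<^esub> u"])
      (use u(1) in \<open>auto simp: A.R.a_assoc A.R_double\<close>)
  then show "card {v \<in> A.almost_unitary. push v = w} = card {u \<in> carrier A.R. A.invariant c u}"
    by (simp only: bij_betw_same_card)
qed

lemma tor_c: "x \<in> A.tor \<Longrightarrow> c \<otimes>\<^bsub>A\<^esub> x \<in> A.tor"
proof -
  assume x: "x \<in> A.tor"
  then have xA: "x \<in> carrier A" by auto
  have "(c \<otimes>\<^bsub>A\<^esub> x) \<otimes>\<^bsub>A\<^esub> (c \<otimes>\<^bsub>A\<^esub> x) = c \<otimes>\<^bsub>A\<^esub> (c \<otimes>\<^bsub>A\<^esub> (x \<otimes>\<^bsub>A\<^esub> x))"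
    using xA A.c(1) by (simp only: A.G.m_ac A.G.m_closed)
  then show ?thesis using x A.c by (simp add: A.c_c)
qed

lemma card_eq_twice_image:
  assumes "S \<subseteq> carrier A" "\<And>x. x \<in> S \<Longrightarrow> c \<otimes>\<^bsub>A\<^esub> x \<in> S"
  shows "card S = card (\<pi> ` S) * 2"
proof (rule card_eq_card_times_fibre[where f = \<pi>])
  show "finite S" "finite (\<pi> ` S)" using assms(1) A.finite_G finite_subset by auto
  fix y assume "y \<in> \<pi> ` S"
  then obtain x where x: "x \<in> S" "y = \<pi> x" by auto
  then have "x \<in> carrier A" using assms by auto
  then have "{a \<in> S. \<pi> a = y} = {x, c \<otimes>\<^bsub>A\<^esub> x}" using fibre_eq[of x] x assms by auto
  then show "card {a \<in> S. \<pi> a = y} = 2" using A.c_neq[of x] \<open>x \<in> carrier A\<close> by auto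
qed auto

text \<open>
  A target is a function on the quotient that is invariant under inversion and free outside the
  image of the \<open>2\<close>-torsion.
\<close>

lemma card_norm_targets:
  "\<exists>n. 2 * n + card A.tor = card (carrier B) + card B.tor \<and> card A.norm_targets = card (carrier K) ^ n"
proof -
  define Y where "Y = carrier B - \<pi> ` A.tor"
  have sub: "\<pi> ` A.tor \<subseteq> B.tor" by (auto simp: \<pi>.hom_mult[symmetric] simp del: \<pi>.hom_mult)
  have piY: "\<pi> a \<in> Y \<longleftrightarrow> a \<notin> A.tor" if "a \<in> carrier A" for a
  proof
    assume "\<pi> a \<in> Y" then show "a \<notin> A.tor" by (auto simp: Y_def)
  next
    assume a: "a \<notin> A.tor"
    have False if x: "x \<in> A.tor" "\<pi> a = \<pi> x" for x
      using fibres[of x a] x \<open>a \<in> carrier A\<close> tor_c[OF x(1)] a by auto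
    then show "\<pi> a \<in> Y" using that by (auto simp: Y_def)
  qed
  have invY: "inv\<^bsub>B\<^esub> \<beta> \<in> Y" if b: "\<beta> \<in> Y" for \<beta>
  proof -
    obtain a where a: "a \<in> carrier A" "\<beta> = \<pi> a" using b surj by (auto simp: Y_def)
    have "inv\<^bsub>A\<^esub> a \<notin> A.tor" using piY[of a] b a by (auto simp: A.G.inv_mult[symmetric])
    then show ?thesis using piY[of "inv\<^bsub>A\<^esub> a"] a by simp
  qed
  obtain n where n: "2 * n = card Y + card {\<beta> \<in> Y. inv\<^bsub>B\<^esub> \<beta> = \<beta>}"
    "card {f \<in> Y \<rightarrow>\<^sub>E carrier K. \<forall>\<beta>\<in>Y. f (inv\<^bsub>B\<^esub> \<beta>) = f \<beta>} = card (carrier K) ^ n"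
    using card_invariant_functions[of Y "\<lambda>\<beta>. inv\<^bsub>B\<^esub> \<beta>" "carrier K"] invY B.finite_G
    by (auto simp: Y_def)
  have "{\<beta> \<in> Y. inv\<^bsub>B\<^esub> \<beta> = \<beta>} = B.tor - \<pi> ` A.tor"
    using B.inv_eq_self_iff by (auto simp: Y_def)
  moreover have "finite (\<pi> ` A.tor)" "finite B.tor" using A.finite_G B.finite_G by auto
  moreover have "\<pi> ` A.tor \<subseteq> carrier B" by auto
  ultimately have "card Y + card (\<pi> ` A.tor) = card (carrier B)"
    "card {\<beta> \<in> Y. inv\<^bsub>B\<^esub> \<beta> = \<beta>} + card (\<pi> ` A.tor) = card B.tor"
    using sub B.finite_G card_mono[of "carrier B" "\<pi> ` A.tor"] card_mono[of B.tor "\<pi> ` A.tor"]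
    by (simp_all add: Y_def card_Diff_subset)
  moreover have "card A.tor = card (\<pi> ` A.tor) * 2"
    by (rule card_eq_twice_image) (use tor_c in auto)
  ultimately have "2 * n + card A.tor = card (carrier B) + card B.tor" using n(1) by simp
  moreover have "bij_betw (\<lambda>t. \<lambda>\<beta>\<in>Y. t (rep \<beta>)) A.norm_targets {f \<in> Y \<rightarrow>\<^sub>E carrier K. \<forall>\<beta>\<in>Y. f (inv\<^bsub>B\<^esub> \<beta>) = f \<beta>}"
  proof (rule bij_betw_byWitness[where f' = "\<lambda>f. \<lambda>a\<in>carrier A. if \<pi> a \<in> Y then f (\<pi> a) else \<zero>"])
    have tsec: "t (rep (\<pi> a)) = t a" if "t \<in> A.norm_targets" "a \<in> carrier A" for t a
      using rep_pi[OF that(2)] that by (auto simp: A.norm_targets_def A.invariant_def)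
    show "\<forall>t\<in>A.norm_targets. (\<lambda>a\<in>carrier A. if \<pi> a \<in> Y then (\<lambda>\<beta>\<in>Y. t (rep \<beta>)) (\<pi> a) else \<zero>) = t"
    proof
      fix t assume t: "t \<in> A.norm_targets"
      have tR: "t \<in> carrier A.R" using t by (rule A.norm_targets_closed)
      show "(\<lambda>a\<in>carrier A. if \<pi> a \<in> Y then (\<lambda>\<beta>\<in>Y. t (rep \<beta>)) (\<pi> a) else \<zero>) = t"
      proof (rule A.group_algebra_eqI)
        show "(\<lambda>a\<in>carrier A. if \<pi> a \<in> Y then (\<lambda>\<beta>\<in>Y. t (rep \<beta>)) (\<pi> a) else \<zero>) \<in> carrier A.R"
          using tsec[OF t] tR by (intro A.lambda_in_R) auto
        fix a assume a: "a \<in> carrier A"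
        then show "(\<lambda>a\<in>carrier A. if \<pi> a \<in> Y then (\<lambda>\<beta>\<in>Y. t (rep \<beta>)) (\<pi> a) else \<zero>) a = t a"
          using t tsec[OF t a] piY[OF a] by (auto simp: A.norm_targets_def)
      qed (rule tR)
    qed
    show "\<forall>f\<in>{f \<in> Y \<rightarrow>\<^sub>E carrier K. \<forall>\<beta>\<in>Y. f (inv\<^bsub>B\<^esub> \<beta>) = f \<beta>}.
        (\<lambda>\<beta>\<in>Y. (\<lambda>a\<in>carrier A. if \<pi> a \<in> Y then f (\<pi> a) else \<zero>) (rep \<beta>)) = f"
    proof
      fix f assume "f \<in> {f \<in> Y \<rightarrow>\<^sub>E carrier K. \<forall>\<beta>\<in>Y. f (inv\<^bsub>B\<^esub> \<beta>) = f \<beta>}"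
      then have f: "f \<in> Y \<rightarrow>\<^sub>E carrier K" by blast
      show "(\<lambda>\<beta>\<in>Y. (\<lambda>a\<in>carrier A. if \<pi> a \<in> Y then f (\<pi> a) else \<zero>) (rep \<beta>)) = f"
      proof
        fix \<beta>
        show "(\<lambda>\<beta>\<in>Y. (\<lambda>a\<in>carrier A. if \<pi> a \<in> Y then f (\<pi> a) else \<zero>) (rep \<beta>)) \<beta> = f \<beta>"
        proof (cases "\<beta> \<in> Y")
          case True
          then show ?thesis using rep[of \<beta>] by (simp add: Y_def)
        next
          case False
          then show ?thesis using PiE_arb[OF f False] by simp
        qed
      qed
    qed
    show "(\<lambda>t. \<lambda>\<beta>\<in>Y. t (rep \<beta>)) ` A.norm_targets \<subseteq> {f \<in> Y \<rightarrow>\<^sub>E carrier K. \<forall>\<beta>\<in>Y. f (inv\<^bsub>B\<^esub> \<beta>) = f \<beta>}"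
    proof (intro image_subsetI CollectI conjI ballI)
      fix t assume t: "t \<in> A.norm_targets"
      have sA: "rep \<beta> \<in> carrier A" if "\<beta> \<in> Y" for \<beta> using rep that by (auto simp: Y_def)
      show "(\<lambda>\<beta>\<in>Y. t (rep \<beta>)) \<in> Y \<rightarrow>\<^sub>E carrier K" using A.norm_targets_closed[OF t] sA by auto
      fix \<beta> assume b: "\<beta> \<in> Y"
      then obtain a where a: "a \<in> carrier A" "\<beta> = \<pi> a" using surj by (auto simp: Y_def)
      have "t (rep (inv\<^bsub>B\<^esub> \<beta>)) = t (inv\<^bsub>A\<^esub> a)" using tsec[OF t, of "inv\<^bsub>A\<^esub> a"] a by simp
      also have "\<dots> = t a" using t a by (simp add: A.norm_targets_def A.Sym_def A.symmetric_coeff)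
      finally show "(\<lambda>\<beta>\<in>Y. t (rep \<beta>)) (inv\<^bsub>B\<^esub> \<beta>) = (\<lambda>\<beta>\<in>Y. t (rep \<beta>)) \<beta>"
        using b invY[OF b] tsec[OF t a(1)] a(2) by simp
    qed
    show "(\<lambda>f. \<lambda>a\<in>carrier A. if \<pi> a \<in> Y then f (\<pi> a) else \<zero>) `
        {f \<in> Y \<rightarrow>\<^sub>E carrier K. \<forall>\<beta>\<in>Y. f (inv\<^bsub>B\<^esub> \<beta>) = f \<beta>} \<subseteq> A.norm_targets"
    proof (rule image_subsetI)
      fix f assume "f \<in> {f \<in> Y \<rightarrow>\<^sub>E carrier K. \<forall>\<beta>\<in>Y. f (inv\<^bsub>B\<^esub> \<beta>) = f \<beta>}"
      then have f: "f \<in> Y \<rightarrow>\<^sub>E carrier K" "\<And>\<beta>. \<beta> \<in> Y \<Longrightarrow> f (inv\<^bsub>B\<^esub> \<beta>) = f \<beta>" by auto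
      let ?t = "\<lambda>a\<in>carrier A. if \<pi> a \<in> Y then f (\<pi> a) else \<zero>"
      have tR: "?t \<in> carrier A.R" using f(1) by (intro A.lambda_in_R) auto
      have "inv\<^bsub>B\<^esub> \<beta> \<in> Y \<longleftrightarrow> \<beta> \<in> Y" if "\<beta> \<in> carrier B" for \<beta>
        using invY[of \<beta>] invY[of "inv\<^bsub>B\<^esub> \<beta>"] that by auto
      then have "A.star ?t = ?t"
        using f tR by (intro A.group_algebra_eqI) (auto simp: A.star_coeff)
      moreover have "A.invariant c ?t" using A.c(1) by (auto simp: A.invariant_def)
      moreover have "?t x = \<zero>" if "x \<in> A.tor" for x using piY[of x] that by auto
      ultimately show "?t \<in> A.norm_targets" using tR by (simp add: A.norm_targets_def A.Sym_def)
    qed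
  qed
  ultimately show ?thesis using n(2) bij_betw_same_card by fastforce
qed

text \<open>
  A square of the quotient is torsion iff its preimages \<open>y\<close>, again squares since \<open>c\<close> is one, satisfy
  \<open>y\<^sup>2 = 1\<close> or \<open>y\<^sup>2 = c\<close>.
\<close>

lemma card_square_torsion:
  assumes g: "g \<in> carrier A" "g \<otimes>\<^bsub>A\<^esub> g = c"
  defines "Q \<equiv> {y \<in> carrier A. (\<exists>x\<in>carrier A. y = x \<otimes>\<^bsub>A\<^esub> x) \<and> y \<otimes>\<^bsub>A\<^esub> y = c}"
  shows "card A.square_torsion + card Q = 2 * card B.square_torsion"
proof -
  let ?S = "A.square_torsion \<union> Q"
  have S: "?S = {y \<in> carrier A. (\<exists>x\<in>carrier A. y = x \<otimes>\<^bsub>A\<^esub> x) \<and> \<pi> (y \<otimes>\<^bsub>A\<^esub> y) = \<one>\<^bsub>B\<^esub>}"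
    using pi_eq_one_iff by (auto simp: A.square_torsion_def Q_def simp del: \<pi>.hom_mult)
  have "card ?S = card (\<pi> ` ?S) * 2"
  proof (rule card_eq_twice_image)
    fix y assume "y \<in> ?S"
    then obtain x where y: "y = x \<otimes>\<^bsub>A\<^esub> x" "x \<in> carrier A" "\<pi> (y \<otimes>\<^bsub>A\<^esub> y) = \<one>\<^bsub>B\<^esub>" unfolding S by auto
    have "c \<otimes>\<^bsub>A\<^esub> y = (g \<otimes>\<^bsub>A\<^esub> x) \<otimes>\<^bsub>A\<^esub> (g \<otimes>\<^bsub>A\<^esub> x)"
      unfolding y(1) g(2)[symmetric] using g(1) y(2) by (simp only: A.G.m_ac A.G.m_closed)
    moreover have "\<pi> ((c \<otimes>\<^bsub>A\<^esub> y) \<otimes>\<^bsub>A\<^esub> (c \<otimes>\<^bsub>A\<^esub> y)) = \<one>\<^bsub>B\<^esub>"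
      using y A.c(1) by simp
    ultimately show "c \<otimes>\<^bsub>A\<^esub> y \<in> ?S"
      unfolding S using y g(1) A.c(1) by (auto simp del: \<pi>.hom_mult)
  qed (auto simp: S)
  moreover have "\<pi> ` ?S = B.square_torsion"
  proof
    show "\<pi> ` ?S \<subseteq> B.square_torsion" unfolding S B.square_torsion_def by auto
    show "B.square_torsion \<subseteq> \<pi> ` ?S"
    proof
      fix \<beta> assume "\<beta> \<in> B.square_torsion"
      then obtain \<xi> where b: "\<xi> \<in> carrier B" "\<beta> = \<xi> \<otimes>\<^bsub>B\<^esub> \<xi>" "\<beta> \<otimes>\<^bsub>B\<^esub> \<beta> = \<one>\<^bsub>B\<^esub>"
        by (auto simp: B.square_torsion_def)
      then obtain x where x: "x \<in> carrier A" "\<xi> = \<pi> x" using surj by auto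
      have "x \<otimes>\<^bsub>A\<^esub> x \<in> ?S" unfolding S using x b by auto
      moreover have "\<beta> = \<pi> (x \<otimes>\<^bsub>A\<^esub> x)" using x b by simp
      ultimately show "\<beta> \<in> \<pi> ` ?S" by blast
    qed
  qed
  moreover have "A.square_torsion \<inter> Q = {}" using A.c(3) by (auto simp: A.square_torsion_def Q_def)
  moreover have "finite A.square_torsion" "finite Q"
    using A.finite_G by (auto simp: A.square_torsion_def Q_def)
  ultimately show ?thesis by (simp add: card_Un_disjoint)
qed

text \<open>
  If \<open>c = k\<^sup>4\<close>, multiplication by \<open>k\<^sup>2\<close> exchanges the squares \<open>y\<close> with \<open>y\<^sup>2 = 1\<close> and those with
  \<open>y\<^sup>2 = c\<close>, so the torsion of the squares does not change in number, and all targets are attained.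
  Otherwise the latter do not exist and both counts change by a factor of two.
\<close>

lemma card_norm_targets_square_torsion:
  assumes g: "g \<in> carrier A" "g \<otimes>\<^bsub>A\<^esub> g = c"
  shows "card A.norm_targets * card B.square_torsion = card A.square_torsion * card A.attained"
proof -
  let ?Q = "{y \<in> carrier A. (\<exists>x\<in>carrier A. y = x \<otimes>\<^bsub>A\<^esub> x) \<and> y \<otimes>\<^bsub>A\<^esub> y = c}"
  note st = card_square_torsion[OF g]
  show ?thesis
  proof (cases "\<exists>k\<in>carrier A. (k \<otimes>\<^bsub>A\<^esub> k) \<otimes>\<^bsub>A\<^esub> (k \<otimes>\<^bsub>A\<^esub> k) = c")
    case True
    then obtain k where k: "k \<in> carrier A" "(k \<otimes>\<^bsub>A\<^esub> k) \<otimes>\<^bsub>A\<^esub> (k \<otimes>\<^bsub>A\<^esub> k) = c" by auto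
    let ?h = "k \<otimes>\<^bsub>A\<^esub> k"
    have sq: "(?h \<otimes>\<^bsub>A\<^esub> y) \<otimes>\<^bsub>A\<^esub> (?h \<otimes>\<^bsub>A\<^esub> y) = c \<otimes>\<^bsub>A\<^esub> (y \<otimes>\<^bsub>A\<^esub> y)" if "y \<in> carrier A" for y
      unfolding k(2)[symmetric] using k(1) that by (simp only: A.G.m_ac A.G.m_closed)
    have sq': "?h \<otimes>\<^bsub>A\<^esub> (x \<otimes>\<^bsub>A\<^esub> x) = (k \<otimes>\<^bsub>A\<^esub> x) \<otimes>\<^bsub>A\<^esub> (k \<otimes>\<^bsub>A\<^esub> x)" if "x \<in> carrier A" for x
      using k(1) that by (simp only: A.G.m_ac A.G.m_closed)
    have hh: "?h \<otimes>\<^bsub>A\<^esub> (?h \<otimes>\<^bsub>A\<^esub> y) = c \<otimes>\<^bsub>A\<^esub> y" if "y \<in> carrier A" for y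
      using k that by (simp add: A.G.m_assoc[symmetric])
    have inj: "inj_on (\<lambda>y. ?h \<otimes>\<^bsub>A\<^esub> y) (carrier A)" using k(1) by (auto simp: inj_on_def)
    have 1: "(\<lambda>y. ?h \<otimes>\<^bsub>A\<^esub> y) ` A.square_torsion \<subseteq> ?Q"
    proof (rule image_subsetI)
      fix y assume "y \<in> A.square_torsion"
      then obtain x where "x \<in> carrier A" "y = x \<otimes>\<^bsub>A\<^esub> x" "y \<in> carrier A" "y \<otimes>\<^bsub>A\<^esub> y = \<one>\<^bsub>A\<^esub>"
        by (auto simp: A.square_torsion_def)
      then show "?h \<otimes>\<^bsub>A\<^esub> y \<in> ?Q" using sq[of y] sq'[of x] k(1) A.c by auto
    qed
    have 2: "(\<lambda>y. ?h \<otimes>\<^bsub>A\<^esub> y) ` ?Q \<subseteq> A.square_torsion"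
    proof (rule image_subsetI)
      fix y assume "y \<in> ?Q"
      then obtain x where "x \<in> carrier A" "y = x \<otimes>\<^bsub>A\<^esub> x" "y \<in> carrier A" "y \<otimes>\<^bsub>A\<^esub> y = c" by auto
      then show "?h \<otimes>\<^bsub>A\<^esub> y \<in> A.square_torsion"
        using sq[of y] sq'[of x] k(1) A.c by (auto simp: A.square_torsion_def)
    qed
    have "finite A.square_torsion" "finite ?Q" "A.square_torsion \<subseteq> carrier A" "?Q \<subseteq> carrier A"
      using A.finite_G by (auto simp: A.square_torsion_def)
    then have "card A.square_torsion = card ?Q"
      using 1 2 inj by (intro antisym card_inj_on_le[of "\<lambda>y. ?h \<otimes>\<^bsub>A\<^esub> y"]) (auto intro: inj_on_subset)
    then show ?thesis using st A.attained_eq_norm_targets[OF k] by simp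
  next
    case False
    then have Q: "?Q = {}" by auto
    have "card A.square_torsion = 2 * card B.square_torsion" using st unfolding Q by simp
    moreover have "card A.norm_targets = 2 * card A.attained" by (rule A.card_norm_targets_eq_double[OF g]) (use False in auto)
    ultimately show ?thesis by simp
  qed
qed

lemma card_unitary_step:
  assumes g: "g \<in> carrier A" "g \<otimes>\<^bsub>A\<^esub> g = c"
    and B: "2 * (e + 1) = card (carrier B) + card B.tor"
      "card B.unitary = card B.square_torsion * card (carrier K) ^ e"
  shows "\<exists>e. 2 * (e + 1) = card (carrier A) + card A.tor \<and>
    card A.unitary = card A.square_torsion * card (carrier K) ^ e"
proof -
  let ?q = "card (carrier K)"
  obtain i where i: "2 * i = card (carrier A)" "card {u \<in> carrier A.R. A.invariant c u} = ?q ^ i"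
    using A.card_invariant by auto
  obtain n where n: "2 * n + card A.tor = card (carrier B) + card B.tor" "card A.norm_targets = ?q ^ n"
    using card_norm_targets by auto
  have q: "?q > 0" using A.finite_K A.K.zero_closed by (auto simp: card_gt_0_iff)
  have T: "card A.attained > 0"
    using A.zero_in_attained A.attained_closed A.finite_R by (auto simp: card_gt_0_iff intro: finite_subset)
  have "card A.tor \<ge> 1"
    using A.finite_G by (simp add: Suc_le_eq card_gt_0_iff) (use A.G.one_closed A.G.l_one in blast)
  moreover have "card (carrier A) \<ge> 1" by (simp add: A.card_G)
  ultimately have le: "n \<le> e + i" "2 * (e + i - n + 1) = card (carrier A) + card A.tor"
    using B(1) n(1) i(1) by auto
  have "card A.attained * (?q ^ n * card A.unitary) = ?q ^ n * (card B.unitary * ?q ^ i)"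
    using A.card_almost_unitary card_almost_unitary_quotient i(2) by simp
  also have "\<dots> = (card A.norm_targets * card B.square_torsion) * ?q ^ (e + i)"
    using B(2) n(2) by (simp add: power_add)
  also have "\<dots> = card A.attained * (card A.square_torsion * ?q ^ (e + i))"
    unfolding card_norm_targets_square_torsion[OF g] by simp
  finally have "?q ^ n * card A.unitary = card A.square_torsion * ?q ^ (e + i)" using T by simp
  also have "\<dots> = ?q ^ n * (card A.square_torsion * ?q ^ (e + i - n))"
    using le(1) by (simp add: power_add[symmetric] mult.left_commute)
  finally have "card A.unitary = card A.square_torsion * ?q ^ (e + i - n)" using q by simp
  then show ?thesis using le(2) by blast
qed

end

section \<open>The order of the unitary subgroup for an abelian 2-group\<close>

context abelian_2_group_algebra
begin

text \<open>
  In a group of exponent two every element is symmetric, and its norm is the square of its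
  augmentation.
\<close>

lemma card_unitary_elementary:
  assumes el: "\<And>x. x \<in> carrier G \<Longrightarrow> x \<otimes>\<^bsub>G\<^esub> x = \<one>\<^bsub>G\<^esub>"
  shows "\<exists>e. 2 * (e + 1) = card (carrier G) + card tor \<and>
    card unitary = card square_torsion * card (carrier K) ^ e"
proof -
  have q: "card (carrier K) > 0" using finite_K K.zero_closed by (auto simp: card_gt_0_iff)
  have tor: "tor = carrier G" using el by auto
  have "square_torsion = {\<one>\<^bsub>G\<^esub>}" using el by (auto simp: square_torsion_def intro!: bexI[of _ "\<one>\<^bsub>G\<^esub>"])
  moreover have "unitary = {w \<in> carrier R. aug w = \<one>}"
  proof -
    have "norm u = \<one>\<^bsub>R\<^esub>" if u: "u \<in> carrier R" "aug u = \<one>" for u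
      by (rule group_algebra_eqI) (use u norm_torsion[OF u] tor in auto)
    then show ?thesis using aug_eq_one_of_norm by (auto simp: unitary_def)
  qed
  moreover obtain k where k: "card (carrier G) = Suc k"
    using card_G by (metis not0_implies_Suc power_not_zero zero_neq_numeral)
  then have "card {w \<in> carrier R. aug w = \<one>} = card (carrier K) ^ k"
    using card_aug_one q by simp
  ultimately show ?thesis by (intro exI[of _ k]) (simp add: tor k)
qed

text \<open>
  Among the iterated squares of \<open>x\<close>, stop two steps before the identity is reached.
\<close>

lemma exists_square_of_order_two:
  assumes x: "x \<in> carrier G" "x \<otimes>\<^bsub>G\<^esub> x \<noteq> \<one>\<^bsub>G\<^esub>"
  obtains g where "g \<in> carrier G" "g \<otimes>\<^bsub>G\<^esub> g \<noteq> \<one>\<^bsub>G\<^esub>"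
    "(g \<otimes>\<^bsub>G\<^esub> g) \<otimes>\<^bsub>G\<^esub> (g \<otimes>\<^bsub>G\<^esub> g) = \<one>\<^bsub>G\<^esub>"
proof -
  define y where "y j = x [^]\<^bsub>G\<^esub> ((2::nat) ^ j)" for j
  have y: "y j \<in> carrier G" for j using x by (simp add: y_def)
  have ys: "y (Suc j) = y j \<otimes>\<^bsub>G\<^esub> y j" for j
    using x by (simp add: y_def G.nat_pow_mult mult_2)
  have "y m = \<one>\<^bsub>G\<^esub>" using G.pow_order_eq_1[OF x(1)] card_G by (simp add: y_def order_def)
  moreover define j where "j = (LEAST j. y j = \<one>\<^bsub>G\<^esub>)"
  ultimately have j: "y j = \<one>\<^bsub>G\<^esub>"
    unfolding j_def by (intro LeastI)
  have least: "y i \<noteq> \<one>\<^bsub>G\<^esub>" if "i < j" for i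
    using not_less_Least that unfolding j_def by blast
  have "y 0 = x" using x by (simp add: y_def)
  then have "y 0 \<noteq> \<one>\<^bsub>G\<^esub>" "y (Suc 0) \<noteq> \<one>\<^bsub>G\<^esub>" using x ys[of 0] by auto
  then have "j \<noteq> 0" "j \<noteq> Suc 0" using j by metis+
  then obtain i where i: "j = Suc (Suc i)" by (metis not0_implies_Suc)
  show ?thesis
  proof (rule that[of "y i"])
    show "y i \<otimes>\<^bsub>G\<^esub> y i \<noteq> \<one>\<^bsub>G\<^esub>" using least[of "Suc i"] i ys[of i] by simp
    show "(y i \<otimes>\<^bsub>G\<^esub> y i) \<otimes>\<^bsub>G\<^esub> (y i \<otimes>\<^bsub>G\<^esub> y i) = \<one>\<^bsub>G\<^esub>"
      using j i ys[of "Suc i"] ys[of i] by simp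
  qed (rule y)
qed

end

text \<open>
  Realizing the quotient on a set of representatives keeps the type of the elements, which the
  induction below cannot change.
\<close>

lemma exists_quotient_by_involution:
  fixes A :: "('g, 'n) monoid_scheme"
  assumes "central_involution K A (Suc m) c"
  shows "\<exists>(B :: 'g monoid) \<pi>. quotient_by_involution K A B m c \<pi>"
proof -
  interpret A: central_involution K A "Suc m" c by (rule assms)
  have [simp]: "c \<in> carrier A" by (rule A.c)
  obtain r where r: "\<And>x. x \<in> carrier A \<Longrightarrow> r x = x \<or> r x = c \<otimes>\<^bsub>A\<^esub> x"
      "\<And>x. x \<in> carrier A \<Longrightarrow> r (c \<otimes>\<^bsub>A\<^esub> x) = r x"
    using involution_representatives[of "carrier A" "\<lambda>x. c \<otimes>\<^bsub>A\<^esub> x"] A.c_c by auto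
  have rA [simp]: "r x \<in> carrier A" if "x \<in> carrier A" for x using r(1)[OF that] that by auto
  have r_mult: "r (r x \<otimes>\<^bsub>A\<^esub> y) = r (x \<otimes>\<^bsub>A\<^esub> y)" if "x \<in> carrier A" "y \<in> carrier A" for x y
    using r(1)[OF that(1)] r(2)[of "x \<otimes>\<^bsub>A\<^esub> y"] that by (auto simp: A.G.m_assoc)
  have r_mult': "r (x \<otimes>\<^bsub>A\<^esub> r y) = r (x \<otimes>\<^bsub>A\<^esub> y)" if "x \<in> carrier A" "y \<in> carrier A" for x y
    using r_mult[OF that(2,1)] that by (simp add: A.G.m_comm)
  have rr [simp]: "r (r x) = r x" if "x \<in> carrier A" for x
    using r_mult[OF that A.G.one_closed] that by simp
  have fibres: "r x = r y \<longleftrightarrow> y = x \<or> y = c \<otimes>\<^bsub>A\<^esub> x" if xy: "x \<in> carrier A" "y \<in> carrier A" for x y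
  proof
    assume e: "r x = r y"
    consider "r x = x" "r y = y" | "r x = x" "r y = c \<otimes>\<^bsub>A\<^esub> y" | "r x = c \<otimes>\<^bsub>A\<^esub> x" "r y = y"
      | "r x = c \<otimes>\<^bsub>A\<^esub> x" "r y = c \<otimes>\<^bsub>A\<^esub> y" using r(1) xy by blast
    then show "y = x \<or> y = c \<otimes>\<^bsub>A\<^esub> x"
      using e xy A.c_c[of y] by cases auto
  qed (use r(2) xy in auto)
  let ?B = "\<lparr>carrier = r ` carrier A, monoid.mult = (\<lambda>x y. r (x \<otimes>\<^bsub>A\<^esub> y)), one = r \<one>\<^bsub>A\<^esub>\<rparr> :: 'g monoid"
  have comm: "comm_group ?B"
  proof (rule comm_groupI)
    fix x assume "x \<in> carrier ?B"
    then obtain a where a: "a \<in> carrier A" "x = r a" by auto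
    have "r (inv\<^bsub>A\<^esub> a) \<otimes>\<^bsub>?B\<^esub> x = \<one>\<^bsub>?B\<^esub>" using a by (simp add: r_mult r_mult')
    then show "\<exists>y\<in>carrier ?B. y \<otimes>\<^bsub>?B\<^esub> x = \<one>\<^bsub>?B\<^esub>" using a by (intro bexI) auto
  next
    fix x y z assume "x \<in> carrier ?B" "y \<in> carrier ?B" "z \<in> carrier ?B"
    then show "x \<otimes>\<^bsub>?B\<^esub> y \<otimes>\<^bsub>?B\<^esub> z = x \<otimes>\<^bsub>?B\<^esub> (y \<otimes>\<^bsub>?B\<^esub> z)"
      by (auto simp: r_mult r_mult' A.G.m_assoc)
  qed (auto simp: r_mult r_mult' A.G.m_comm)
  have card: "card (carrier A) = card (carrier ?B) * 2"
  proof (rule card_eq_card_times_fibre[where f = r])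
    fix y assume "y \<in> carrier ?B"
    then obtain x where x: "x \<in> carrier A" "y = r x" by auto
    then have "{a \<in> carrier A. r a = y} = {x, c \<otimes>\<^bsub>A\<^esub> x}" using fibres[OF x(1)] by (auto simp: eq_commute[of "r x"] r(2))
    then show "card {a \<in> carrier A. r a = y} = 2" using A.c_neq[OF x(1)] by auto
  qed (auto simp: A.finite_G)
  interpret B: comm_group ?B by (rule comm)
  have fin: "finite (carrier ?B)" using A.finite_G by simp
  have cB: "card (carrier ?B) = 2 ^ m" using card A.card_G by simp
  interpret B': abelian_2_group_algebra K ?B m
    by unfold_locales (rule fin A.finite_K A.one_one cB)+
  have "quotient_by_involution K A ?B m c r"
  proof unfold_locales
    show "r \<in> hom A ?B" by (auto simp: hom_def r_mult r_mult')
    show "r ` carrier A = carrier ?B" by simp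
    show "\<And>x y. x \<in> carrier A \<Longrightarrow> y \<in> carrier A \<Longrightarrow> (r x = r y) = (y = x \<or> y = c \<otimes>\<^bsub>A\<^esub> x)"
      by (rule fibres)
  qed
  then show ?thesis by blast
qed

theorem card_unitary_abelian:
  fixes K :: "('k, 'm) ring_scheme" and A :: "'g monoid"
  assumes "abelian_2_group_algebra K A m"
  shows "\<exists>e. 2 * (e + 1) = card (carrier A) + card {x \<in> carrier A. x \<otimes>\<^bsub>A\<^esub> x = \<one>\<^bsub>A\<^esub>} \<and>
    card (abelian_2_group_algebra.unitary K A) =
      card (abelian_2_group_algebra.square_torsion A) * card (carrier K) ^ e"
  using assms
proof (induction m arbitrary: A)
  case 0
  then interpret A: abelian_2_group_algebra K A 0 .
  show ?case
  proof (rule A.card_unitary_elementary)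
    fix x assume "x \<in> carrier A"
    then show "x \<otimes>\<^bsub>A\<^esub> x = \<one>\<^bsub>A\<^esub>"
      using A.card_G by (auto simp: card_1_singleton_iff) (metis A.G.m_closed A.G.one_closed singletonD)
  qed
next
  case (Suc m)
  then interpret A: abelian_2_group_algebra K A "Suc m" by simp
  show ?case
  proof (cases "\<forall>x\<in>carrier A. x \<otimes>\<^bsub>A\<^esub> x = \<one>\<^bsub>A\<^esub>")
    case True
    then show ?thesis by (intro A.card_unitary_elementary) auto
  next
    case False
    then obtain g where g: "g \<in> carrier A" "g \<otimes>\<^bsub>A\<^esub> g \<noteq> \<one>\<^bsub>A\<^esub>"
      "(g \<otimes>\<^bsub>A\<^esub> g) \<otimes>\<^bsub>A\<^esub> (g \<otimes>\<^bsub>A\<^esub> g) = \<one>\<^bsub>A\<^esub>"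
      using A.exists_square_of_order_two by metis
    have "central_involution K A (Suc m) (g \<otimes>\<^bsub>A\<^esub> g)"
      by unfold_locales (use g in auto)
    from exists_quotient_by_involution[OF this]
    obtain B :: "'g monoid" and \<pi> where "quotient_by_involution K A B m (g \<otimes>\<^bsub>A\<^esub> g) \<pi>"
      by blast
    then interpret Q: quotient_by_involution K A B m "g \<otimes>\<^bsub>A\<^esub> g" \<pi> .
    show ?thesis
      using Suc.IH[OF Q.B.abelian_2_group_algebra_axioms] Q.card_unitary_step[OF g(1) refl] by blast
  qed
qed

section \<open>Extensions by an inverting element\<close>

context char2_group_algebra
begin

text \<open>
  Left multiplication by \<open>v\<close> is injective on the finite ring, hence onto.
\<close>

lemma left_inverse_of_right_inverse:
  assumes uv: "u \<in> carrier R" "v \<in> carrier R" "u \<otimes>\<^bsub>R\<^esub> v = \<one>\<^bsub>R\<^esub>"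
  shows "v \<otimes>\<^bsub>R\<^esub> u = \<one>\<^bsub>R\<^esub>"
proof -
  have cancel: "u \<otimes>\<^bsub>R\<^esub> (v \<otimes>\<^bsub>R\<^esub> x) = x" if "x \<in> carrier R" for x
    using uv that by (simp add: R.m_assoc[symmetric])
  have "(\<lambda>x. v \<otimes>\<^bsub>R\<^esub> x) ` carrier R = carrier R"
  proof (rule endo_inj_surj[OF finite_R])
    show "inj_on (\<lambda>x. v \<otimes>\<^bsub>R\<^esub> x) (carrier R)"
      by (rule inj_on_inverseI[where g = "\<lambda>x. u \<otimes>\<^bsub>R\<^esub> x"]) (rule cancel)
  qed (use uv in auto)
  then obtain x where x: "x \<in> carrier R" "v \<otimes>\<^bsub>R\<^esub> x = \<one>\<^bsub>R\<^esub>" using R.one_closed by (metis imageE)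
  then have "x = u" using cancel[OF x(1)] uv by simp
  then show ?thesis using x by simp
qed

text \<open>
  The condition \<open>v v\<^sup>* = 1\<close> already forces \<open>v\<close> to be a unit, and its augmentation to be a square root
  of \<open>1\<close>, hence \<open>1\<close>.
\<close>

lemma unitary_subgroup_eq: "unitary_subgroup K G = {v \<in> carrier R. v \<otimes>\<^bsub>R\<^esub> star v = \<one>\<^bsub>R\<^esub>}"
proof
  show "unitary_subgroup K G \<subseteq> {v \<in> carrier R. v \<otimes>\<^bsub>R\<^esub> star v = \<one>\<^bsub>R\<^esub>}"
    by (auto simp: unitary_subgroup_def normalized_units_def)
  show "{v \<in> carrier R. v \<otimes>\<^bsub>R\<^esub> star v = \<one>\<^bsub>R\<^esub>} \<subseteq> unitary_subgroup K G"
  proof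
    fix v assume "v \<in> {v \<in> carrier R. v \<otimes>\<^bsub>R\<^esub> star v = \<one>\<^bsub>R\<^esub>}"
    then have v: "v \<in> carrier R" "v \<otimes>\<^bsub>R\<^esub> star v = \<one>\<^bsub>R\<^esub>" by auto
    have v': "star v \<otimes>\<^bsub>R\<^esub> v = \<one>\<^bsub>R\<^esub>" using left_inverse_of_right_inverse[of v "star v"] v by simp
    have "v \<in> Units R" using v v' by (auto simp: Units_def)
    moreover have "inv\<^bsub>R\<^esub> v = star v"
      using R.inv_unique'[of v "star v"] v v' by simp
    moreover have "aug v \<otimes> aug v = aug (v \<otimes>\<^bsub>R\<^esub> star v)" using v(1) by (simp add: aug_mult aug_star)
    then have "aug v \<otimes> aug v = \<one> \<otimes> \<one>" unfolding v(2) by (simp add: one_eq_single aug_single)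
    then have "aug v = \<one>" by (rule K_square_inj[OF aug_closed[OF v(1)] K.one_closed])
    ultimately show "v \<in> unitary_subgroup K G" by (simp add: unitary_subgroup_def normalized_units_def)
  qed
qed

end

locale inverting_extension = char2_group_algebra K G
  for K :: "('k, 'm) ring_scheme" (structure) and G :: "('g, 'n) monoid_scheme" +
  fixes A :: "'g set" and b :: 'g and m :: nat
  assumes A_subgroup: "subgroup A G"
    and A_comm: "\<And>x y. x \<in> A \<Longrightarrow> y \<in> A \<Longrightarrow> x \<otimes>\<^bsub>G\<^esub> y = y \<otimes>\<^bsub>G\<^esub> x"
    and card_A: "card A = 2 ^ m"
    and b: "b \<in> carrier G" "b \<notin> A"
    and cosets: "\<And>x. x \<in> carrier G \<Longrightarrow> x \<notin> A \<Longrightarrow> x \<otimes>\<^bsub>G\<^esub> inv\<^bsub>G\<^esub> b \<in> A"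
    and inverts: "\<And>a. a \<in> A \<Longrightarrow> inv\<^bsub>G\<^esub> b \<otimes>\<^bsub>G\<^esub> a \<otimes>\<^bsub>G\<^esub> b = inv\<^bsub>G\<^esub> a"
begin

text \<open>
  The subgroup as a group of its own, on the plain record type for which the abelian case is
  stated.
\<close>

definition H :: "'g monoid" where "H = \<lparr>carrier = A, monoid.mult = (\<otimes>\<^bsub>G\<^esub>), one = \<one>\<^bsub>G\<^esub>\<rparr>"

lemma H_simps [simp]: "carrier H = A" "x \<otimes>\<^bsub>H\<^esub> y = x \<otimes>\<^bsub>G\<^esub> y" "\<one>\<^bsub>H\<^esub> = \<one>\<^bsub>G\<^esub>"
  by (simp_all add: H_def)

lemma A_closed [simp]: "a \<in> A \<Longrightarrow> a \<in> carrier G"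
  using subgroup.subset[OF A_subgroup] by auto

lemma A_mult [simp]: "x \<in> A \<Longrightarrow> y \<in> A \<Longrightarrow> x \<otimes>\<^bsub>G\<^esub> y \<in> A"
  by (rule subgroup.m_closed[OF A_subgroup])

lemma A_inv [simp]: "x \<in> A \<Longrightarrow> inv\<^bsub>G\<^esub> x \<in> A"
  by (rule subgroup.m_inv_closed[OF A_subgroup])

lemma A_one [simp]: "\<one>\<^bsub>G\<^esub> \<in> A"
  by (rule subgroup.one_closed[OF A_subgroup])

lemma H_comm_group: "comm_group H"
proof (rule comm_groupI)
  fix x assume "x \<in> carrier H"
  then show "\<exists>y\<in>carrier H. y \<otimes>\<^bsub>H\<^esub> x = \<one>\<^bsub>H\<^esub>" by (intro bexI[of _ "inv\<^bsub>G\<^esub> x"]) auto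
qed (auto simp: G.m_assoc intro: A_comm)

sublocale A: abelian_2_group_algebra K H m
proof -
  interpret H: comm_group H by (rule H_comm_group)
  have "finite A" by (rule finite_subset[OF subgroup.subset[OF A_subgroup] finite_G])
  then show "abelian_2_group_algebra K H m"
    by unfold_locales (simp_all add: finite_K one_one card_A)
qed

lemma H_inv [simp]: "x \<in> A \<Longrightarrow> inv\<^bsub>H\<^esub> x = inv\<^bsub>G\<^esub> x"
  using A.G.inv_equality[of "inv\<^bsub>G\<^esub> x" x] by simp

definition c where "c = b \<otimes>\<^bsub>G\<^esub> b"

lemma c_in_A: "c \<in> A"
proof (rule ccontr)
  assume "c \<notin> A"
  then have "c \<otimes>\<^bsub>G\<^esub> inv\<^bsub>G\<^esub> b \<in> A" using b cosets by (simp add: c_def)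
  then show False using b by (simp add: c_def G.m_assoc)
qed

lemma c_square: "c \<otimes>\<^bsub>G\<^esub> c = \<one>\<^bsub>G\<^esub>"
proof -
  have "inv\<^bsub>G\<^esub> c = inv\<^bsub>G\<^esub> b \<otimes>\<^bsub>G\<^esub> c \<otimes>\<^bsub>G\<^esub> b" using inverts[OF c_in_A] by simp
  also have "\<dots> = c" using b by (simp add: c_def G.m_assoc[symmetric])
  finally show ?thesis using G.r_inv[of c] c_in_A by simp
qed

lemma inv_b: "inv\<^bsub>G\<^esub> b = c \<otimes>\<^bsub>G\<^esub> b"
  using b c_square by (intro G.inv_equality) (simp_all add: c_def G.m_assoc)

lemma bij_coset: "bij_betw (\<lambda>a. a \<otimes>\<^bsub>G\<^esub> b) A (carrier G - A)"
proof (rule bij_betw_byWitness[where f' = "\<lambda>x. x \<otimes>\<^bsub>G\<^esub> inv\<^bsub>G\<^esub> b"])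
  show "(\<lambda>a. a \<otimes>\<^bsub>G\<^esub> b) ` A \<subseteq> carrier G - A"
  proof (rule image_subsetI)
    fix a assume a: "a \<in> A"
    have "b \<in> A" if "a \<otimes>\<^bsub>G\<^esub> b \<in> A"
    proof -
      have "inv\<^bsub>G\<^esub> a \<otimes>\<^bsub>G\<^esub> (a \<otimes>\<^bsub>G\<^esub> b) = b" using a b by (simp add: G.m_assoc[symmetric])
      then show ?thesis using A_mult[OF A_inv[OF a] that] by simp
    qed
    then show "a \<otimes>\<^bsub>G\<^esub> b \<in> carrier G - A" using a b by auto
  qed
qed (use b cosets in \<open>auto simp: G.m_assoc\<close>)

lemma ab_notin: "a \<in> A \<Longrightarrow> a \<otimes>\<^bsub>G\<^esub> b \<notin> A"
  using bij_betw_apply[OF bij_coset, of a] by simp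

definition "fst_part v = (\<lambda>a\<in>A. v a)"

definition "snd_part v = (\<lambda>a\<in>A. v (a \<otimes>\<^bsub>G\<^esub> b))"

lemma fst_part_closed [simp]: "v \<in> carrier R \<Longrightarrow> fst_part v \<in> carrier A.R"
  unfolding fst_part_def using A.lambda_in_R[of v] by simp

lemma snd_part_closed [simp]: "v \<in> carrier R \<Longrightarrow> snd_part v \<in> carrier A.R"
  unfolding snd_part_def using A.lambda_in_R[of "\<lambda>a. v (a \<otimes>\<^bsub>G\<^esub> b)"] b by simp

lemma part_simps [simp]: "a \<in> A \<Longrightarrow> fst_part v a = v a" "a \<in> A \<Longrightarrow> snd_part v a = v (a \<otimes>\<^bsub>G\<^esub> b)"
  by (simp_all add: fst_part_def snd_part_def)

lemma finsum_split:
  assumes f: "\<And>x. x \<in> carrier G \<Longrightarrow> f x \<in> carrier K"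
  shows "(\<Oplus>x\<in>carrier G. f x) = (\<Oplus>a\<in>A. f a) \<oplus> (\<Oplus>a\<in>A. f (a \<otimes>\<^bsub>G\<^esub> b))"
proof -
  have "carrier G = A \<union> (carrier G - A)" using A_closed by blast
  then have "(\<Oplus>x\<in>carrier G. f x) = (\<Oplus>x\<in>A \<union> (carrier G - A). f x)" by simp
  also have "\<dots> = (\<Oplus>a\<in>A. f a) \<oplus> (\<Oplus>x\<in>carrier G - A. f x)"
    using f finite_G A.finite_G by (intro K.finsum_Un_disjoint) auto
  also have "(\<Oplus>x\<in>carrier G - A. f x) = (\<Oplus>a\<in>A. f (a \<otimes>\<^bsub>G\<^esub> b))"
    using f by (intro K.finsum_bij_betw[OF bij_coset]) auto
  finally show ?thesis .
qed

lemma norm_coeff_A: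
  assumes v: "v \<in> carrier R" and g: "g \<in> A"
  shows "(v \<otimes>\<^bsub>R\<^esub> star v) g = A.norm (fst_part v) g \<oplus> A.norm (snd_part v) g"
proof -
  have "(v \<otimes>\<^bsub>R\<^esub> star v) g = (\<Oplus>a\<in>A. v a \<otimes> v (inv\<^bsub>G\<^esub> g \<otimes>\<^bsub>G\<^esub> a)) \<oplus>
      (\<Oplus>a\<in>A. v (a \<otimes>\<^bsub>G\<^esub> b) \<otimes> v (inv\<^bsub>G\<^esub> g \<otimes>\<^bsub>G\<^esub> (a \<otimes>\<^bsub>G\<^esub> b)))"
    using v g by (subst norm_coeff) (auto intro!: finsum_split)
  also have "(\<Oplus>a\<in>A. v a \<otimes> v (inv\<^bsub>G\<^esub> g \<otimes>\<^bsub>G\<^esub> a)) = A.norm (fst_part v) g"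
    using v g A.norm_coeff[of "fst_part v" "fst_part v" g]
    by (simp add: A.norm_def Pi_def cong: K.finsum_cong)
  also have "(\<Oplus>a\<in>A. v (a \<otimes>\<^bsub>G\<^esub> b) \<otimes> v (inv\<^bsub>G\<^esub> g \<otimes>\<^bsub>G\<^esub> (a \<otimes>\<^bsub>G\<^esub> b))) = A.norm (snd_part v) g"
    using v g b A.norm_coeff[of "snd_part v" "snd_part v" g]
    by (simp add: A.norm_def Pi_def G.m_assoc cong: K.finsum_cong)
  finally show ?thesis .
qed

text \<open>
  This is the summand \<open>(1 + c) u v b\<close> of \<open>x x\<^sup>*\<close>: moving \<open>b\<close> past an element of \<open>A\<close> inverts it, which
  turns the correlations of \<open>u\<close> and \<open>v\<close> into convolutions.
\<close>

lemma norm_coeff_coset: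
  assumes v: "v \<in> carrier R" and h: "h \<in> A"
  shows "(v \<otimes>\<^bsub>R\<^esub> star v) (h \<otimes>\<^bsub>G\<^esub> b) =
    (fst_part v \<otimes>\<^bsub>A.R\<^esub> snd_part v) (c \<otimes>\<^bsub>G\<^esub> h) \<oplus> (fst_part v \<otimes>\<^bsub>A.R\<^esub> snd_part v) h"
proof -
  have cG: "c \<in> carrier G" using c_in_A by simp
  have g: "inv\<^bsub>G\<^esub> (h \<otimes>\<^bsub>G\<^esub> b) \<otimes>\<^bsub>G\<^esub> a \<otimes>\<^bsub>G\<^esub> b = inv\<^bsub>G\<^esub> a \<otimes>\<^bsub>G\<^esub> h" if a: "a \<in> A" for a
  proof -
    have "inv\<^bsub>G\<^esub> (h \<otimes>\<^bsub>G\<^esub> b) \<otimes>\<^bsub>G\<^esub> a \<otimes>\<^bsub>G\<^esub> b = inv\<^bsub>G\<^esub> b \<otimes>\<^bsub>G\<^esub> (inv\<^bsub>G\<^esub> h \<otimes>\<^bsub>G\<^esub> a) \<otimes>\<^bsub>G\<^esub> b"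
      using a h b by (simp add: G.inv_mult_group G.m_assoc)
    also have "\<dots> = inv\<^bsub>G\<^esub> a \<otimes>\<^bsub>G\<^esub> h" using a h by (simp add: inverts G.inv_mult_group)
    finally show ?thesis .
  qed
  have g': "inv\<^bsub>G\<^esub> (h \<otimes>\<^bsub>G\<^esub> b) \<otimes>\<^bsub>G\<^esub> a = inv\<^bsub>G\<^esub> a \<otimes>\<^bsub>G\<^esub> (c \<otimes>\<^bsub>G\<^esub> h) \<otimes>\<^bsub>G\<^esub> b" if a: "a \<in> A" for a
  proof -
    have "inv\<^bsub>G\<^esub> (h \<otimes>\<^bsub>G\<^esub> b) \<otimes>\<^bsub>G\<^esub> a = (inv\<^bsub>G\<^esub> (h \<otimes>\<^bsub>G\<^esub> b) \<otimes>\<^bsub>G\<^esub> a \<otimes>\<^bsub>G\<^esub> b) \<otimes>\<^bsub>G\<^esub> inv\<^bsub>G\<^esub> b"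
      using a h b by (simp add: G.m_assoc)
    also have "\<dots> = inv\<^bsub>G\<^esub> a \<otimes>\<^bsub>G\<^esub> (h \<otimes>\<^bsub>G\<^esub> c) \<otimes>\<^bsub>G\<^esub> b"
      unfolding g[OF a] inv_b using a h b cG by (simp add: G.m_assoc)
    finally show ?thesis using A_comm[OF h c_in_A] by simp
  qed
  have "(v \<otimes>\<^bsub>R\<^esub> star v) (h \<otimes>\<^bsub>G\<^esub> b) = (\<Oplus>a\<in>A. v a \<otimes> v (inv\<^bsub>G\<^esub> (h \<otimes>\<^bsub>G\<^esub> b) \<otimes>\<^bsub>G\<^esub> a)) \<oplus>
      (\<Oplus>a\<in>A. v (a \<otimes>\<^bsub>G\<^esub> b) \<otimes> v (inv\<^bsub>G\<^esub> (h \<otimes>\<^bsub>G\<^esub> b) \<otimes>\<^bsub>G\<^esub> (a \<otimes>\<^bsub>G\<^esub> b)))"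
    using v h b by (subst norm_coeff) (auto intro!: finsum_split)
  also have "(\<Oplus>a\<in>A. v a \<otimes> v (inv\<^bsub>G\<^esub> (h \<otimes>\<^bsub>G\<^esub> b) \<otimes>\<^bsub>G\<^esub> a)) = (fst_part v \<otimes>\<^bsub>A.R\<^esub> snd_part v) (c \<otimes>\<^bsub>G\<^esub> h)"
    using v h b c_in_A A.mult_coeff[of "fst_part v" "snd_part v" "c \<otimes>\<^bsub>G\<^esub> h"]
    by (simp add: g' Pi_def cong: K.finsum_cong)
  also have "(\<Oplus>a\<in>A. v (a \<otimes>\<^bsub>G\<^esub> b) \<otimes> v (inv\<^bsub>G\<^esub> (h \<otimes>\<^bsub>G\<^esub> b) \<otimes>\<^bsub>G\<^esub> (a \<otimes>\<^bsub>G\<^esub> b))) =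
      (snd_part v \<otimes>\<^bsub>A.R\<^esub> fst_part v) h"
  proof -
    have "inv\<^bsub>G\<^esub> (h \<otimes>\<^bsub>G\<^esub> b) \<otimes>\<^bsub>G\<^esub> (a \<otimes>\<^bsub>G\<^esub> b) = inv\<^bsub>G\<^esub> a \<otimes>\<^bsub>G\<^esub> h" if "a \<in> A" for a
      using g[OF that] that h b by (simp add: G.m_assoc)
    then show ?thesis
      using v h b A.mult_coeff[of "snd_part v" "fst_part v" h] by (simp add: Pi_def cong: K.finsum_cong)
  qed
  also have "snd_part v \<otimes>\<^bsub>A.R\<^esub> fst_part v = fst_part v \<otimes>\<^bsub>A.R\<^esub> snd_part v"
    using v by (simp add: A.mult_comm)
  finally show ?thesis .
qed

lemma unitary_iff:
  assumes v: "v \<in> carrier R"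
  shows "v \<otimes>\<^bsub>R\<^esub> star v = \<one>\<^bsub>R\<^esub> \<longleftrightarrow>
    A.norm (fst_part v) \<oplus>\<^bsub>A.R\<^esub> A.norm (snd_part v) = \<one>\<^bsub>A.R\<^esub> \<and>
    A.invariant c (fst_part v \<otimes>\<^bsub>A.R\<^esub> snd_part v)"
proof -
  let ?n = "v \<otimes>\<^bsub>R\<^esub> star v"
  have "?n = \<one>\<^bsub>R\<^esub> \<longleftrightarrow> (\<forall>g\<in>carrier G. ?n g = \<one>\<^bsub>R\<^esub> g)"
    using v by (auto intro: group_algebra_eqI)
  also have "\<dots> \<longleftrightarrow> (\<forall>g\<in>A. ?n g = \<one>\<^bsub>R\<^esub> g) \<and> (\<forall>h\<in>A. ?n (h \<otimes>\<^bsub>G\<^esub> b) = \<one>\<^bsub>R\<^esub> (h \<otimes>\<^bsub>G\<^esub> b))"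
  proof -
    have "carrier G = A \<union> (\<lambda>a. a \<otimes>\<^bsub>G\<^esub> b) ` A" using bij_betw_imp_surj_on[OF bij_coset] A_closed by auto
    then show ?thesis by auto
  qed
  also have "(\<forall>g\<in>A. ?n g = \<one>\<^bsub>R\<^esub> g) \<longleftrightarrow>
      A.norm (fst_part v) \<oplus>\<^bsub>A.R\<^esub> A.norm (snd_part v) = \<one>\<^bsub>A.R\<^esub>"
  proof
    assume a: "\<forall>g\<in>A. ?n g = \<one>\<^bsub>R\<^esub> g"
    show "A.norm (fst_part v) \<oplus>\<^bsub>A.R\<^esub> A.norm (snd_part v) = \<one>\<^bsub>A.R\<^esub>"
    proof (rule A.group_algebra_eqI)
      fix g assume "g \<in> carrier H"
      then have g: "g \<in> A" by simp
      then show "(A.norm (fst_part v) \<oplus>\<^bsub>A.R\<^esub> A.norm (snd_part v)) g = \<one>\<^bsub>A.R\<^esub> g"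
        using a norm_coeff_A[OF v g] by (simp add: A.add_coeff A.one_coeff one_coeff)
    qed (use v in simp_all)
  next
    assume a: "A.norm (fst_part v) \<oplus>\<^bsub>A.R\<^esub> A.norm (snd_part v) = \<one>\<^bsub>A.R\<^esub>"
    show "\<forall>g\<in>A. ?n g = \<one>\<^bsub>R\<^esub> g"
    proof
      fix g assume g: "g \<in> A"
      have "?n g = (A.norm (fst_part v) \<oplus>\<^bsub>A.R\<^esub> A.norm (snd_part v)) g"
        using norm_coeff_A[OF v g] g by (simp add: A.add_coeff)
      then show "?n g = \<one>\<^bsub>R\<^esub> g" unfolding a using g by (simp add: A.one_coeff one_coeff)
    qed
  qed
  also have "(\<forall>h\<in>A. ?n (h \<otimes>\<^bsub>G\<^esub> b) = \<one>\<^bsub>R\<^esub> (h \<otimes>\<^bsub>G\<^esub> b)) \<longleftrightarrow>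
      A.invariant c (fst_part v \<otimes>\<^bsub>A.R\<^esub> snd_part v)"
    unfolding A.invariant_def H_simps
  proof (rule ball_cong[OF refl])
    fix h assume h: "h \<in> A"
    have "h \<otimes>\<^bsub>G\<^esub> b \<noteq> \<one>\<^bsub>G\<^esub>" using ab_notin[OF h] A_one by metis
    then have "\<one>\<^bsub>R\<^esub> (h \<otimes>\<^bsub>G\<^esub> b) = \<zero>" using h b by (simp add: one_coeff)
    moreover have "(fst_part v \<otimes>\<^bsub>A.R\<^esub> snd_part v) x \<in> carrier K" if "x \<in> A" for x
      using v that A.coeff_closed[of "fst_part v \<otimes>\<^bsub>A.R\<^esub> snd_part v" x] by simp
    ultimately show "?n (h \<otimes>\<^bsub>G\<^esub> b) = \<one>\<^bsub>R\<^esub> (h \<otimes>\<^bsub>G\<^esub> b) \<longleftrightarrow>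
        (fst_part v \<otimes>\<^bsub>A.R\<^esub> snd_part v) (c \<otimes>\<^bsub>G\<^esub> h) = (fst_part v \<otimes>\<^bsub>A.R\<^esub> snd_part v) h"
      using h c_in_A by (simp add: norm_coeff_coset[OF v h] K_eq_iff)
  qed
  finally show ?thesis .
qed

text \<open>
  The decomposition \<open>x = u + v b\<close>.
\<close>

lemma bij_parts: "bij_betw (\<lambda>v. (fst_part v, snd_part v)) (carrier R) (carrier A.R \<times> carrier A.R)"
proof -
  let ?j = "\<lambda>(u, w). \<lambda>g\<in>carrier G. if g \<in> A then u g else w (g \<otimes>\<^bsub>G\<^esub> inv\<^bsub>G\<^esub> b)"
  have j: "?j (u, w) \<in> carrier R" if "u \<in> carrier A.R" "w \<in> carrier A.R" for u w
    using that cosets A.coeff_closed[of u] A.coeff_closed[of w] by (auto intro!: lambda_in_R)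
  show ?thesis
  proof (rule bij_betw_byWitness[where f' = ?j])
    show "\<forall>v\<in>carrier R. ?j (fst_part v, snd_part v) = v"
    proof
      fix v assume v: "v \<in> carrier R"
      have "?j (fst_part v, snd_part v) \<in> carrier R" using v by (intro j) auto
      then show "?j (fst_part v, snd_part v) = v"
        using v b cosets by (intro group_algebra_eqI) (auto simp: G.m_assoc)
    qed
    show "\<forall>p\<in>carrier A.R \<times> carrier A.R. (fst_part (?j p), snd_part (?j p)) = p"
    proof
      fix p assume "p \<in> carrier A.R \<times> carrier A.R"
      then obtain u w where p: "p = (u, w)" and uw: "u \<in> carrier A.R" "w \<in> carrier A.R" by auto
      have "fst_part (?j (u, w)) = u"
        using uw j[OF uw] by (intro A.group_algebra_eqI) auto
      moreover have "snd_part (?j (u, w)) = w"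
        using uw j[OF uw] b ab_notin by (intro A.group_algebra_eqI) (auto simp: G.m_assoc)
      ultimately show "(fst_part (?j p), snd_part (?j p)) = p" by (simp only: p)
    qed
    show "(\<lambda>v. (fst_part v, snd_part v)) ` carrier R \<subseteq> carrier A.R \<times> carrier A.R" by auto
    show "?j ` (carrier A.R \<times> carrier A.R) \<subseteq> carrier R" using j by auto
  qed
qed

lemma card_unitary_subgroup:
  "card (unitary_subgroup K G) = card {(u, w). u \<in> carrier A.R \<and> w \<in> carrier A.R \<and>
    A.norm u \<oplus>\<^bsub>A.R\<^esub> A.norm w = \<one>\<^bsub>A.R\<^esub> \<and> A.invariant c (u \<otimes>\<^bsub>A.R\<^esub> w)}"
proof (rule bij_betw_same_card)
  let ?f = "\<lambda>v. (fst_part v, snd_part v)"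
  have "bij_betw ?f {v \<in> carrier R. v \<otimes>\<^bsub>R\<^esub> star v = \<one>\<^bsub>R\<^esub>} (?f ` {v \<in> carrier R. v \<otimes>\<^bsub>R\<^esub> star v = \<one>\<^bsub>R\<^esub>})"
    by (rule bij_betw_subset[OF bij_parts]) auto
  also have "?f ` {v \<in> carrier R. v \<otimes>\<^bsub>R\<^esub> star v = \<one>\<^bsub>R\<^esub>} =
      {(u, w). u \<in> carrier A.R \<and> w \<in> carrier A.R \<and>
        A.norm u \<oplus>\<^bsub>A.R\<^esub> A.norm w = \<one>\<^bsub>A.R\<^esub> \<and> A.invariant c (u \<otimes>\<^bsub>A.R\<^esub> w)}" (is "_ = ?P")
  proof
    show "?f ` {v \<in> carrier R. v \<otimes>\<^bsub>R\<^esub> star v = \<one>\<^bsub>R\<^esub>} \<subseteq> ?P" using unitary_iff by auto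
    show "?P \<subseteq> ?f ` {v \<in> carrier R. v \<otimes>\<^bsub>R\<^esub> star v = \<one>\<^bsub>R\<^esub>}"
    proof
      fix p assume p: "p \<in> ?P"
      then have "p \<in> ?f ` carrier R" unfolding bij_betw_imp_surj_on[OF bij_parts] by auto
      then obtain v where v: "v \<in> carrier R" "p = ?f v" by blast
      then show "p \<in> ?f ` {v \<in> carrier R. v \<otimes>\<^bsub>R\<^esub> star v = \<one>\<^bsub>R\<^esub>}" using p unitary_iff[OF v(1)] by auto
    qed
  qed
  finally show "bij_betw ?f (unitary_subgroup K G) ?P" by (simp only: unitary_subgroup_eq)
qed

end

context inverting_extension
begin

lemma card_unitary_subgroup_order_two:
  assumes "b \<otimes>\<^bsub>G\<^esub> b = \<one>\<^bsub>G\<^esub>"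
  shows "\<exists>n. 2 * n + 2 = 3 * card A + card A.tor \<and> card (unitary_subgroup K G) = order K ^ n"
proof -
  have c: "c = \<one>\<^bsub>G\<^esub>" using assms by (simp add: c_def)
  have inv: "A.invariant c u" for u by (simp add: A.invariant_def c)
  obtain s where s: "2 * s = card (carrier H) + card A.tor"
    "card {(u, v). u \<in> carrier A.R \<and> v \<in> carrier A.R \<and> A.norm u \<oplus>\<^bsub>A.R\<^esub> A.norm v = \<one>\<^bsub>A.R\<^esub>} =
      card {w \<in> carrier A.R. A.aug w = \<one>} * card (carrier K) ^ s"
    by (rule A.card_norm_pairs)
  have q: "card (carrier K) > 0" using finite_K K.zero_closed by (auto simp: card_gt_0_iff)
  obtain k where k: "card A = Suc k"
    using card_A by (metis not0_implies_Suc power_not_zero zero_neq_numeral)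
  then have "card {w \<in> carrier A.R. A.aug w = \<one>} = card (carrier K) ^ k"
    using A.card_aug_one q by simp
  then have "card (unitary_subgroup K G) = order K ^ (k + s)"
    using card_unitary_subgroup s(2) by (simp add: inv order_def power_add)
  then show ?thesis using s(1) k by (intro exI[of _ "k + s"]) simp
qed

lemma card_unitary_subgroup_order_four:
  assumes "b \<otimes>\<^bsub>G\<^esub> b \<noteq> \<one>\<^bsub>G\<^esub>"
  shows "\<exists>n. 2 * n + 2 = 2 * card A + card A.tor \<and>
    card (unitary_subgroup K G) = 2 * card A.square_torsion * order K ^ n"
proof -
  interpret C: central_involution K H m c
    by unfold_locales (use c_in_A c_square assms in \<open>auto simp: c_def\<close>)
  obtain i where i: "2 * i = card A" "card {u \<in> carrier A.R. A.invariant c u} = order K ^ i"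
    using C.card_invariant by (auto simp: order_def)
  obtain e where e: "2 * (e + 1) = card A + card A.tor"
    "card A.unitary = card A.square_torsion * order K ^ e"
    using card_unitary_abelian[OF A.abelian_2_group_algebra_axioms] by (auto simp: order_def)
  have "card (unitary_subgroup K G) = 2 * card A.square_torsion * order K ^ (e + i)"
    unfolding card_unitary_subgroup C.card_norm_pairs_invariant e(2) i(2) by (simp add: power_add)
  then show ?thesis using e(1) i(1) by (intro exI[of _ "e + i"]) simp
qed

end

section \<open>The two orders\<close>

theorem theorem2:
  fixes K :: "('k, 'm) ring_scheme" and G :: "('g, 'n) monoid_scheme"
    and A :: "'g set" and b :: 'g
  assumes "field K" and "finite (carrier K)" and "ring_characteristic K = 2"
    and "group G" and "finite (carrier G)" and "\<exists>n::nat. order G = 2 ^ n"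
    and "subgroup A G" and "comm_group (G\<lparr>carrier := A\<rparr>)" and "card (rcosets\<^bsub>G\<^esub> A) = 2"
    and "b \<in> carrier G - A"
    and "\<And>a. a \<in> A \<Longrightarrow> inv\<^bsub>G\<^esub> b \<otimes>\<^bsub>G\<^esub> a \<otimes>\<^bsub>G\<^esub> b = inv\<^bsub>G\<^esub> a"
  shows "(group.ord G b = 2 \<longrightarrow>
      real (card (unitary_subgroup K G)) =
        real (order K) powr ((3 * real (card A) + real (card (two_torsion G A)) - 2) / 2))
    \<and> (group.ord G b = 4 \<longrightarrow>
      real (card (unitary_subgroup K G)) =
        2 * real (card (two_torsion G (squares G A))) *
          real (order K) powr (real (card A) + 1 / 2 * real (card (two_torsion G A)) - 1))"
proof -
  interpret K: field K by (rule assms(1))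
  interpret G: group G by (rule assms(4))
  interpret A: comm_group "G\<lparr>carrier := A\<rparr>" by (rule assms(8))
  have AG: "A \<subseteq> carrier G" using assms(7) by (rule subgroup.subset)
  have bG: "b \<in> carrier G" "b \<notin> A" using assms(10) by auto
  have one_one: "\<one>\<^bsub>K\<^esub> \<oplus>\<^bsub>K\<^esub> \<one>\<^bsub>K\<^esub> = \<zero>\<^bsub>K\<^esub>"
  proof -
    have "\<one>\<^bsub>K\<^esub> [^]\<^bsub>add_monoid K\<^esub> (2::nat) = \<one>\<^bsub>add_monoid K\<^esub>"
      using group.pow_ord_eq_1[OF K.add.is_group, of "\<one>\<^bsub>K\<^esub>"] assms(3) by (simp add: ring_characteristic_def)
    then show ?thesis by (simp add: numeral_2_eq_2)
  qed
  obtain n where n: "order G = 2 ^ n" using assms(6) by auto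
  have lagrange: "2 * card A = 2 ^ n"
    using G.lagrange[OF assms(7)] assms(9) n by simp
  then have "n \<noteq> 0" by (cases n) auto
  then obtain m where "n = Suc m" by (metis not0_implies_Suc)
  then have card_A: "card A = 2 ^ m" using lagrange by simp
  have cosets: "x \<otimes>\<^bsub>G\<^esub> inv\<^bsub>G\<^esub> b \<in> A" if x: "x \<in> carrier G" "x \<notin> A" for x
  proof -
    have R: "A \<in> rcosets\<^bsub>G\<^esub> A" "A #>\<^bsub>G\<^esub> b \<in> rcosets\<^bsub>G\<^esub> A" "A #>\<^bsub>G\<^esub> x \<in> rcosets\<^bsub>G\<^esub> A"
      using assms(7) bG x AG by (auto intro: G.rcosetsI subgroup.subgroup_in_rcosets[OF assms(7) assms(4)])
    have ne: "A #>\<^bsub>G\<^esub> b \<noteq> A" "A #>\<^bsub>G\<^esub> x \<noteq> A"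
      using bG x G.rcos_self[OF _ assms(7)] by blast+
    obtain P Q where "rcosets\<^bsub>G\<^esub> A = {P, Q}" using assms(9) by (auto simp: card_2_iff)
    then have "A #>\<^bsub>G\<^esub> x = A #>\<^bsub>G\<^esub> b" using R ne by auto
    then have "x \<in> A #>\<^bsub>G\<^esub> b" using G.rcos_self[OF x(1) assms(7)] by simp
    then obtain a where "a \<in> A" "x = a \<otimes>\<^bsub>G\<^esub> b" by (auto simp: r_coset_def)
    then show ?thesis using bG AG by (auto simp: G.m_assoc subset_iff)
  qed
  have comm: "x \<otimes>\<^bsub>G\<^esub> y = y \<otimes>\<^bsub>G\<^esub> x" if "x \<in> A" "y \<in> A" for x y
    using A.m_comm[of x y] that by simp
  interpret E: inverting_extension K G A b m
  proof (intro inverting_extension.intro inverting_extension_axioms.intro)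
    show "char2_group_algebra K G" by unfold_locales (fact assms(2) assms(5) one_one)+
  qed (fact assms(7) card_A bG cosets comm assms(11))+
  have sq: "x [^]\<^bsub>G\<^esub> (2::nat) = x \<otimes>\<^bsub>G\<^esub> x" if "x \<in> carrier G" for x
    using that by (simp add: numeral_2_eq_2)
  have tor: "two_torsion G A = E.A.tor"
    using AG by (auto simp: two_torsion_def sq subset_iff)
  have sqtor: "two_torsion G (squares G A) = E.A.square_torsion"
    using AG by (auto simp: two_torsion_def squares_def E.A.square_torsion_def sq subset_iff image_iff)
  have q: "real (order K) > 0"
    using assms(2) K.zero_closed by (auto simp: order_def card_gt_0_iff)
  show ?thesis
  proof (intro conjI impI)
    assume "group.ord G b = 2"
    then have "b \<otimes>\<^bsub>G\<^esub> b = \<one>\<^bsub>G\<^esub>" using G.pow_ord_eq_1[OF bG(1)] sq[OF bG(1)] by simp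
    then obtain k where k: "2 * k + 2 = 3 * card A + card E.A.tor" "card (unitary_subgroup K G) = order K ^ k"
      using E.card_unitary_subgroup_order_two by blast
    from arg_cong[OF k(1), of real]
    have "(3 * real (card A) + real (card (two_torsion G A)) - 2) / 2 = real k"
      unfolding tor by simp
    then show "real (card (unitary_subgroup K G)) =
        real (order K) powr ((3 * real (card A) + real (card (two_torsion G A)) - 2) / 2)"
      using k(2) q by (simp add: powr_realpow)
  next
    assume "group.ord G b = 4"
    then have "\<not> group.ord G b dvd 2" by (auto dest: dvd_imp_le)
    then have "b \<otimes>\<^bsub>G\<^esub> b \<noteq> \<one>\<^bsub>G\<^esub>" using G.pow_eq_id[OF bG(1), of 2] sq[OF bG(1)] by simp
    then obtain k where k: "2 * k + 2 = 2 * card A + card E.A.tor"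
      "card (unitary_subgroup K G) = 2 * card E.A.square_torsion * order K ^ k"
      using E.card_unitary_subgroup_order_four by blast
    from arg_cong[OF k(1), of real]
    have "real (card A) + 1 / 2 * real (card (two_torsion G A)) - 1 = real k"
      unfolding tor by simp
    then show "real (card (unitary_subgroup K G)) =
        2 * real (card (two_torsion G (squares G A))) *
          real (order K) powr (real (card A) + 1 / 2 * real (card (two_torsion G A)) - 1)"
      using k(2) q by (simp add: powr_realpow sqtor)
  qed
qed

end
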